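(* Let $\mathcal{L}_1$ and $\mathcal{L}_2$ be $\lambda$-graph bisystems satisfying FPCC, and suppose that the dynamical systems $(\mathcal{X}_{\mathcal{L}_i},\sigma_{\mathcal{L}_i})$, $i=1,2$, are equivalently essentially free. Then the following two assertions are equivalent. (i) There exists an isomorphism $\varphi:\mathcal{G}_{\mathcal{L}_1}\to\mathcal{G}_{\mathcal{L}_2}$ of étale groupoids such that $d_{\mathcal{L}_2}\circ\varphi=d_{\mathcal{L}_1}$. (ii) There exists an isomorphism $\Phi:\mathcal{R}_{\mathcal{L}_1}\to\mathcal{R}_{\mathcal{L}_2}$ of $C^*$-algebras such that $\Phi(C(\mathcal{X}_{\mathcal{L}_1}))=C(\mathcal{X}_{\mathcal{L}_2})$ and $\Phi\circ\gamma_{\mathcal{L}_1,t}=\gamma_{\mathcal{L}_2,t}\circ\Phi$ for all $t\in\mathbb{T}$.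
   Context: **$\lambda$-graph bisystem.** Let $\Sigma$ be a finite set. A $\lambda$-graph bisystem $\mathcal{L}=(\mathcal{L}^-,\mathcal{L}^+)$ over $\Sigma$ consists of two labeled Bratteli diagrams $\mathcal{L}^{-}=(V,E^{-},\lambda^{-})$, $\mathcal{L}^{+}=(V,E^{+},\lambda^{+})$ with common vertex set $V=\bigcup_{l\ge 0}V_l$ and edge sets $E^-=\bigcup_{l\ge0}E^-_{l+1,l}$, $E^+=\bigcup_{l\ge0}E^+_{l,l+1}$ (all $V_l$, $E^-_{l+1,l}$, $E^+_{l,l+1}$ are finite, nonempty and pairwise disjoint, and $V_0$ is a singleton). An edge $e^-\in E^-_{l+1,l}$ has source $s(e^-)\in V_{l+1}$ and terminal $t(e^-)\in V_l$; an edge $e^+\in E^+_{l,l+1}$ has source $s(e^+)\in V_l$ and terminal $t(e^+)\in V_{l+1}$; labels are given by $\lambda^\pm:E^\pm\to\Sigma$. Required: (1) $\mathcal{L}^-$ is right-resolving: distinct $e^-,f^-\in E^-_{l+1,l}$ with $s(e^-)=s(f^-)$ have $\lambda^-(e^-)\neq\lambda^-(f^-)$; (2) $\mathcal{L}^+$ is left-resolving: distinct $e^+,f^+\in E^+_{l,l+1}$ with $t(e^+)=t(f^+)$ have $\lambda^+(e^+)\ne\lambda^+(f^+)$; (3) local property: for all $u\in V_l$, $v\in V_{l+2}$ there is a bijection $\phi$ from $\{(f^+,f^-)\in E^+_{l,l+1}\times E^-_{l+2,l+1}: s(f^+)=u,\ t(f^+)=t(f^-),\ s(f^-)=v\}$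 onto $\{(e^-,e^+)\in E^-_{l+1,l}\times E^+_{l+1,l+2}: t(e^-)=u,\ s(e^-)=s(e^+),\ t(e^+)=v\}$ such that $\phi(f^+,f^-)=(e^-,e^+)$ implies $\lambda^+(f^+)=\lambda^+(e^+)$ and $\lambda^-(f^-)=\lambda^-(e^-)$. For $v\in V_l$, let $F(v)\subset\Sigma^l$ be the set of words $(\lambda^-(e^-_l),\dots,\lambda^-(e^-_1))$ with $e^-_n\in E^-_{n,n-1}$, $s(e^-_l)=v$, $t(e_n^-)=s(e_{n-1}^-)$, and let $P(v)\subset\Sigma^l$ be the set of words $(\lambda^+(e^+_1),\dots,\lambda^+(e^+_l))$ with $e^+_n\in E^+_{n-1,n}$, $t(e^+_l)=v$, $s(e^+_n)=t(e^+_{n-1})$. FPCC means $F(v)=P(v)$ for all $v\in V$. **Configuration space.** Let $\mathbb{Z}^2[<]=\{(k,l)\in\mathbb{Z}^2: k<l\}$, $n(k,l)=l-k-1$, $V_{(k,l)}=V_{n(k,l)}$, $E^-_{(k-1,k),l}=E^-_{n(k-1,l),n(k,l)}$, $E^+_{k,(l,l+1)}=E^+_{n(k,l),n(k,l+1)}$. $\mathcal{X}_{\mathcal{L}}$ is the set of configurations $x=\{(v_{(k,l)},e^-_{(k-1,k),l},e^+_{k,(l,l+1)})\}_{(k,l)\in\mathbb{Z}^2[<]}$ with $v_{(k,l)}\in V_{(k,l)}$, $e^-_{(k-1,k),l}\in E^-_{(k-1,k),l}$, $e^+_{k,(l,l+1)}\in E^+_{k,(l,l+1)}$, such that $s(e^-_{(k-1,k),l})=v_{(k-1,l)}$,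 $t(e^-_{(k-1,k),l})=v_{(k,l)}$, $s(e^+_{k,(l,l+1)})=v_{(k,l)}$, $t(e^+_{k,(l,l+1)})=v_{(k,l+1)}$, and such that there is $(x_n)_{n\in\mathbb{Z}}\in\Sigma^{\mathbb{Z}}$ with $\lambda^-(e^-_{(k-1,k),l})=x_k$ and $\lambda^+(e^+_{k,(l,l+1)})=x_l$ for all $(k,l)\in\mathbb{Z}^2[<]$. For $v\in V_{(p,q)}$ and $\mu=(\mu_{p+1},\dots,\mu_{q-1})\in P(v)$ let $U_{(\mu;v)}$ be the set of $x\in\mathcal{X}_{\mathcal{L}}$ whose vertex at $(p,q)$ is $v$ and whose labels satisfy $(x_{p+1},\dots,x_{q-1})=\mu$. These sets (over all $(p,q)\in\mathbb{Z}^2[<]$) form a base of the topology of $\mathcal{X}_{\mathcal{L}}$ (a compact totally disconnected metrizable space). **Equivalence relation.** For $(p,q)\in\mathbb{Z}^2[<]$, $\square_{(p,q)}(x)$ is the restriction of $x$ to all $v_{(k,l)},e^-_{(k-1,k),l},e^+_{k,(l,l+1)}$ with $k\le p$, $l\ge q$. Put $R_{\mathcal{L}_{(p,q)}}=\{(x,z):\square_{(p,q)}(x)=\square_{(p,q)}(z)\}\subset\mathcal{X}_{\mathcal{L}}\times\mathcal{X}_{\mathcal{L}}$ with the relative product topology, and $R_{\mathcal{L}}=\bigcup_{(p,q)}R_{\mathcal{L}_{(p,q)}}$ with the inductive limit topology; it is an étale equivalence relation. **Groupoid and $C^*$-algebra.** The shift $\sigma_{\mathcal{L}}:\mathcal{X}_{\mathcal{L}}\to\mathcal{X}_{\mathcal{L}}$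 is the homeomorphism $\sigma_{\mathcal{L}}(x)=\{(v_{(k+1,l+1)},e^-_{(k,k+1),l+1},e^+_{k+1,(l+1,l+2)})\}_{(k,l)}$. $\mathcal{G}_{\mathcal{L}}=\{(x,n,z)\in\mathcal{X}_{\mathcal{L}}\times\mathbb{Z}\times\mathcal{X}_{\mathcal{L}}:(\sigma_{\mathcal{L}}^n(x),z)\in R_{\mathcal{L}}\}$, with topology transferred from $R_{\mathcal{L}}\times\mathbb{Z}$ via $(x,n,z)\mapsto((\sigma_{\mathcal{L}}^n(x),z),n)$, $r(x,n,z)=x$, $s(x,n,z)=z$, product $(x,n,z)(z,m,w)=(x,n+m,w)$, inverse $(z,-n,x)$; it is an étale amenable groupoid with unit space $\{(x,0,x)\}$ identified with $\mathcal{X}_{\mathcal{L}}$. $d_{\mathcal{L}}:\mathcal{G}_{\mathcal{L}}\to\mathbb{Z}$ is $d_{\mathcal{L}}(x,n,z)=n$. $\mathcal{R}_{\mathcal{L}}=C^*(\mathcal{G}_{\mathcal{L}})$ is the (full = reduced) groupoid $C^*$-algebra, $C(\mathcal{X}_{\mathcal{L}})$ is regarded as a subalgebra of it via the clopen unit space, and $\gamma_{\mathcal{L},t}$, $t\in\mathbb{T}=\mathbb{R}/\mathbb{Z}$, is the automorphism of $\mathcal{R}_{\mathcal{L}}$ given on $g\in C_c(\mathcal{G}_{\mathcal{L}})$ by $\gamma_{\mathcal{L},t}(g)(x,n,z)=\exp(2\pi\sqrt{-1}\,nt)\,g(x,n,z)$. $(\mathcal{X}_{\mathcal{L}},\sigma_{\mathcal{L}})$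 is equivalently essentially free if for each $n\in\mathbb{Z}$, $n\neq0$, the set $\{x\in\mathcal{X}_{\mathcal{L}}:(\sigma_{\mathcal{L}}^n(x),x)\in R_{\mathcal{L}}\}$ has empty interior. *)

theory Defs
  imports "HOL-Analysis.Analysis"
begin

section \<open>\<open>\<lambda>\<close>-graph bisystems\<close>

text \<open>
  \<open>EdgeM L l\<close> is $E^-_{l+1,l}$ and \<open>EdgeP L l\<close> is $E^+_{l,l+1}$; the edges of both diagrams live in
  one type, so that one source map and one terminal map serve both.
\<close>

record ('v, 'e, 'a) bisystem =
  Alph  :: "'a set"
  Vert  :: "nat \<Rightarrow> 'v set"
  EdgeM :: "nat \<Rightarrow> 'e set"
  EdgeP :: "nat \<Rightarrow> 'e set"
  source :: "'e \<Rightarrow> 'v"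
  terminal :: "'e \<Rightarrow> 'v"
  labelM :: "'e \<Rightarrow> 'a"
  labelP :: "'e \<Rightarrow> 'a"

definition paths_PM :: "('v, 'e, 'a) bisystem \<Rightarrow> nat \<Rightarrow> 'v \<Rightarrow> 'v \<Rightarrow> ('e \<times> 'e) set" where
  "paths_PM L l u v = {(fp, fm). fp \<in> EdgeP L l \<and> fm \<in> EdgeM L (l + 1) \<and>
     source L fp = u \<and> terminal L fp = terminal L fm \<and> source L fm = v}"

definition paths_MP :: "('v, 'e, 'a) bisystem \<Rightarrow> nat \<Rightarrow> 'v \<Rightarrow> 'v \<Rightarrow> ('e \<times> 'e) set" where
  "paths_MP L l u v = {(em, ep). em \<in> EdgeM L l \<and> ep \<in> EdgeP L (l + 1) \<and>
     terminal L em = u \<and> source L em = source L ep \<and> terminal L ep = v}"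

locale lambda_graph_bisystem =
  fixes L :: "('v, 'e, 'a) bisystem"
  assumes finite_Alph: "finite (Alph L)"
    and finite_Vert: "finite (Vert L l)"
    and finite_EdgeM: "finite (EdgeM L l)"
    and finite_EdgeP: "finite (EdgeP L l)"
    and Vert_nonempty: "Vert L l \<noteq> {}"
    and EdgeM_nonempty: "EdgeM L l \<noteq> {}"
    and EdgeP_nonempty: "EdgeP L l \<noteq> {}"
    and disjoint_Vert: "l \<noteq> m \<Longrightarrow> Vert L l \<inter> Vert L m = {}"
    and disjoint_EdgeM: "l \<noteq> m \<Longrightarrow> EdgeM L l \<inter> EdgeM L m = {}"
    and disjoint_EdgeP: "l \<noteq> m \<Longrightarrow> EdgeP L l \<inter> EdgeP L m = {}"
    and disjoint_EdgeM_EdgeP: "EdgeM L l \<inter> EdgeP L m = {}"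
    and Vert_0: "\<exists>v. Vert L 0 = {v}"
    and source_EdgeM: "e \<in> EdgeM L l \<Longrightarrow> source L e \<in> Vert L (l + 1)"
    and terminal_EdgeM: "e \<in> EdgeM L l \<Longrightarrow> terminal L e \<in> Vert L l"
    and source_EdgeP: "e \<in> EdgeP L l \<Longrightarrow> source L e \<in> Vert L l"
    and terminal_EdgeP: "e \<in> EdgeP L l \<Longrightarrow> terminal L e \<in> Vert L (l + 1)"
    and labelM_Alph: "e \<in> EdgeM L l \<Longrightarrow> labelM L e \<in> Alph L"
    and labelP_Alph: "e \<in> EdgeP L l \<Longrightarrow> labelP L e \<in> Alph L"
    and right_resolving:
      "\<lbrakk>e \<in> EdgeM L l; f \<in> EdgeM L l; e \<noteq> f; source L e = source L f\<rbrakk> \<Longrightarrow> labelM L e \<noteq> labelM L f"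
    and left_resolving:
      "\<lbrakk>e \<in> EdgeP L l; f \<in> EdgeP L l; e \<noteq> f; terminal L e = terminal L f\<rbrakk> \<Longrightarrow> labelP L e \<noteq> labelP L f"
    and local_property:
      "\<lbrakk>u \<in> Vert L l; v \<in> Vert L (l + 2)\<rbrakk> \<Longrightarrow>
         \<exists>\<phi>. bij_betw \<phi> (paths_PM L l u v) (paths_MP L l u v) \<and>
             (\<forall>fp fm em ep. (fp, fm) \<in> paths_PM L l u v \<and> \<phi> (fp, fm) = (em, ep) \<longrightarrow>
                labelP L fp = labelP L ep \<and> labelM L fm = labelM L em)"

text \<open>For \<open>v\<close> in \<open>Vert L l\<close>, the word sets $F(v)$ and $P(v)$; they contain only the empty word for \<open>l = 0\<close>.\<close>

definition F_words :: "('v, 'e, 'a) bisystem \<Rightarrow> nat \<Rightarrow> 'v \<Rightarrow> 'a list set" where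
  "F_words L l v = {w. \<exists>e. (\<forall>n\<in>{1..l}. e n \<in> EdgeM L (n - 1)) \<and>
     (l \<ge> 1 \<longrightarrow> source L (e l) = v) \<and>
     (\<forall>n\<in>{2..l}. terminal L (e n) = source L (e (n - 1))) \<and>
     w = map (\<lambda>n. labelM L (e n)) (rev [1..<l + 1])}"

definition P_words :: "('v, 'e, 'a) bisystem \<Rightarrow> nat \<Rightarrow> 'v \<Rightarrow> 'a list set" where
  "P_words L l v = {w. \<exists>e. (\<forall>n\<in>{1..l}. e n \<in> EdgeP L (n - 1)) \<and>
     (l \<ge> 1 \<longrightarrow> terminal L (e l) = v) \<and>
     (\<forall>n\<in>{2..l}. source L (e n) = terminal L (e (n - 1))) \<and>
     w = map (\<lambda>n. labelP L (e n)) [1..<l + 1]}"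

definition FPCC :: "('v, 'e, 'a) bisystem \<Rightarrow> bool" where
  "FPCC L \<longleftrightarrow> (\<forall>l. \<forall>v\<in>Vert L l. F_words L l v = P_words L l v)"


section \<open>The configuration space and its shift\<close>

definition Z2lt :: "(int \<times> int) set" where
  "Z2lt = {(k, l). k < l}"

definition lev :: "int \<Rightarrow> int \<Rightarrow> nat" where
  "lev k l = nat (l - k - 1)"

text \<open>
  A configuration sends $(k,l)$ with $k<l$ to the triple
  $(v_{(k,l)}, e^-_{(k-1,k),l}, e^+_{k,(l,l+1)})$, and is \<open>undefined\<close> at all other pairs.
\<close>

type_synonym ('v, 'e) config = "int \<times> int \<Rightarrow> 'v \<times> 'e \<times> 'e"

definition vx :: "('v, 'e) config \<Rightarrow> int \<Rightarrow> int \<Rightarrow> 'v" where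
  "vx x k l = fst (x (k, l))"

definition em :: "('v, 'e) config \<Rightarrow> int \<Rightarrow> int \<Rightarrow> 'e" where
  "em x k l = fst (snd (x (k, l)))"

definition ep :: "('v, 'e) config \<Rightarrow> int \<Rightarrow> int \<Rightarrow> 'e" where
  "ep x k l = snd (snd (x (k, l)))"

definition label_sequence ::
    "('v, 'e, 'a) bisystem \<Rightarrow> ('v, 'e) config \<Rightarrow> (int \<Rightarrow> 'a) \<Rightarrow> bool" where
  "label_sequence L x a \<longleftrightarrow> range a \<subseteq> Alph L \<and>
     (\<forall>(k, l)\<in>Z2lt. labelM L (em x k l) = a k \<and> labelP L (ep x k l) = a l)"

definition XL :: "('v, 'e, 'a) bisystem \<Rightarrow> ('v, 'e) config set" where
  "XL L = {x. x \<in> extensional Z2lt \<and>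
     (\<forall>(k, l)\<in>Z2lt.
        vx x k l \<in> Vert L (lev k l) \<and> em x k l \<in> EdgeM L (lev k l) \<and> ep x k l \<in> EdgeP L (lev k l) \<and>
        source L (em x k l) = vx x (k - 1) l \<and> terminal L (em x k l) = vx x k l \<and>
        source L (ep x k l) = vx x k l \<and> terminal L (ep x k l) = vx x k (l + 1)) \<and>
     (\<exists>a. label_sequence L x a)}"

definition cylinder ::
    "('v, 'e, 'a) bisystem \<Rightarrow> int \<Rightarrow> int \<Rightarrow> 'a list \<Rightarrow> 'v \<Rightarrow> ('v, 'e) config set" where
  "cylinder L p q \<mu> v =
     {x\<in>XL L. vx x p q = v \<and> (\<exists>a. label_sequence L x a \<and> map a [p+1..q-1] = \<mu>)}"

definition Xtop :: "('v, 'e, 'a) bisystem \<Rightarrow> ('v, 'e) config topology" where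
  "Xtop L = topology_generated_by
     {cylinder L p q \<mu> v | p q \<mu> v. (p, q) \<in> Z2lt \<and> v \<in> Vert L (lev p q) \<and> \<mu> \<in> P_words L (lev p q) v}"

definition shift :: "('v, 'e) config \<Rightarrow> ('v, 'e) config" where
  "shift x = (\<lambda>(k, l). x (k + 1, l + 1))"

text \<open>The integer powers of the bijection \<open>shift\<close> (see \<open>shift_pow_1\<close> and \<open>shift_pow_add\<close>).\<close>

definition shift_pow :: "int \<Rightarrow> ('v, 'e) config \<Rightarrow> ('v, 'e) config" where
  "shift_pow n x = (\<lambda>(k, l). x (k + n, l + n))"

lemma shift_pow_0: "shift_pow 0 x = x"
  by (simp add: shift_pow_def)

lemma shift_pow_1: "shift_pow 1 = shift"
  by (simp add: shift_pow_def shift_def fun_eq_iff)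

lemma shift_pow_add: "shift_pow (m + n) x = shift_pow m (shift_pow n x)"
  by (simp add: shift_pow_def fun_eq_iff ac_simps)


section \<open>The equivalence relation\<close>

definition Rpq ::
    "('v, 'e, 'a) bisystem \<Rightarrow> int \<Rightarrow> int \<Rightarrow> (('v, 'e) config \<times> ('v, 'e) config) set" where
  "Rpq L p q = {(x, z). x \<in> XL L \<and> z \<in> XL L \<and>
     restrict x {(k, l). k \<le> p \<and> q \<le> l} = restrict z {(k, l). k \<le> p \<and> q \<le> l}}"

definition Rpq_top ::
    "('v, 'e, 'a) bisystem \<Rightarrow> int \<Rightarrow> int \<Rightarrow> (('v, 'e) config \<times> ('v, 'e) config) topology" where
  "Rpq_top L p q = subtopology (prod_topology (Xtop L) (Xtop L)) (Rpq L p q)"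

definition RL :: "('v, 'e, 'a) bisystem \<Rightarrow> (('v, 'e) config \<times> ('v, 'e) config) set" where
  "RL L = (\<Union>(p, q)\<in>Z2lt. Rpq L p q)"

definition RL_top ::
    "('v, 'e, 'a) bisystem \<Rightarrow> (('v, 'e) config \<times> ('v, 'e) config) topology" where
  "RL_top L = topology (\<lambda>W. W \<subseteq> RL L \<and> (\<forall>(p, q)\<in>Z2lt. openin (Rpq_top L p q) (W \<inter> Rpq L p q)))"

lemma openin_RL_top:
  "openin (RL_top L) W \<longleftrightarrow>
     W \<subseteq> RL L \<and> (\<forall>(p, q)\<in>Z2lt. openin (Rpq_top L p q) (W \<inter> Rpq L p q))"
proof -
  have "S \<inter> T \<inter> Rpq L p q = (S \<inter> Rpq L p q) \<inter> (T \<inter> Rpq L p q)" for S T p q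
    by blast
  moreover have "openin (Rpq_top L p q) (\<Union>K \<inter> Rpq L p q)"
    if "\<forall>S\<in>K. openin (Rpq_top L p q) (S \<inter> Rpq L p q)" for K p q
  proof -
    have "openin (Rpq_top L p q) (\<Union>((\<lambda>S. S \<inter> Rpq L p q) ` K))"
      using that by (intro openin_Union) blast
    moreover have "\<Union>K \<inter> Rpq L p q = \<Union>((\<lambda>S. S \<inter> Rpq L p q) ` K)"
      by blast
    ultimately show ?thesis
      by (simp only:)
  qed
  ultimately have "istopology (\<lambda>W. W \<subseteq> RL L \<and> (\<forall>(p, q)\<in>Z2lt. openin (Rpq_top L p q) (W \<inter> Rpq L p q)))"
    unfolding istopology_def case_prod_beta
    by (intro conjI allI impI ballI) (simp_all add: openin_Int openin_Union le_infI1 Sup_le_iff)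
  then show ?thesis
    by (simp add: RL_top_def topology_inverse')
qed

definition equivalently_essentially_free :: "('v, 'e, 'a) bisystem \<Rightarrow> bool" where
  "equivalently_essentially_free L \<longleftrightarrow>
     (\<forall>n::int. n \<noteq> 0 \<longrightarrow> Xtop L interior_of {x\<in>XL L. (shift_pow n x, x) \<in> RL L} = {})"


section \<open>Topological groupoids\<close>

text \<open>
  The carrier of a groupoid is the space of its topology, and \<open>grange\<close> and \<open>gsource\<close> take values in
  the units, regarded as elements of the groupoid.
\<close>

record 'g top_groupoid =
  gtop :: "'g topology"
  grange :: "'g \<Rightarrow> 'g"
  gsource :: "'g \<Rightarrow> 'g"
  gmult :: "'g \<Rightarrow> 'g \<Rightarrow> 'g"
  ginv :: "'g \<Rightarrow> 'g"

abbreviation gcarrier :: "'g top_groupoid \<Rightarrow> 'g set" where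
  "gcarrier G \<equiv> topspace (gtop G)"

definition groupoid_iso :: "'g top_groupoid \<Rightarrow> 'h top_groupoid \<Rightarrow> ('g \<Rightarrow> 'h) \<Rightarrow> bool" where
  "groupoid_iso G H \<phi> \<longleftrightarrow> homeomorphic_map (gtop G) (gtop H) \<phi> \<and>
     (\<forall>g\<in>gcarrier G. grange H (\<phi> g) = \<phi> (grange G g) \<and> gsource H (\<phi> g) = \<phi> (gsource G g) \<and>
        ginv H (\<phi> g) = \<phi> (ginv G g)) \<and>
     (\<forall>g\<in>gcarrier G. \<forall>h\<in>gcarrier G. gsource G g = grange G h \<longrightarrow>
        \<phi> (gmult G g h) = gmult H (\<phi> g) (\<phi> h))"

type_synonym ('v, 'e) garrow = "('v, 'e) config \<times> int \<times> ('v, 'e) config"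

definition GL_set :: "('v, 'e, 'a) bisystem \<Rightarrow> ('v, 'e) garrow set" where
  "GL_set L = {(x, n, z). x \<in> XL L \<and> z \<in> XL L \<and> (shift_pow n x, z) \<in> RL L}"

definition GL :: "('v, 'e, 'a) bisystem \<Rightarrow> ('v, 'e) garrow top_groupoid" where
  "GL L = \<lparr>
     gtop = pullback_topology (GL_set L) (\<lambda>(x, n, z). ((shift_pow n x, z), n))
              (prod_topology (RL_top L) (discrete_topology UNIV)),
     grange = (\<lambda>(x, n, z). (x, 0, x)),
     gsource = (\<lambda>(x, n, z). (z, 0, z)),
     gmult = (\<lambda>(x, n, z) (z', m, w). (x, n + m, w)),
     ginv = (\<lambda>(x, n, z). (z, - n, x))\<rparr>"

definition dL :: "('v, 'e) garrow \<Rightarrow> int" where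
  "dL = (\<lambda>(x, n, z). n)"

lemma topspace_Xtop: "topspace (Xtop L) = XL L"
proof -
  have "x \<in> topspace (Xtop L)" if "x \<in> XL L" for x
  proof -
    have "vx x 0 1 \<in> Vert L (lev 0 1)"
      using that by (auto simp: XL_def Z2lt_def)
    moreover have "[] \<in> P_words L (lev 0 1) (vx x 0 1)"
      by (auto simp: P_words_def lev_def)
    ultimately have "openin (Xtop L) (cylinder L 0 1 [] (vx x 0 1))"
      unfolding Xtop_def by (intro topology_generated_by_Basis) (force simp: Z2lt_def)
    moreover have "x \<in> cylinder L 0 1 [] (vx x 0 1)"
      using that by (auto simp: cylinder_def XL_def)
    ultimately show ?thesis
      by (meson openin_subset subsetD)
  qed
  then show ?thesis
    by (auto simp: Xtop_def topology_generated_by_topspace cylinder_def)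
qed

lemma topspace_RL_top: "topspace (RL_top L) = RL L"
proof -
  have "topspace (Rpq_top L p q) = Rpq L p q" for p q
    by (auto simp: Rpq_top_def topspace_Xtop Rpq_def)
  then have "openin (Rpq_top L p q) (Rpq L p q)" for p q
    by (metis openin_topspace)
  moreover have "RL L \<inter> Rpq L p q = Rpq L p q" if "(p, q) \<in> Z2lt" for p q
    using that by (auto simp: RL_def)
  ultimately have "openin (RL_top L) (RL L)"
    unfolding openin_RL_top by auto
  then have "RL L \<subseteq> topspace (RL_top L)"
    by (rule openin_subset)
  moreover have "topspace (RL_top L) \<subseteq> RL L"
    using openin_RL_top[of L "topspace (RL_top L)"] by simp
  ultimately show ?thesis
    by simp
qed

lemma gcarrier_GL: "gcarrier (GL L) = GL_set L"
proof -
  have "gcarrier (GL L) = (\<lambda>(x, n, z). ((shift_pow n x, z), n)) -` (RL L \<times> UNIV) \<inter> GL_set L"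
    by (simp add: GL_def topspace_pullback_topology topspace_RL_top)
  also have "\<dots> = GL_set L"
    unfolding GL_set_def by (rule Int_absorb1) clarsimp
  finally show ?thesis .
qed


section \<open>The Hilbert space $\ell^2$\<close>

typedef 'g ell2 = "{\<xi> :: 'g \<Rightarrow> complex. (\<lambda>g. (cmod (\<xi> g))\<^sup>2) summable_on UNIV}"
  morphisms ell2_fun Abs_ell2
  by (rule exI[of _ "\<lambda>_. 0"]) simp

setup_lifting type_definition_ell2

lemma ell2_summable: "(\<lambda>g. (cmod (ell2_fun \<xi> g))\<^sup>2) summable_on UNIV"
  using ell2_fun[of \<xi>] by simp

lemma ell2_add_aux:
  fixes f h :: "'g \<Rightarrow> complex"
  assumes "(\<lambda>g. (cmod (f g))\<^sup>2) summable_on UNIV" "(\<lambda>g. (cmod (h g))\<^sup>2) summable_on UNIV"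
  shows "(\<lambda>g. (cmod (f g + h g))\<^sup>2) summable_on UNIV"
proof (rule summable_on_comparison_test)
  show "(\<lambda>g. 2 * (cmod (f g))\<^sup>2 + 2 * (cmod (h g))\<^sup>2) summable_on UNIV"
    by (intro summable_on_add summable_on_cmult_right assms)
  show "(cmod (f g + h g))\<^sup>2 \<le> 2 * (cmod (f g))\<^sup>2 + 2 * (cmod (h g))\<^sup>2" for g
  proof -
    have "(cmod (f g + h g))\<^sup>2 \<le> (cmod (f g) + cmod (h g))\<^sup>2"
      by (intro power_mono norm_triangle_ineq) simp
    also have "\<dots> \<le> 2 * (cmod (f g))\<^sup>2 + 2 * (cmod (h g))\<^sup>2"
      using sum_squares_bound[of "cmod (f g)" "cmod (h g)"] by (simp add: power2_sum)
    finally show ?thesis .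
  qed
qed simp

lemma ell2_mult_aux:
  fixes f u :: "'g \<Rightarrow> complex"
  assumes "(\<lambda>g. (cmod (f g))\<^sup>2) summable_on UNIV" "\<And>g. cmod (u g) \<le> B"
  shows "(\<lambda>g. (cmod (u g * f g))\<^sup>2) summable_on UNIV"
proof (rule summable_on_comparison_test)
  show "(\<lambda>g. B\<^sup>2 * (cmod (f g))\<^sup>2) summable_on UNIV"
    by (intro summable_on_cmult_right assms)
  show "(cmod (u g * f g))\<^sup>2 \<le> B\<^sup>2 * (cmod (f g))\<^sup>2" for g
    using assms(2)[of g] by (auto simp: norm_mult power_mult_distrib intro!: mult_right_mono power_mono)
qed simp

lemma ell2_inner_summable:
  "(\<lambda>g. inner (ell2_fun \<xi> g) (ell2_fun \<eta> g)) summable_on UNIV"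
proof -
  have "(\<lambda>g. norm (inner (ell2_fun \<xi> g) (ell2_fun \<eta> g))) summable_on UNIV"
  proof (rule summable_on_comparison_test)
    show "(\<lambda>g. (cmod (ell2_fun \<xi> g))\<^sup>2 + (cmod (ell2_fun \<eta> g))\<^sup>2) summable_on UNIV"
      by (intro summable_on_add ell2_summable)
    show "norm (inner (ell2_fun \<xi> g) (ell2_fun \<eta> g))
        \<le> (cmod (ell2_fun \<xi> g))\<^sup>2 + (cmod (ell2_fun \<eta> g))\<^sup>2" for g
    proof -
      have "norm (inner (ell2_fun \<xi> g) (ell2_fun \<eta> g)) \<le> cmod (ell2_fun \<xi> g) * cmod (ell2_fun \<eta> g)"
        using Cauchy_Schwarz_ineq2 by auto
      also have "\<dots> \<le> (cmod (ell2_fun \<xi> g))\<^sup>2 + (cmod (ell2_fun \<eta> g))\<^sup>2"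
        using sum_squares_bound[of "cmod (ell2_fun \<xi> g)" "cmod (ell2_fun \<eta> g)"]
          mult_nonneg_nonneg[OF norm_ge_zero[of "ell2_fun \<xi> g"] norm_ge_zero[of "ell2_fun \<eta> g"]]
        by linarith
      finally show ?thesis .
    qed
  qed simp
  then show ?thesis
    by (rule abs_summable_summable)
qed

instantiation ell2 :: (type) real_vector
begin

lift_definition zero_ell2 :: "'a ell2" is "\<lambda>_. 0" by simp

lift_definition plus_ell2 :: "'a ell2 \<Rightarrow> 'a ell2 \<Rightarrow> 'a ell2" is "\<lambda>\<xi> \<eta> g. \<xi> g + \<eta> g"
  by (rule ell2_add_aux)

lift_definition uminus_ell2 :: "'a ell2 \<Rightarrow> 'a ell2" is "\<lambda>\<xi> g. - \<xi> g" by simp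

lift_definition minus_ell2 :: "'a ell2 \<Rightarrow> 'a ell2 \<Rightarrow> 'a ell2" is "\<lambda>\<xi> \<eta> g. \<xi> g - \<eta> g"
  using ell2_add_aux[where h = "\<lambda>g. - _ g"] by force

lift_definition scaleR_ell2 :: "real \<Rightarrow> 'a ell2 \<Rightarrow> 'a ell2" is "\<lambda>r \<xi> g. r *\<^sub>R \<xi> g"
  by (simp add: power_mult_distrib summable_on_cmult_right)

instance
  by standard (transfer; simp add: fun_eq_iff algebra_simps)+

end

instantiation ell2 :: (type) real_inner
begin

definition inner_ell2 :: "'a ell2 \<Rightarrow> 'a ell2 \<Rightarrow> real" where
  "inner_ell2 \<xi> \<eta> = (\<Sum>\<^sub>\<infinity>g. inner (ell2_fun \<xi> g) (ell2_fun \<eta> g))"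

definition norm_ell2 :: "'a ell2 \<Rightarrow> real" where
  "norm_ell2 \<xi> = sqrt (inner \<xi> \<xi>)"

definition dist_ell2 :: "'a ell2 \<Rightarrow> 'a ell2 \<Rightarrow> real" where
  "dist_ell2 \<xi> \<eta> = norm (\<xi> - \<eta>)"

definition sgn_ell2 :: "'a ell2 \<Rightarrow> 'a ell2" where
  "sgn_ell2 \<xi> = \<xi> /\<^sub>R norm \<xi>"

definition uniformity_ell2 :: "('a ell2 \<times> 'a ell2) filter" where
  "uniformity_ell2 = (INF e\<in>{0<..}. principal {(x, y). dist x y < e})"

definition open_ell2 :: "'a ell2 set \<Rightarrow> bool" where
  "open_ell2 U \<longleftrightarrow> (\<forall>x\<in>U. eventually (\<lambda>(x', y). x' = x \<longrightarrow> y \<in> U) uniformity)"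

instance
proof
  fix a b c :: "'a ell2" and r :: real
  show "dist a b = norm (a - b)" "sgn a = a /\<^sub>R norm a" "norm a = sqrt (inner a a)"
    by (simp_all add: dist_ell2_def sgn_ell2_def norm_ell2_def)
  show "uniformity = (INF e\<in>{0<..}. principal {(x, y :: 'a ell2). dist x y < e})"
    by (rule uniformity_ell2_def)
  show "open U \<longleftrightarrow> (\<forall>x\<in>U. eventually (\<lambda>(x', y). x' = x \<longrightarrow> y \<in> U) uniformity)" for U :: "'a ell2 set"
    by (rule open_ell2_def)
  show "inner a b = inner b a"
    by (simp add: inner_ell2_def inner_commute)
  show "inner (a + b) c = inner a c + inner b c"
    by (simp add: inner_ell2_def plus_ell2.rep_eq inner_add_left infsum_add ell2_inner_summable)
  show "inner (r *\<^sub>R a) b = r * inner a b"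
    by (simp add: inner_ell2_def scaleR_ell2.rep_eq infsum_cmult_right')
  show "0 \<le> inner a a"
    by (simp add: inner_ell2_def infsum_nonneg)
  show "inner a a = 0 \<longleftrightarrow> a = 0"
  proof
    assume "inner a a = 0"
    then have "inner (ell2_fun a g) (ell2_fun a g) = 0" for g
      using nonneg_infsum_le_0D[OF _ ell2_inner_summable[of a a]] by (simp add: inner_ell2_def)
    then show "a = 0"
      by (simp add: ell2_fun_inject[symmetric] zero_ell2.rep_eq fun_eq_iff)
  qed (simp add: inner_ell2_def zero_ell2.rep_eq)
qed

end

text \<open>The complex inner product, linear in the first argument; \<open>inner\<close> is its real part.\<close>

definition cinner :: "'g ell2 \<Rightarrow> 'g ell2 \<Rightarrow> complex" where
  "cinner \<xi> \<eta> = (\<Sum>\<^sub>\<infinity>g. ell2_fun \<xi> g * cnj (ell2_fun \<eta> g))"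

lift_definition mult_ell2 :: "complex \<Rightarrow> 'g ell2 \<Rightarrow> 'g ell2" is "\<lambda>c \<xi> g. c * \<xi> g"
  by (rule ell2_mult_aux[where B = "cmod _"]) auto

lemma bounded_linear_mult_ell2: "bounded_linear (mult_ell2 c)"
proof (rule bounded_linear_intro)
  show "mult_ell2 c (\<xi> + \<eta>) = mult_ell2 c \<xi> + mult_ell2 c \<eta>" for \<xi> \<eta> :: "'a ell2"
    by transfer (simp add: algebra_simps)
  show "mult_ell2 c (r *\<^sub>R \<xi>) = r *\<^sub>R mult_ell2 c \<xi>" for r and \<xi> :: "'a ell2"
    by transfer simp
  show "norm (mult_ell2 c \<xi>) \<le> norm \<xi> * cmod c" for \<xi> :: "'a ell2"
  proof -
    have "inner (mult_ell2 c \<xi>) (mult_ell2 c \<xi>) = (cmod c)\<^sup>2 * inner \<xi> \<xi>"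
      by (simp add: inner_ell2_def mult_ell2.rep_eq dot_square_norm[where 'a = complex] norm_mult power_mult_distrib
          infsum_cmult_right')
    then show ?thesis
      by (simp add: norm_eq_sqrt_inner real_sqrt_mult)
  qed
qed


section \<open>Groupoid $C^*$-algebras\<close>

text \<open>Complex multiples and adjoints of bounded operators, which are only real linear by their type.\<close>

definition cscale :: "complex \<Rightarrow> ('g ell2 \<Rightarrow>\<^sub>L 'g ell2) \<Rightarrow> ('g ell2 \<Rightarrow>\<^sub>L 'g ell2)" where
  "cscale c T = Blinfun (mult_ell2 c) o\<^sub>L T"

definition is_adjoint :: "('g ell2 \<Rightarrow>\<^sub>L 'g ell2) \<Rightarrow> ('g ell2 \<Rightarrow>\<^sub>L 'g ell2) \<Rightarrow> bool" where
  "is_adjoint T S \<longleftrightarrow> (\<forall>\<xi> \<eta>. cinner (T \<xi>) \<eta> = cinner \<xi> (S \<eta>))"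

definition cstar_iso ::
    "('g ell2 \<Rightarrow>\<^sub>L 'g ell2) set \<Rightarrow> ('h ell2 \<Rightarrow>\<^sub>L 'h ell2) set \<Rightarrow>
     (('g ell2 \<Rightarrow>\<^sub>L 'g ell2) \<Rightarrow> ('h ell2 \<Rightarrow>\<^sub>L 'h ell2)) \<Rightarrow> bool" where
  "cstar_iso A B \<Phi> \<longleftrightarrow> bij_betw \<Phi> A B \<and>
     (\<forall>S\<in>A. \<forall>T\<in>A. \<Phi> (S + T) = \<Phi> S + \<Phi> T) \<and>
     (\<forall>c. \<forall>T\<in>A. \<Phi> (cscale c T) = cscale c (\<Phi> T)) \<and>
     (\<forall>S\<in>A. \<forall>T\<in>A. \<Phi> (S o\<^sub>L T) = \<Phi> S o\<^sub>L \<Phi> T) \<and>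
     (\<forall>S\<in>A. \<forall>T\<in>A. is_adjoint T S \<longrightarrow> is_adjoint (\<Phi> T) (\<Phi> S))"

text \<open>The compactly supported continuous functions on the (Hausdorff) groupoid, extended by zero.\<close>

definition Cc :: "'g top_groupoid \<Rightarrow> ('g \<Rightarrow> complex) set" where
  "Cc G = {f. continuous_map (gtop G) euclidean f \<and> (\<forall>g. g \<notin> gcarrier G \<longrightarrow> f g = 0) \<and>
     compactin (gtop G) (gtop G closure_of {g\<in>gcarrier G. f g \<noteq> 0})}"

definition convolution :: "'g top_groupoid \<Rightarrow> ('g \<Rightarrow> complex) \<Rightarrow> ('g \<Rightarrow> complex) \<Rightarrow> 'g \<Rightarrow> complex" where
  "convolution G f h \<gamma> =
     (\<Sum>\<^sub>\<infinity>(\<alpha>, \<beta>)\<in>{(\<alpha>, \<beta>). \<alpha> \<in> gcarrier G \<and> \<beta> \<in> gcarrier G \<and> gsource G \<alpha> = grange G \<beta> \<and>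
        gmult G \<alpha> \<beta> = \<gamma>}. f \<alpha> * h \<beta>)"

text \<open>
  \<open>T\<close> is the operator of left convolution by \<open>f\<close>.  On $\ell^2(G) = \bigoplus_u \ell^2(G_u)$, where
  $G_u$ is the set of arrows with source \<open>u\<close>, this is the direct sum of all regular representations
  of $C_c(G)$; on functions supported off the carrier of \<open>G\<close> it is zero.
\<close>

definition regular_rep :: "'g top_groupoid \<Rightarrow> ('g \<Rightarrow> complex) \<Rightarrow> ('g ell2 \<Rightarrow>\<^sub>L 'g ell2) \<Rightarrow> bool" where
  "regular_rep G f T \<longleftrightarrow> (\<forall>\<xi>. ell2_fun (T \<xi>) = convolution G f (ell2_fun \<xi>))"

text \<open>
  The reduced groupoid $C^*$-algebra, as the operator norm closure of the image of $C_c(G)$.  For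
  amenable \<open>G\<close>, such as $\mathcal{G}_{\mathcal{L}}$, it coincides with the full one.
\<close>

definition groupoid_cstar :: "'g top_groupoid \<Rightarrow> ('g ell2 \<Rightarrow>\<^sub>L 'g ell2) set" where
  "groupoid_cstar G = closure {T. \<exists>f\<in>Cc G. regular_rep G f T}"

abbreviation CL :: "('v, 'e, 'a) bisystem \<Rightarrow> (('v, 'e) garrow ell2 \<Rightarrow>\<^sub>L ('v, 'e) garrow ell2) set" where
  "CL L \<equiv> groupoid_cstar (GL L)"

definition CX :: "('v, 'e, 'a) bisystem \<Rightarrow> (('v, 'e) garrow ell2 \<Rightarrow>\<^sub>L ('v, 'e) garrow ell2) set" where
  "CX L = {T. \<exists>f. continuous_map (Xtop L) euclidean f \<and>
     regular_rep (GL L) (\<lambda>(x, n, z). if x \<in> XL L \<and> n = 0 \<and> z = x then f x else 0) T}"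


section \<open>The gauge action\<close>

definition gauge_fun :: "real \<Rightarrow> (('v, 'e) garrow \<Rightarrow> complex) \<Rightarrow> ('v, 'e) garrow \<Rightarrow> complex" where
  "gauge_fun t f = (\<lambda>(x, n, z). exp (2 * of_real pi * \<i> * of_int n * of_real t) * f (x, n, z))"

text \<open>
  \<open>gauge_action L t\<close> is the automorphism of \<open>CL L\<close> that extends \<open>gauge_fun t\<close> from $C_c$; see
  \<open>is_gauge_phase_conj\<close> for existence and \<open>is_gauge_unique\<close> for uniqueness on \<open>CL L\<close>.  The parameter ranges over the reals, \<open>t\<close> and \<open>t + 1\<close>
  giving the same automorphism.
\<close>

definition is_gauge ::
    "('v, 'e, 'a) bisystem \<Rightarrow> real \<Rightarrow>
     ((('v, 'e) garrow ell2 \<Rightarrow>\<^sub>L ('v, 'e) garrow ell2) \<Rightarrow>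
      (('v, 'e) garrow ell2 \<Rightarrow>\<^sub>L ('v, 'e) garrow ell2)) \<Rightarrow> bool" where
  "is_gauge L t \<Gamma> \<longleftrightarrow> cstar_iso (CL L) (CL L) \<Gamma> \<and> continuous_on (CL L) \<Gamma> \<and>
     (\<forall>f\<in>Cc (GL L). \<forall>T. regular_rep (GL L) f T \<longrightarrow> regular_rep (GL L) (gauge_fun t f) (\<Gamma> T))"

definition gauge_action ::
    "('v, 'e, 'a) bisystem \<Rightarrow> real \<Rightarrow>
     (('v, 'e) garrow ell2 \<Rightarrow>\<^sub>L ('v, 'e) garrow ell2) \<Rightarrow>
     (('v, 'e) garrow ell2 \<Rightarrow>\<^sub>L ('v, 'e) garrow ell2)" where
  "gauge_action L t = (SOME \<Gamma>. is_gauge L t \<Gamma>)"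

text \<open>Existence: conjugation by the diagonal unitary with entries $\exp(2\pi\sqrt{-1}\,nt)$.\<close>

lift_definition phase_ell2 :: "real \<Rightarrow> ('v, 'e) garrow ell2 \<Rightarrow> ('v, 'e) garrow ell2"
  is "gauge_fun"
  unfolding gauge_fun_def case_prod_beta
  by (rule ell2_mult_aux[where B = 1]) auto

lemma bounded_linear_phase_ell2: "bounded_linear (phase_ell2 t)"
proof (rule bounded_linear_intro)
  show "phase_ell2 t (\<xi> + \<eta>) = phase_ell2 t \<xi> + phase_ell2 t \<eta>" for \<xi> \<eta> :: "('v, 'e) garrow ell2"
    by transfer (simp add: gauge_fun_def fun_eq_iff algebra_simps)
  show "phase_ell2 t (r *\<^sub>R \<xi>) = r *\<^sub>R phase_ell2 t \<xi>" for r and \<xi> :: "('v, 'e) garrow ell2"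
    by transfer (simp add: gauge_fun_def fun_eq_iff)
  show "norm (phase_ell2 t \<xi>) \<le> norm \<xi> * 1" for \<xi> :: "('v, 'e) garrow ell2"
  proof -
    have "inner (phase_ell2 t \<xi>) (phase_ell2 t \<xi>) = inner \<xi> \<xi>"
      by (simp add: inner_ell2_def phase_ell2.rep_eq dot_square_norm[where 'a = complex] gauge_fun_def norm_mult
          case_prod_beta)
    then show ?thesis
      by (simp add: norm_eq_sqrt_inner)
  qed
qed

definition phase_op :: "real \<Rightarrow> ('v, 'e) garrow ell2 \<Rightarrow>\<^sub>L ('v, 'e) garrow ell2" where
  "phase_op t = Blinfun (phase_ell2 t)"

lemma phase_op_apply: "ell2_fun (phase_op t \<xi>) = gauge_fun t (ell2_fun \<xi>)"
  by (simp add: phase_op_def bounded_linear_Blinfun_apply bounded_linear_phase_ell2 phase_ell2.rep_eq)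

lemma gauge_fun_add: "gauge_fun s (gauge_fun t f) = gauge_fun (s + t) f"
  by (simp add: gauge_fun_def fun_eq_iff exp_add algebra_simps)

lemma gauge_fun_0: "gauge_fun 0 f = f"
  by (simp add: gauge_fun_def fun_eq_iff)

lemma phase_op_inverse: "phase_op t o\<^sub>L phase_op (- t) = id_blinfun"
  by (rule blinfun_eqI) (simp add: ell2_fun_inject[symmetric] phase_op_apply gauge_fun_add gauge_fun_0)

definition phase_conj ::
    "real \<Rightarrow> (('v, 'e) garrow ell2 \<Rightarrow>\<^sub>L ('v, 'e) garrow ell2) \<Rightarrow>
     (('v, 'e) garrow ell2 \<Rightarrow>\<^sub>L ('v, 'e) garrow ell2)" where
  "phase_conj t T = phase_op t o\<^sub>L T o\<^sub>L phase_op (- t)"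

lemma phase_conj_apply: "phase_conj t T \<xi> = phase_op t (T (phase_op (- t) \<xi>))"
  by (simp add: phase_conj_def)

lemma phase_op_cancel [simp]:
  "phase_op t (phase_op (- t) \<xi>) = \<xi>" "phase_op (- t) (phase_op t \<xi>) = \<xi>"
  by (simp_all add: ell2_fun_inject[symmetric] phase_op_apply gauge_fun_add gauge_fun_0)

lemma phase_conj_inverse: "phase_conj t (phase_conj (- t) T) = T"
  by (rule blinfun_eqI) (metis phase_conj_apply phase_op_cancel minus_minus)

lemma cscale_apply: "ell2_fun (cscale c T \<xi>) g = c * ell2_fun (T \<xi>) g"
  by (simp add: cscale_def bounded_linear_Blinfun_apply bounded_linear_mult_ell2 mult_ell2.rep_eq)

lemma phase_conj_add: "phase_conj t (S + T) = phase_conj t S + phase_conj t T"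
  by (rule blinfun_eqI) (simp add: phase_conj_apply blinfun.add_left blinfun.add_right)

lemma phase_conj_mult: "phase_conj t (S o\<^sub>L T) = phase_conj t S o\<^sub>L phase_conj t T"
  by (rule blinfun_eqI) (simp add: phase_conj_apply)

lemma phase_conj_cscale: "phase_conj t (cscale c T) = cscale c (phase_conj t T)"
  by (rule blinfun_eqI)
    (simp add: ell2_fun_inject[symmetric] fun_eq_iff cscale_apply phase_conj_apply phase_op_apply gauge_fun_def)

lemma cinner_phase: "cinner (phase_op t \<xi>) \<eta> = cinner \<xi> (phase_op (- t) \<eta>)"
  unfolding cinner_def phase_op_apply
  by (rule infsum_cong) (auto simp: gauge_fun_def exp_cnj ac_simps)

lemma phase_conj_adjoint: "is_adjoint T S \<Longrightarrow> is_adjoint (phase_conj t T) (phase_conj t S)"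
  using cinner_phase[of "- t"] by (simp add: is_adjoint_def phase_conj_apply cinner_phase)

lemma continuous_phase_conj: "continuous_on S (phase_conj t)"
  unfolding phase_conj_def by (intro continuous_intros)

lemma regular_rep_phase_conj:
  assumes "regular_rep (GL L) f T"
  shows "regular_rep (GL L) (gauge_fun t f) (phase_conj t T)"
  unfolding regular_rep_def
proof (intro allI ext)
  fix \<xi> and \<gamma> :: "('a, 'b) garrow"
  have "ell2_fun (phase_conj t T \<xi>) \<gamma>
      = gauge_fun t (convolution (GL L) f (gauge_fun (- t) (ell2_fun \<xi>))) \<gamma>"
    using assms by (simp add: phase_conj_apply phase_op_apply regular_rep_def)
  also have "\<dots> = convolution (GL L) (gauge_fun t f) (ell2_fun \<xi>) \<gamma>"
    unfolding convolution_def gauge_fun_def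
    by (simp add: case_prod_beta infsum_cmult_right'[symmetric])
      (rule infsum_cong, auto simp: GL_def exp_add[symmetric] algebra_simps)
  finally show "ell2_fun (phase_conj t T \<xi>) \<gamma> = convolution (GL L) (gauge_fun t f) (ell2_fun \<xi>) \<gamma>" .
qed

lemma gauge_fun_Cc:
  assumes "f \<in> Cc (GL L)"
  shows "gauge_fun t f \<in> Cc (GL L)"
proof -
  have "continuous_map (prod_topology (RL_top L) (discrete_topology UNIV)) euclidean
      ((\<lambda>n::int. exp (2 * of_real pi * \<i> * of_int n * of_real t)) \<circ> snd)"
    by (rule continuous_map_compose[OF continuous_map_snd]) simp
  then have "continuous_map (gtop (GL L)) euclidean
      (((\<lambda>n::int. exp (2 * of_real pi * \<i> * of_int n * of_real t)) \<circ> snd) \<circ>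
       (\<lambda>(x, n, z). ((shift_pow n x, z), n)))"
    unfolding GL_def top_groupoid.simps by (rule continuous_map_pullback)
  then have "continuous_map (gtop (GL L)) euclidean (\<lambda>g. exp (2 * of_real pi * \<i> * of_int (dL g) * of_real t))"
    by (simp add: comp_def case_prod_beta dL_def)
  moreover have "continuous_map (gtop (GL L)) euclidean f"
    using assms by (simp add: Cc_def)
  ultimately have "continuous_map (gtop (GL L)) (prod_topology euclidean euclidean)
      (\<lambda>g. (exp (2 * of_real pi * \<i> * of_int (dL g) * of_real t), f g))"
    by (rule continuous_map_pairedI)
  moreover have "continuous_map (prod_topology euclidean euclidean) euclidean
      (\<lambda>z :: complex \<times> complex. fst z * snd z)"
    by (simp add: euclidean_product_topology continuous_on_mult continuous_on_fst continuous_on_snd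
        continuous_on_id)
  ultimately have "continuous_map (gtop (GL L)) euclidean
      ((\<lambda>z. fst z * snd z) \<circ> (\<lambda>g. (exp (2 * of_real pi * \<i> * of_int (dL g) * of_real t), f g)))"
    by (rule continuous_map_compose)
  then have "continuous_map (gtop (GL L)) euclidean
      (\<lambda>g. exp (2 * of_real pi * \<i> * of_int (dL g) * of_real t) * f g)"
    by (simp add: comp_def)
  moreover have "gauge_fun t f = (\<lambda>g. exp (2 * of_real pi * \<i> * of_int (dL g) * of_real t) * f g)"
    by (simp add: gauge_fun_def dL_def fun_eq_iff)
  ultimately show ?thesis
    using assms by (simp add: Cc_def)
qed

lemma phase_conj_CL:
  assumes "T \<in> CL L"
  shows "phase_conj t T \<in> CL L"
proof -
  let ?S = "{T. \<exists>f\<in>Cc (GL L). regular_rep (GL L) f T}"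
  have "phase_conj t ` closure ?S \<subseteq> closure ?S"
  proof (rule image_closure_subset)
    show "phase_conj t ` ?S \<subseteq> closure ?S"
      using regular_rep_phase_conj gauge_fun_Cc closure_subset[of ?S] by blast
  qed (auto intro: continuous_phase_conj)
  then show ?thesis
    using assms by (auto simp: groupoid_cstar_def)
qed

lemma is_gauge_phase_conj: "is_gauge L t (phase_conj t)"
proof -
  have "bij_betw (phase_conj t) (CL L) (CL L)"
    by (rule bij_betw_byWitness[where f' = "phase_conj (- t)"])
      (use phase_conj_inverse[of t] phase_conj_inverse[of "- t"] phase_conj_CL in auto)
  then have "cstar_iso (CL L) (CL L) (phase_conj t)"
    by (simp add: cstar_iso_def phase_conj_add phase_conj_mult phase_conj_cscale phase_conj_adjoint)
  then show ?thesis
    by (simp add: is_gauge_def regular_rep_phase_conj continuous_phase_conj)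
qed

lemma is_gauge_unique:
  assumes "is_gauge L t \<Gamma>" "is_gauge L t \<Delta>" "T \<in> CL L"
  shows "\<Gamma> T = \<Delta> T"
proof -
  let ?S = "{T. \<exists>f\<in>Cc (GL L). regular_rep (GL L) f T}"
  have "\<Gamma> T - \<Delta> T = 0"
  proof (rule continuous_constant_on_closure[where f = "\<lambda>T. \<Gamma> T - \<Delta> T" and S = ?S])
    show "continuous_on (closure ?S) (\<lambda>T. \<Gamma> T - \<Delta> T)"
      using assms by (intro continuous_on_diff) (simp_all add: is_gauge_def groupoid_cstar_def)
    show "\<Gamma> T - \<Delta> T = 0" if T: "T \<in> ?S" for T
    proof -
      obtain f where "f \<in> Cc (GL L)" "regular_rep (GL L) f T"
        using T by blast
      then have "regular_rep (GL L) (gauge_fun t f) (\<Gamma> T)" "regular_rep (GL L) (gauge_fun t f) (\<Delta> T)"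
        using assms by (auto simp: is_gauge_def)
      then have "\<Gamma> T = \<Delta> T"
        by (intro blinfun_eqI) (simp add: regular_rep_def ell2_fun_inject[symmetric])
      then show ?thesis
        by simp
    qed
    show "T \<in> closure ?S"
      using assms by (simp add: groupoid_cstar_def)
  qed
  then show ?thesis
    by simp
qed

lemma gauge_action_eq: "T \<in> CL L \<Longrightarrow> gauge_action L t T = phase_conj t T"
  unfolding gauge_action_def
  by (rule is_gauge_unique[OF someI[of "is_gauge L t", OF is_gauge_phase_conj] is_gauge_phase_conj])

end

theory Submission
  imports Defs
begin

text \<open>
  An arrow of $\mathcal G_{\mathcal L}$ is determined by its range, its degree and its source, since an arrow of degree
  zero is nothing but a pair in the relation $R_{\mathcal L}$.  A degree preserving isomorphism of groupoids
  therefore has the form $(x,n,z) \mapsto (h(x),n,h(z))$ with a bijection $h$ of the configuration spaces, and both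
  assertions of the theorem are compared with the existence of an $h$ for which this formula defines a homeomorphism
  between the spaces of arrows (locale \<open>graded_iso\<close>).

  From $h$ to operators: relabelling the canonical basis of $\ell^2$ by the map on arrows conjugates convolution
  operators into convolution operators.  It commutes with the gauge action, as degrees are kept, and it
  respects the diagonal, as units go to units (\<open>cstar_iso_transport\<close>, \<open>transport_CX_onto\<close>, \<open>transport_gauge\<close>).

  From operators to $h$: an isomorphism $\Phi$ that respects the diagonals permutes the projections of clopen sets,
  and Stone duality turns this into a bijection $h$ of points (\<open>same_point_ex\<close>).  The groupoid has a base of compact
  open sets $K$ on which range and source are injective and the degree is constant.  The indicator function of $K$
  acts as a partial isometry $T_K$, which is homogeneous for the gauge action, moves diagonal projections as
  $K$ moves points, and satisfies $T_{K^{-1}} T_K = 1_{s(K)}$.  All this is inherited by $A = \Phi(T_K)$.  Homogeneity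
  and the commutation with projections confine the support of $A$, as a function on the second groupoid,
  to arrows $(h(x),n,h(z))$ with $(x,n,z) \in K$ (\<open>image_isom_support\<close>), and invertibility on $s(K)$ shows that each of
  these occurs (\<open>image_isom_nonzero\<close>).  The function is continuous, so the image of $K$ is open.  Hence $h$ induces an
  open map on arrows, and the inverse of $\Phi$ provides its inverse.

  Two facts about the groupoid carry this argument.  The first is its etale structure.  The triangle
  of a configuration below the vertex at $(p,q)$, that is, its part in the positions $(k,l)$ with
  $p \le k < l \le q$, can be exchanged for any other triangle below the same vertex
  (\<open>config_refill\<close>); this rests on the local property and on FPCC, and it implies that the source of a basic open set of
  arrows is a full cylinder, that basic sets are compact, and that multiplication is an open map.  The second is that
  the algebra is closed under products (\<open>CL_mult\<close>), without which the inverse of $\Phi$ could not be seen to be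
  multiplicative.  Functions in $C_c$ are cut into pieces supported on such sets $K$, for which a convolution
  has a single term.
\<close>

section \<open>Operators on $\ell^2$\<close>

lemma ell2_eqI: "(\<And>g. ell2_fun \<xi> g = ell2_fun \<eta> g) \<Longrightarrow> \<xi> = \<eta>"
  by (simp add: ell2_fun_inject[symmetric] fun_eq_iff)

lemma norm_ell2_sq: "(norm \<xi>)\<^sup>2 = (\<Sum>\<^sub>\<infinity>g. (cmod (ell2_fun \<xi> g))\<^sup>2)"
  by (simp add: dot_square_norm[symmetric] inner_ell2_def)

lemma norm_coord_le: "cmod (ell2_fun \<xi> g) \<le> norm \<xi>"
proof -
  have "(cmod (ell2_fun \<xi> g))\<^sup>2 = sum (\<lambda>g. (cmod (ell2_fun \<xi> g))\<^sup>2) {g}"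
    by simp
  also have "\<dots> \<le> (norm \<xi>)\<^sup>2"
    unfolding norm_ell2_sq by (rule finite_sum_le_infsum) (auto simp: ell2_summable)
  finally show ?thesis
    by (rule power2_le_imp_le) simp
qed

lift_definition delta :: "'g \<Rightarrow> 'g ell2" is "\<lambda>g h. if h = g then 1 else 0"
  by (rule summable_on_cong_neutral[THEN iffD1, OF _ _ _ summable_on_finite[of "{_}"]]) auto

lemma delta_apply: "ell2_fun (delta g) h = (if h = g then 1 else 0)"
  by (simp add: delta.rep_eq)

lemma norm_delta: "norm (delta g) = 1"
proof -
  have "(norm (delta g))\<^sup>2 = (\<Sum>\<^sub>\<infinity>h. (cmod (ell2_fun (delta g) h))\<^sup>2)"
    by (rule norm_ell2_sq)
  also have "\<dots> = (\<Sum>\<^sub>\<infinity>h\<in>{g}. (cmod (ell2_fun (delta g) h))\<^sup>2)"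
    by (rule infsum_cong_neutral) (auto simp: delta_apply)
  finally have "sqrt ((norm (delta g))\<^sup>2) = sqrt 1"
    by (simp add: delta_apply)
  then show ?thesis
    by (simp only: real_sqrt_abs abs_norm_cancel real_sqrt_one)
qed

text \<open>
  Matrix entries are continuous in the operator norm.  Relations that are expressed by entries, or by
  equations between operators, therefore pass from convolution by functions in $C_c$ to the closure.
\<close>

lemma norm_entry_le:
  fixes T :: "'g ell2 \<Rightarrow>\<^sub>L 'h ell2"
  shows "cmod (ell2_fun (T (delta g)) h) \<le> norm T"
  using norm_coord_le[of "T (delta g)" h] norm_blinfun[of T "delta g"] by (simp add: norm_delta)

text \<open>
  The operator $\xi \mapsto w \cdot (\xi \circ \tau)$ on a set \<open>D\<close> maps $\ell^2$ to $\ell^2$ when \<open>\<tau>\<close> is injective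
  on \<open>D\<close> and \<open>w\<close> is bounded there.  It is set to 0 in all other cases, so that it is a total function of
  its data.  Convolution by a function on a slice, relabelling of basis vectors and diagonal projections
  are all of this form.
\<close>

definition weight_ok where
  "weight_ok w D \<tau> \<longleftrightarrow> inj_on \<tau> D \<and> (\<exists>B. \<forall>h\<in>D. cmod (w h) \<le> B)"

lemma weighted_pullback_bound:
  assumes f: "(\<lambda>g. (cmod (f g))\<^sup>2) summable_on UNIV" and inj: "inj_on \<tau> D" and B: "\<And>h. h \<in> D \<Longrightarrow> cmod (w h) \<le> B"
  shows "(\<lambda>h. (cmod (if h \<in> D then w h * f (\<tau> h) else 0))\<^sup>2) summable_on UNIV" (is ?S)
    and "(\<Sum>\<^sub>\<infinity>h. (cmod (if h \<in> D then w h * f (\<tau> h) else 0))\<^sup>2) \<le> B\<^sup>2 * (\<Sum>\<^sub>\<infinity>g. (cmod (f g))\<^sup>2)" (is ?L)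
proof -
  let ?F = "\<lambda>g. (cmod (f g))\<^sup>2"
  have s1: "?F summable_on \<tau> ` D"
    using f summable_on_subset_banach by blast
  then have "(?F \<circ> \<tau>) summable_on D"
    using summable_on_reindex[OF inj] by blast
  then have s2: "(\<lambda>h. B\<^sup>2 * ?F (\<tau> h)) summable_on D"
    by (intro summable_on_cmult_right) (simp add: comp_def)
  have le: "(cmod (w h * f (\<tau> h)))\<^sup>2 \<le> B\<^sup>2 * ?F (\<tau> h)" if "h \<in> D" for h
    using B[OF that] by (auto simp: norm_mult power_mult_distrib intro!: mult_right_mono power_mono)
  have s3: "(\<lambda>h. (cmod (w h * f (\<tau> h)))\<^sup>2) summable_on D"
    by (rule summable_on_comparison_test[OF s2]) (use le in auto)
  show ?S
    by (rule summable_on_cong_neutral[THEN iffD1, OF _ _ _ s3]) auto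
  have "(\<Sum>\<^sub>\<infinity>h. (cmod (if h \<in> D then w h * f (\<tau> h) else 0))\<^sup>2) = (\<Sum>\<^sub>\<infinity>h\<in>D. (cmod (w h * f (\<tau> h)))\<^sup>2)"
    by (rule infsum_cong_neutral) auto
  also have "\<dots> \<le> (\<Sum>\<^sub>\<infinity>h\<in>D. B\<^sup>2 * ?F (\<tau> h))"
    by (rule infsum_mono[OF s3 s2 le])
  also have "\<dots> = B\<^sup>2 * infsum ?F (\<tau> ` D)"
    using infsum_reindex[OF inj, of ?F] by (simp add: infsum_cmult_right' comp_def)
  also have "\<dots> \<le> B\<^sup>2 * infsum ?F UNIV"
    by (intro mult_left_mono infsum_mono_neutral s1 f) auto
  finally show ?L .
qed

lift_definition weighted_pullback_ell2 :: "('h \<Rightarrow> complex) \<Rightarrow> 'h set \<Rightarrow> ('h \<Rightarrow> 'g) \<Rightarrow> 'g ell2 \<Rightarrow> 'h ell2"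
  is "\<lambda>w D \<tau> \<xi> h. if weight_ok w D \<tau> \<and> h \<in> D then w h * \<xi> (\<tau> h) else 0"
  subgoal for w D \<tau> \<xi>
  proof (cases "weight_ok w D \<tau>")
    case True
    then obtain B where B: "inj_on \<tau> D" "\<And>h. h \<in> D \<Longrightarrow> cmod (w h) \<le> B"
      by (auto simp: weight_ok_def)
    show "(\<lambda>g. (cmod (if weight_ok w D \<tau> \<and> g \<in> D then w g * \<xi> (\<tau> g) else 0))\<^sup>2) summable_on UNIV"
      if "(\<lambda>g. (cmod (\<xi> g))\<^sup>2) summable_on UNIV"
      using weighted_pullback_bound(1)[OF that B] True by simp
  qed simp
  done

lemma bounded_linear_weighted_pullback_ell2: "bounded_linear (weighted_pullback_ell2 w D \<tau>)"
proof (cases "weight_ok w D \<tau>")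
  case True
  then obtain B where B: "inj_on \<tau> D" "\<And>h. h \<in> D \<Longrightarrow> cmod (w h) \<le> B"
    by (auto simp: weight_ok_def)
  show ?thesis
  proof (rule bounded_linear_intro)
    show "weighted_pullback_ell2 w D \<tau> (\<xi> + \<eta>) = weighted_pullback_ell2 w D \<tau> \<xi> + weighted_pullback_ell2 w D \<tau> \<eta>" for \<xi> \<eta>
      by transfer (auto simp: algebra_simps)
    show "weighted_pullback_ell2 w D \<tau> (r *\<^sub>R \<xi>) = r *\<^sub>R weighted_pullback_ell2 w D \<tau> \<xi>" for r \<xi>
      by transfer auto
    show "norm (weighted_pullback_ell2 w D \<tau> \<xi>) \<le> norm \<xi> * \<bar>B\<bar>" for \<xi>
    proof (rule power2_le_imp_le)
      have "(norm (weighted_pullback_ell2 w D \<tau> \<xi>))\<^sup>2 \<le> B\<^sup>2 * (norm \<xi>)\<^sup>2"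
        using weighted_pullback_bound(2)[OF ell2_summable B] True by (simp add: norm_ell2_sq weighted_pullback_ell2.rep_eq)
      then show "(norm (weighted_pullback_ell2 w D \<tau> \<xi>))\<^sup>2 \<le> (norm \<xi> * \<bar>B\<bar>)\<^sup>2"
        by (simp add: power_mult_distrib mult.commute)
    qed simp
  qed
next
  case False
  have "weighted_pullback_ell2 w D \<tau> = (\<lambda>_. 0)"
    using False by (auto intro!: ell2_eqI simp: weighted_pullback_ell2.rep_eq zero_ell2.rep_eq)
  then show ?thesis
    by simp
qed

definition weighted_pullback :: "('h \<Rightarrow> complex) \<Rightarrow> 'h set \<Rightarrow> ('h \<Rightarrow> 'g) \<Rightarrow> 'g ell2 \<Rightarrow>\<^sub>L 'h ell2" where
  "weighted_pullback w D \<tau> = Blinfun (weighted_pullback_ell2 w D \<tau>)"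

lemma weighted_pullback_apply:
  assumes "inj_on \<tau> D" "\<And>h. h \<in> D \<Longrightarrow> cmod (w h) \<le> B"
  shows "ell2_fun (weighted_pullback w D \<tau> \<xi>) h = (if h \<in> D then w h * ell2_fun \<xi> (\<tau> h) else 0)"
proof -
  have "weight_ok w D \<tau>"
    using assms by (auto simp: weight_ok_def)
  then show ?thesis
    by (simp add: weighted_pullback_def bounded_linear_Blinfun_apply bounded_linear_weighted_pullback_ell2 weighted_pullback_ell2.rep_eq)
qed

abbreviation pullback_op :: "'h set \<Rightarrow> ('h \<Rightarrow> 'g) \<Rightarrow> 'g ell2 \<Rightarrow>\<^sub>L 'h ell2" where
  "pullback_op \<equiv> weighted_pullback (\<lambda>_. 1)"

lemma pullback_op_apply:
  "inj_on \<tau> D \<Longrightarrow> ell2_fun (pullback_op D \<tau> \<xi>) h = (if h \<in> D then ell2_fun \<xi> (\<tau> h) else 0)"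
  using weighted_pullback_apply[of \<tau> D "\<lambda>_. 1" 1] by simp

text \<open>
  Relabelling basis vectors along a bijection is unitary, so its adjoint is the inverse relabelling.
\<close>

lemma cinner_pullback_op:
  assumes bij: "bij_betw \<tau> D E" and inv: "\<And>h. h \<in> D \<Longrightarrow> \<sigma> (\<tau> h) = h"
  shows "cinner (pullback_op D \<tau> \<xi>) \<eta> = cinner \<xi> (pullback_op E \<sigma> \<eta>)"
proof -
  have inj: "inj_on \<tau> D" "inj_on \<sigma> E"
    using bij inv by (auto simp: bij_betw_def inj_on_def)
  have "cinner (pullback_op D \<tau> \<xi>) \<eta> = (\<Sum>\<^sub>\<infinity>h\<in>D. ell2_fun \<xi> (\<tau> h) * cnj (ell2_fun \<eta> (\<sigma> (\<tau> h))))"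
    unfolding cinner_def by (rule infsum_cong_neutral) (auto simp: pullback_op_apply inj inv)
  also have "\<dots> = (\<Sum>\<^sub>\<infinity>g\<in>E. ell2_fun \<xi> g * cnj (ell2_fun \<eta> (\<sigma> g)))"
    by (rule infsum_reindex_bij_betw[OF bij])
  also have "\<dots> = cinner \<xi> (pullback_op E \<sigma> \<eta>)"
    unfolding cinner_def by (rule infsum_cong_neutral) (auto simp: pullback_op_apply inj)
  finally show ?thesis .
qed

section \<open>Configurations and their labels\<close>

definition label_at :: "('v, 'e, 'a) bisystem \<Rightarrow> ('v, 'e) config \<Rightarrow> int \<Rightarrow> 'a" where
  "label_at L x n = labelM L (em x n (n + 1))"

text \<open>
  As $\mathcal L^-$ is right-resolving and $\mathcal L^+$ left-resolving, an edge is determined by its label and its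
  endpoint \<open>u\<close> of higher level.  The values are arbitrary when there is no such edge.
\<close>

definition edge_out :: "('v, 'e, 'a) bisystem \<Rightarrow> 'v \<Rightarrow> 'a \<Rightarrow> 'e" where
  "edge_out L u b = (SOME e. e \<in> (\<Union>n. EdgeM L n) \<and> source L e = u \<and> labelM L e = b)"

definition edge_in :: "('v, 'e, 'a) bisystem \<Rightarrow> 'v \<Rightarrow> 'a \<Rightarrow> 'e" where
  "edge_in L u b = (SOME e. e \<in> (\<Union>n. EdgeP L n) \<and> terminal L e = u \<and> labelP L e = b)"

abbreviation stepM :: "('v, 'e, 'a) bisystem \<Rightarrow> 'a \<Rightarrow> 'v \<Rightarrow> 'v" where
  "stepM L b u \<equiv> terminal L (edge_out L u b)"

abbreviation stepP :: "('v, 'e, 'a) bisystem \<Rightarrow> 'a \<Rightarrow> 'v \<Rightarrow> 'v" where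
  "stepP L b u \<equiv> source L (edge_in L u b)"

text \<open>
  Starting from a vertex in position \<open>(k, l)\<close>, follow \<open>j\<close> edges of $E^-$ with the labels
  $a_{k+1}, \dots, a_{k+j}$ to position \<open>(k + j, l)\<close>, respectively \<open>j\<close> edges of $E^+$ backwards with the labels
  $a_{l-1}, \dots, a_{l-j}$ to position \<open>(k, l - j)\<close>.
\<close>

primrec stepsM :: "('v, 'e, 'a) bisystem \<Rightarrow> (int \<Rightarrow> 'a) \<Rightarrow> int \<Rightarrow> nat \<Rightarrow> 'v \<Rightarrow> 'v" where
  "stepsM L a k 0 u = u"
| "stepsM L a k (Suc j) u = stepM L (a (k + int j + 1)) (stepsM L a k j u)"

primrec stepsP :: "('v, 'e, 'a) bisystem \<Rightarrow> (int \<Rightarrow> 'a) \<Rightarrow> int \<Rightarrow> nat \<Rightarrow> 'v \<Rightarrow> 'v" where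
  "stepsP L a l 0 u = u"
| "stepsP L a l (Suc j) u = stepP L (a (l - int j - 1)) (stepsP L a l j u)"

text \<open>
  The vertex \<open>u\<close> can stand in position \<open>(k, l)\<close> over the labels $a_{k+1}, \dots, a_{l-1}$.  Because of FPCC the
  word may be consumed from either end, which is why this single condition guarantees that every
  step of \<open>stepsM\<close> and \<open>stepsP\<close> inside the triangle below \<open>u\<close> exists.
\<close>

definition reads :: "('v, 'e, 'a) bisystem \<Rightarrow> (int \<Rightarrow> 'a) \<Rightarrow> int \<Rightarrow> int \<Rightarrow> 'v \<Rightarrow> bool" where
  "reads L a k l u \<longleftrightarrow> k < l \<and> u \<in> Vert L (lev k l) \<and> map a [k+1..l-1] \<in> P_words L (lev k l) u"

text \<open>
  The basic open set $U_{(\mu;v)}$ that contains \<open>x\<close>, addressed by \<open>x\<close> instead of by a word and a vertex.  It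
  fixes all of the triangle below \<open>(p, q)\<close>, that is, the vertices in the positions \<open>(k, l)\<close> with \<open>p \<le> k\<close>, \<open>k < l\<close>
  and \<open>l \<le> q\<close> and the edges between them.
\<close>

definition cyl :: "('v, 'e, 'a) bisystem \<Rightarrow> int \<Rightarrow> int \<Rightarrow> ('v, 'e) config \<Rightarrow> ('v, 'e) config set" where
  "cyl L p q x = {y \<in> XL L. vx y p q = vx x p q \<and> (\<forall>n. p < n \<and> n < q \<longrightarrow> label_at L y n = label_at L x n)}"

text \<open>
  The members of a pair share their square at \<open>(p, q)\<close>, while on the triangle below \<open>(p, q)\<close> they agree with \<open>x\<close>
  and \<open>z\<close>.  These sets and the corresponding sets of arrows form bases of the two topologies, see
  \<open>openin_RL_iff\<close> and \<open>openin_GL_iff\<close>.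
\<close>

definition R_basic where
  "R_basic L p q x z = Rpq L p q \<inter> cyl L p q x \<times> cyl L p q z"

definition G_basic where
  "G_basic L p q = (\<lambda>(x, n, z). {(x', m, z'). m = n \<and> x' \<in> XL L \<and>
     (shift_pow n x', z') \<in> R_basic L p q (shift_pow n x) z})"

definition inv_set :: "('v, 'e) garrow set \<Rightarrow> ('v, 'e) garrow set" where
  "inv_set A = {(z, - n, x) | x n z. (x, n, z) \<in> A}"

lemma inv_set_iff [simp]: "(z, n, x) \<in> inv_set A \<longleftrightarrow> (x, - n, z) \<in> A"
  by (auto simp: inv_set_def intro!: exI[of _ "- n"])

lemma lev_simps:
  "k < l \<Longrightarrow> lev (k - 1) l = Suc (lev k l)" "k < l \<Longrightarrow> lev k (l + 1) = Suc (lev k l)"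
  by (auto simp: lev_def)

lemma P_words_Suc:
  "w \<in> P_words L (Suc n) v \<longleftrightarrow>
     (\<exists>e\<in>EdgeP L n. terminal L e = v \<and> (\<exists>w'\<in>P_words L n (source L e). w = w' @ [labelP L e]))"
  (is "?L \<longleftrightarrow> ?R")
proof
  assume ?L
  then obtain e where "(\<forall>i\<in>{1..Suc n}. e i \<in> EdgeP L (i - 1)) \<and> (Suc n \<ge> 1 \<longrightarrow> terminal L (e (Suc n)) = v) \<and>
      (\<forall>i\<in>{2..Suc n}. source L (e i) = terminal L (e (i - 1))) \<and> w = map (\<lambda>i. labelP L (e i)) [1..<Suc n + 1]"
    unfolding P_words_def by blast
  then have e: "\<And>i. i \<in> {1..Suc n} \<Longrightarrow> e i \<in> EdgeP L (i - 1)" "terminal L (e (Suc n)) = v"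
    "\<And>i. i \<in> {2..Suc n} \<Longrightarrow> source L (e i) = terminal L (e (i - 1))"
    "w = map (\<lambda>i. labelP L (e i)) [1..<Suc n + 1]"
    by (blast, simp, blast, blast)
  have "map (\<lambda>i. labelP L (e i)) [1..<n + 1] \<in> P_words L n (source L (e (Suc n)))"
    unfolding P_words_def mem_Collect_eq using e
    by (intro exI[of _ e]) (auto simp: Suc_le_eq)
  then show ?R
    using e(1)[of "Suc n"] e(2,4) by force
next
  assume ?R
  then obtain f w' where f: "f \<in> EdgeP L n" "terminal L f = v" "w' \<in> P_words L n (source L f)"
    "w = w' @ [labelP L f]" by blast
  from f(3) obtain e where "(\<forall>i\<in>{1..n}. e i \<in> EdgeP L (i - 1)) \<and> (n \<ge> 1 \<longrightarrow> terminal L (e n) = source L f) \<and>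
      (\<forall>i\<in>{2..n}. source L (e i) = terminal L (e (i - 1))) \<and> w' = map (\<lambda>i. labelP L (e i)) [1..<n + 1]"
    unfolding P_words_def by blast
  then have e: "\<And>i. i \<in> {1..n} \<Longrightarrow> e i \<in> EdgeP L (i - 1)" "n \<ge> 1 \<Longrightarrow> terminal L (e n) = source L f"
    "\<And>i. i \<in> {2..n} \<Longrightarrow> source L (e i) = terminal L (e (i - 1))"
    "w' = map (\<lambda>i. labelP L (e i)) [1..<n + 1]"
    by (blast, blast, blast, blast)
  show ?L
    unfolding P_words_def mem_Collect_eq
    by (intro exI[of _ "e(Suc n := f)"]) (use e f in \<open>auto simp: le_Suc_eq\<close>)
qed

lemma F_words_Suc:
  "w \<in> F_words L (Suc n) v \<longleftrightarrow>
     (\<exists>e\<in>EdgeM L n. source L e = v \<and> (\<exists>w'\<in>F_words L n (terminal L e). w = labelM L e # w'))"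
  (is "?L \<longleftrightarrow> ?R")
proof
  assume ?L
  then obtain e where "(\<forall>i\<in>{1..Suc n}. e i \<in> EdgeM L (i - 1)) \<and> (Suc n \<ge> 1 \<longrightarrow> source L (e (Suc n)) = v) \<and>
      (\<forall>i\<in>{2..Suc n}. terminal L (e i) = source L (e (i - 1))) \<and> w = map (\<lambda>i. labelM L (e i)) (rev [1..<Suc n + 1])"
    unfolding F_words_def by blast
  then have e: "\<And>i. i \<in> {1..Suc n} \<Longrightarrow> e i \<in> EdgeM L (i - 1)" "source L (e (Suc n)) = v"
    "\<And>i. i \<in> {2..Suc n} \<Longrightarrow> terminal L (e i) = source L (e (i - 1))"
    "w = map (\<lambda>i. labelM L (e i)) (rev [1..<Suc n + 1])"
    by (blast, simp, blast, blast)
  have "map (\<lambda>i. labelM L (e i)) (rev [1..<n + 1]) \<in> F_words L n (terminal L (e (Suc n)))"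
    unfolding F_words_def mem_Collect_eq using e
    by (intro exI[of _ e]) (auto simp: Suc_le_eq)
  then show ?R
    using e(1)[of "Suc n"] e(2,4) by force
next
  assume ?R
  then obtain f w' where f: "f \<in> EdgeM L n" "source L f = v" "w' \<in> F_words L n (terminal L f)"
    "w = labelM L f # w'" by blast
  from f(3) obtain e where "(\<forall>i\<in>{1..n}. e i \<in> EdgeM L (i - 1)) \<and> (n \<ge> 1 \<longrightarrow> source L (e n) = terminal L f) \<and>
      (\<forall>i\<in>{2..n}. terminal L (e i) = source L (e (i - 1))) \<and> w' = map (\<lambda>i. labelM L (e i)) (rev [1..<n + 1])"
    unfolding F_words_def by blast
  then have e: "\<And>i. i \<in> {1..n} \<Longrightarrow> e i \<in> EdgeM L (i - 1)" "n \<ge> 1 \<Longrightarrow> source L (e n) = terminal L f"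
    "\<And>i. i \<in> {2..n} \<Longrightarrow> terminal L (e i) = source L (e (i - 1))"
    "w' = map (\<lambda>i. labelM L (e i)) (rev [1..<n + 1])"
    by (blast, blast, blast, blast)
  show ?L
    unfolding F_words_def mem_Collect_eq
    by (intro exI[of _ "e(Suc n := f)"]) (use e f in \<open>auto simp: le_Suc_eq\<close>)
qed

locale fpcc_bisystem = lambda_graph_bisystem L for L :: "('v, 'e, 'a) bisystem" +
  assumes FPCC: "FPCC L"

context lambda_graph_bisystem
begin

context
  fixes x :: "('v, 'e) config"
  assumes x: "x \<in> XL L"
begin

lemma XL_cell:
  assumes "k < l"
  shows vx_Vert: "vx x k l \<in> Vert L (lev k l)"
    and em_EdgeM: "em x k l \<in> EdgeM L (lev k l)"
    and ep_EdgeP: "ep x k l \<in> EdgeP L (lev k l)"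
    and source_em: "source L (em x k l) = vx x (k - 1) l"
    and terminal_em: "terminal L (em x k l) = vx x k l"
    and source_ep: "source L (ep x k l) = vx x k l"
    and terminal_ep: "terminal L (ep x k l) = vx x k (l + 1)"
  using x assms by (auto simp: XL_def Z2lt_def)

lemma label_sequence_lab: "label_sequence L x a \<longleftrightarrow> a = label_at L x"
proof -
  obtain b where b: "label_sequence L x b"
    using x by (auto simp: XL_def)
  have "c = label_at L x" if "label_sequence L x c" for c
    using that by (auto simp: label_sequence_def label_at_def Z2lt_def fun_eq_iff)
  then show ?thesis
    using b by auto
qed

lemma labelM_em: "k < l \<Longrightarrow> labelM L (em x k l) = label_at L x k"
  and labelP_ep: "k < l \<Longrightarrow> labelP L (ep x k l) = label_at L x l"
  using label_sequence_lab[of "label_at L x"] by (auto simp: label_sequence_def Z2lt_def)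

end

lemma EdgeM_eqI:
  assumes "e \<in> EdgeM L m" "f \<in> EdgeM L n" "source L e = source L f" "labelM L e = labelM L f"
  shows "e = f"
proof -
  have "m = n"
    using assms source_EdgeM[of e m] source_EdgeM[of f n] disjoint_Vert[of "m + 1" "n + 1"] by fastforce
  then show ?thesis
    using right_resolving assms by blast
qed

lemma EdgeP_eqI:
  assumes "e \<in> EdgeP L m" "f \<in> EdgeP L n" "terminal L e = terminal L f" "labelP L e = labelP L f"
  shows "e = f"
proof -
  have "m = n"
    using assms terminal_EdgeP[of e m] terminal_EdgeP[of f n] disjoint_Vert[of "m + 1" "n + 1"] by fastforce
  then show ?thesis
    using left_resolving assms by blast
qed

lemma edge_out_eq: "e \<in> EdgeM L n \<Longrightarrow> edge_out L (source L e) (labelM L e) = e"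
  unfolding edge_out_def by (rule some_equality) (auto intro: EdgeM_eqI)

lemma edge_in_eq: "e \<in> EdgeP L n \<Longrightarrow> edge_in L (terminal L e) (labelP L e) = e"
  unfolding edge_in_def by (rule some_equality) (auto intro: EdgeP_eqI)

lemma
  assumes "x \<in> XL L" "k < l"
  shows edge_out_vx: "edge_out L (vx x (k - 1) l) (label_at L x k) = em x k l"
    and edge_in_vx: "edge_in L (vx x k (l + 1)) (label_at L x l) = ep x k l"
  using edge_out_eq[OF em_EdgeM[OF assms]] edge_in_eq[OF ep_EdgeP[OF assms]]
  by (simp_all add: assms source_em terminal_ep labelM_em labelP_ep)

lemma
  assumes "x \<in> XL L" "k < l"
  shows stepM_vx: "stepM L (label_at L x k) (vx x (k - 1) l) = vx x k l"
    and stepP_vx: "stepP L (label_at L x l) (vx x k (l + 1)) = vx x k l"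
  using assms by (simp_all add: edge_out_vx edge_in_vx terminal_em source_ep)

text \<open>
  A vertex and the labels below it determine all that lies below it: walk from \<open>(k', l')\<close> to \<open>(k', l)\<close> along $E^+$ and
  on to \<open>(k, l)\<close> along $E^-$; each edge on the way is determined by its label and by the vertex already known.
\<close>

lemma vx_eq_from_corner:
  assumes x: "x \<in> XL L" and y: "y \<in> XL L" and v: "vx x k' l' = vx y k' l'"
    and ineq: "k' \<le> k" "k < l" "l \<le> l'"
    and M: "\<And>n. k' < n \<Longrightarrow> n \<le> k \<Longrightarrow> label_at L x n = label_at L y n"
    and P: "\<And>n. l \<le> n \<Longrightarrow> n < l' \<Longrightarrow> label_at L x n = label_at L y n"
  shows "vx x k l = vx y k l"
proof -
  have "l \<le> i \<longrightarrow> vx x k' i = vx y k' i" if "i \<le> l'" for i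
    using that
  proof (induction rule: int_le_induct)
    case (step i)
    show ?case
    proof
      assume "l \<le> i - 1"
      then have "stepP L (label_at L x (i - 1)) (vx x k' (i - 1 + 1)) = stepP L (label_at L y (i - 1)) (vx y k' (i - 1 + 1))"
        using step P by simp
      then show "vx x k' (i - 1) = vx y k' (i - 1)"
        using stepP_vx[OF x, of k' "i - 1"] stepP_vx[OF y, of k' "i - 1"] \<open>l \<le> i - 1\<close> ineq by simp
    qed
  qed (use v in simp)
  then have "vx x k' l = vx y k' l"
    using ineq by blast
  have "i \<le> k \<longrightarrow> vx x i l = vx y i l" if "k' \<le> i" for i
    using that
  proof (induction rule: int_ge_induct)
    case (step i)
    show ?case
    proof
      assume "i + 1 \<le> k"
      then have "stepM L (label_at L x (i + 1)) (vx x (i + 1 - 1) l) = stepM L (label_at L y (i + 1)) (vx y (i + 1 - 1) l)"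
        using step M by simp
      then show "vx x (i + 1) l = vx y (i + 1) l"
        using stepM_vx[OF x, of "i + 1" l] stepM_vx[OF y, of "i + 1" l] \<open>i + 1 \<le> k\<close> ineq by simp
    qed
  qed (use \<open>vx x k' l = vx y k' l\<close> in simp)
  then show ?thesis
    using ineq by blast
qed

lemma config_eq_at:
  assumes x: "x \<in> XL L" and y: "y \<in> XL L" and v: "vx x (k - 1) (l + 1) = vx y (k - 1) (l + 1)"
    and kl: "k < l" and label_at: "label_at L x k = label_at L y k" "label_at L x l = label_at L y l"
  shows "x (k, l) = y (k, l)"
proof -
  have *: "vx x i j = vx y i j" if "k - 1 \<le> i" "i \<le> k" "l \<le> j" "j \<le> l + 1" for i j
  proof (rule vx_eq_from_corner[OF x y v])
    show "label_at L x n = label_at L y n" if "k - 1 < n" "n \<le> i" for n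
      using that \<open>i \<le> k\<close> label_at(1) by (cases "n = k") auto
    show "label_at L x n = label_at L y n" if "j \<le> n" "n < l + 1" for n
      using that \<open>l \<le> j\<close> label_at(2) by (cases "n = l") auto
  qed (use that kl in auto)
  have "em x k l = em y k l"
    using edge_out_vx[OF x kl] edge_out_vx[OF y kl] label_at *[of "k - 1" l] by simp
  moreover have "ep x k l = ep y k l"
    using edge_in_vx[OF x kl] edge_in_vx[OF y kl] label_at *[of k "l + 1"] by simp
  ultimately show ?thesis
    using *[of k l] by (simp add: vx_def em_def ep_def prod_eq_iff)
qed

lemma Rpq_iff:
  "(x, z) \<in> Rpq L p q \<longleftrightarrow> x \<in> XL L \<and> z \<in> XL L \<and> (\<forall>k\<le>p. \<forall>l\<ge>q. x (k, l) = z (k, l))"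
  by (force simp: Rpq_def restrict_def fun_eq_iff)

lemma Rpq_mono: "p' \<le> p \<Longrightarrow> q \<le> q' \<Longrightarrow> Rpq L p q \<subseteq> Rpq L p' q'"
  by (auto simp: Rpq_iff)

lemma Rpq_lab:
  assumes "(x, z) \<in> Rpq L p q" "p < q" "n \<le> p \<or> q \<le> n"
  shows "label_at L x n = label_at L z n"
proof -
  have xz: "x \<in> XL L" "z \<in> XL L"
    using assms by (auto simp: Rpq_iff)
  show ?thesis
  proof (cases "n \<le> p")
    case True
    then have "x (n, q) = z (n, q)"
      using assms by (auto simp: Rpq_iff)
    then show ?thesis
      using labelM_em[OF xz(1), of n q] labelM_em[OF xz(2), of n q] True assms by (simp add: em_def)
  next
    case False
    then have "x (p, n) = z (p, n)"
      using assms by (auto simp: Rpq_iff)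
    then show ?thesis
      using labelP_ep[OF xz(1), of p n] labelP_ep[OF xz(2), of p n] False assms by (simp add: ep_def)
  qed
qed

text \<open>
  If two configurations agree on a far square and their labels agree on the strips in between, then they
  agree on the larger square, since every vertex of it lies below a vertex of the far square.
\<close>

lemma Rpq_enlarge:
  assumes R: "(x, z) \<in> Rpq L p' q'" and le: "p' \<le> p" "p < q" "q \<le> q'"
    and label_at: "\<And>n. p' < n \<and> n \<le> p \<or> q \<le> n \<and> n < q' \<Longrightarrow> label_at L x n = label_at L z n"
  shows "(x, z) \<in> Rpq L p q"
proof -
  have xz: "x \<in> XL L" "z \<in> XL L"
    using R by (auto simp: Rpq_iff)
  have lab': "label_at L x n = label_at L z n" if "n \<le> p \<or> q \<le> n" for n
  proof (cases "n \<le> p' \<or> q' \<le> n")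
    case True
    then show ?thesis
      using Rpq_lab[OF R] le by simp
  next
    case False
    then show ?thesis
      using label_at that by simp
  qed
  have "x (k, l) = z (k, l)" if kl: "k \<le> p" "q \<le> l" for k l
  proof (rule config_eq_at[OF xz])
    define K M where "K = min p' (k - 1)" and "M = max q' (l + 1)"
    have "vx x K M = vx z K M"
      using R by (simp add: Rpq_iff vx_def K_def M_def)
    then show "vx x (k - 1) (l + 1) = vx z (k - 1) (l + 1)"
      by (rule vx_eq_from_corner[OF xz]) (use kl le lab' in \<open>auto simp: K_def M_def\<close>)
  qed (use kl le lab' in auto)
  then show ?thesis
    using xz by (simp add: Rpq_iff)
qed

lemma Rpq_eqI:
  assumes R: "(x, z) \<in> Rpq L p q" and "p < q" and label_at: "\<And>n. p < n \<Longrightarrow> n < q \<Longrightarrow> label_at L x n = label_at L z n"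
  shows "x = z"
proof -
  have xz: "x \<in> XL L" "z \<in> XL L"
    using R by (auto simp: Rpq_iff)
  have lab': "label_at L x n = label_at L z n" for n
    using Rpq_lab[OF R \<open>p < q\<close>, of n] label_at[of n] by (cases "n \<le> p \<or> q \<le> n") auto
  have "x (k, l) = z (k, l)" if kl: "k < l" for k l
  proof (rule config_eq_at[OF xz])
    define K M where "K = min p (k - 1)" and "M = max q (l + 1)"
    have "vx x K M = vx z K M"
      using R by (simp add: Rpq_iff vx_def K_def M_def)
    then show "vx x (k - 1) (l + 1) = vx z (k - 1) (l + 1)"
      by (rule vx_eq_from_corner[OF xz]) (use kl lab' in \<open>auto simp: K_def M_def\<close>)
  qed (use kl lab' in auto)
  moreover have "x i = z i" if "i \<notin> Z2lt" for i
    using xz that by (simp add: XL_def extensional_arb[of _ Z2lt])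
  ultimately have "x (k, l) = z (k, l)" for k l
    by (cases "k < l") (auto simp: Z2lt_def)
  then show ?thesis
    by (simp add: fun_eq_iff)
qed

lemma cyl_refl: "x \<in> XL L \<Longrightarrow> x \<in> cyl L p q x"
  by (simp add: cyl_def)

lemma cyl_eq: "y \<in> cyl L p q x \<Longrightarrow> cyl L p q y = cyl L p q x"
  by (auto simp: cyl_def)

lemma cyl_subset: "cyl L p q x \<subseteq> XL L"
  by (auto simp: cyl_def)

lemma cyl_mono:
  assumes "x \<in> XL L" "p' \<le> p" "p < q" "q \<le> q'"
  shows "cyl L p' q' x \<subseteq> cyl L p q x"
proof
  fix y assume y: "y \<in> cyl L p' q' x"
  have "vx y p q = vx x p q"
    by (rule vx_eq_from_corner[of y x p' q']) (use y assms in \<open>auto simp: cyl_def\<close>)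
  then show "y \<in> cyl L p q x"
    using y assms by (auto simp: cyl_def)
qed

text \<open>
  Being in \<open>Rpq L p q\<close> is detected far out: it only depends on the far square and on the labels between
  the two squares.  This makes the inductive limit topology on $R_{\mathcal L}$ computable, as it
  shows that \<open>Rpq L p q\<close> is open in the larger relations.
\<close>

lemma Rpq_cyl:
  assumes ab: "(a, b) \<in> Rpq L p' q'" "a \<in> cyl L p' q' x" "b \<in> cyl L p' q' z"
    and xz: "(x, z) \<in> Rpq L p q" and le: "p' \<le> p" "p < q" "q \<le> q'"
  shows "(a, b) \<in> Rpq L p q"
proof (rule Rpq_enlarge[OF ab(1) le])
  fix n assume "p' < n \<and> n \<le> p \<or> q \<le> n \<and> n < q'"
  then show "label_at L a n = label_at L b n"
    using Rpq_lab[OF xz le(2), of n] ab(2,3) le by (auto simp: cyl_def)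
qed

end

lemma readsD: "reads L a k l u \<Longrightarrow> k < l" "reads L a k l u \<Longrightarrow> u \<in> Vert L (lev k l)"
  by (auto simp: reads_def)

lemma reads_cong:
  assumes "\<And>n. k < n \<Longrightarrow> n < l \<Longrightarrow> a n = b n"
  shows "reads L a k l u \<longleftrightarrow> reads L b k l u"
proof -
  have "map a [k+1..l-1] = map b [k+1..l-1]"
    using assms by auto
  then show ?thesis
    by (simp only: reads_def)
qed

context fpcc_bisystem
begin

lemma reads_iff_F_words:
  "reads L a k l u \<longleftrightarrow> k < l \<and> u \<in> Vert L (lev k l) \<and> map a [k+1..l-1] \<in> F_words L (lev k l) u"
  using FPCC by (auto simp: reads_def FPCC_def)

lemma reads_extend_M:
  assumes "e \<in> EdgeM L (lev k l)" "reads L a k l (terminal L e)" "labelM L e = a k"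
  shows "reads L a (k - 1) l (source L e)"
proof -
  have kl: "k < l"
    using assms(2) by (rule readsD)
  have "map a [k..l-1] = a k # map a [k+1..l-1]"
    using kl by (simp add: upto_rec1)
  then show ?thesis
    using assms kl source_EdgeM[OF assms(1)] by (auto simp: reads_iff_F_words lev_simps F_words_Suc)
qed

lemma reads_extend_P:
  assumes "e \<in> EdgeP L (lev k l)" "reads L a k l (source L e)" "labelP L e = a l"
  shows "reads L a k (l + 1) (terminal L e)"
proof -
  have kl: "k < l"
    using assms(2) by (rule readsD)
  have "map a [k+1..l] = map a [k+1..l-1] @ [a l]"
    using kl by (simp add: upto_rec2)
  then show ?thesis
    using assms kl terminal_EdgeP[OF assms(1)] by (auto simp: reads_def lev_simps P_words_Suc)
qed

lemma reads_edge_out: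
  assumes "reads L a (k - 1) l u" "k < l"
  shows "edge_out L u (a k) \<in> EdgeM L (lev k l)" "source L (edge_out L u (a k)) = u"
    "labelM L (edge_out L u (a k)) = a k" "reads L a k l (stepM L (a k) u)"
proof -
  have "map a [k..l-1] = a k # map a [k+1..l-1]"
    using assms by (simp add: upto_rec1)
  then obtain e where e: "e \<in> EdgeM L (lev k l)" "source L e = u" "labelM L e = a k"
    "map a [k+1..l-1] \<in> F_words L (lev k l) (terminal L e)"
    using assms by (auto simp: reads_iff_F_words lev_simps F_words_Suc)
  then have "edge_out L u (a k) = e"
    using edge_out_eq by metis
  then show "edge_out L u (a k) \<in> EdgeM L (lev k l)" "source L (edge_out L u (a k)) = u"
    "labelM L (edge_out L u (a k)) = a k" "reads L a k l (stepM L (a k) u)"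
    using e assms terminal_EdgeM[OF e(1)] by (auto simp: reads_iff_F_words)
qed

lemma reads_edge_in:
  assumes "reads L a k (l + 1) u" "k < l"
  shows "edge_in L u (a l) \<in> EdgeP L (lev k l)" "terminal L (edge_in L u (a l)) = u"
    "labelP L (edge_in L u (a l)) = a l" "reads L a k l (stepP L (a l) u)"
proof -
  have "map a [k+1..l] = map a [k+1..l-1] @ [a l]"
    using assms by (simp add: upto_rec2)
  then obtain e where e: "e \<in> EdgeP L (lev k l)" "terminal L e = u" "labelP L e = a l"
    "map a [k+1..l-1] \<in> P_words L (lev k l) (source L e)"
    using assms by (auto simp: reads_def lev_simps P_words_Suc)
  then have "edge_in L u (a l) = e"
    using edge_in_eq by metis
  then show "edge_in L u (a l) \<in> EdgeP L (lev k l)" "terminal L (edge_in L u (a l)) = u"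
    "labelP L (edge_in L u (a l)) = a l" "reads L a k l (stepP L (a l) u)"
    using e assms source_EdgeP[OF e(1)] by (auto simp: reads_def)
qed

text \<open>
  The local property in terms of partial maps: an $E^-$ step and an $E^+$ step commute.  The $E^+$ edge into \<open>u\<close> and
  the $E^-$ edge out of its source form a path of the kind counted on one side of the bijection.  The path on the
  other side that belongs to it has the same labels, so its edges are those selected by the steps in the other
  order.
\<close>

lemma step_commute:
  assumes u: "reads L a (k - 1) (l + 1) u" and kl: "k < l"
  shows "stepM L (a k) (stepP L (a l) u) = stepP L (a l) (stepM L (a k) u)"
proof -
  let ?e = "edge_in L u (a l)" let ?w = "source L ?e" let ?f = "edge_out L ?w (a k)"
  have e: "?e \<in> EdgeP L (lev (k - 1) l)" "terminal L ?e = u" "labelP L ?e = a l" "reads L a (k - 1) l ?w"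
    using reads_edge_in[OF u] kl by auto
  have f: "?f \<in> EdgeM L (lev k l)" "source L ?f = ?w" "labelM L ?f = a k"
    using reads_edge_out[OF e(4) kl] by auto
  have l: "lev (k - 1) l = lev k l + 1" "lev (k - 1) (l + 1) = lev k l + 2"
    using kl by (simp_all add: lev_def)
  have "(?f, ?e) \<in> paths_MP L (lev k l) (terminal L ?f) u"
    using e f l by (simp add: paths_MP_def)
  moreover have "terminal L ?f \<in> Vert L (lev k l)" "u \<in> Vert L (lev k l + 2)"
    using f(1) terminal_EdgeM readsD(2)[OF u] l by auto
  ultimately obtain \<phi> where \<phi>: "bij_betw \<phi> (paths_PM L (lev k l) (terminal L ?f) u) (paths_MP L (lev k l) (terminal L ?f) u)"
    "\<And>fp fm em ep. (fp, fm) \<in> paths_PM L (lev k l) (terminal L ?f) u \<Longrightarrow> \<phi> (fp, fm) = (em, ep) \<Longrightarrow>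
                labelP L fp = labelP L ep \<and> labelM L fm = labelM L em"
    "(?f, ?e) \<in> paths_MP L (lev k l) (terminal L ?f) u"
    using local_property by blast
  have "(?f, ?e) \<in> \<phi> ` paths_PM L (lev k l) (terminal L ?f) u"
    using \<phi>(1,3) by (simp only: bij_betw_def)
  then obtain fp fm where fpm: "(fp, fm) \<in> paths_PM L (lev k l) (terminal L ?f) u" "\<phi> (fp, fm) = (?f, ?e)"
    by (elim imageE) (metis surj_pair)
  have lbl: "labelP L fp = a l" "labelM L fm = a k"
    using \<phi>(2)[OF fpm] e(3) f(3) by auto
  have paths: "fp \<in> EdgeP L (lev k l)" "fm \<in> EdgeM L (lev k l + 1)" "source L fp = terminal L ?f"
    "terminal L fp = terminal L fm" "source L fm = u"
    using fpm(1) by (auto simp: paths_PM_def)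
  have "edge_out L u (a k) = fm" "edge_in L (terminal L fm) (a l) = fp"
    using edge_out_eq[OF paths(2)] edge_in_eq[OF paths(1)] lbl paths by simp_all
  then show ?thesis
    using paths by simp
qed

lemma reads_stepsM: "reads L a k l u \<Longrightarrow> k + int j < l \<Longrightarrow> reads L a (k + int j) l (stepsM L a k j u)"
proof (induction j)
  case (Suc j)
  then have "reads L a (k + int j + 1 - 1) l (stepsM L a k j u)"
    by simp
  from reads_edge_out(4)[OF this] show ?case
    using Suc.prems by (simp add: algebra_simps)
qed simp

lemma reads_stepsP: "reads L a k l u \<Longrightarrow> k < l - int j \<Longrightarrow> reads L a k (l - int j) (stepsP L a l j u)"
proof (induction j)
  case (Suc j)
  then have "reads L a k (l - int j - 1 + 1) (stepsP L a l j u)"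
    by simp
  from reads_edge_in(4)[OF this] show ?case
    using Suc.prems by (simp add: algebra_simps)
qed simp

lemma stepsM_stepP:
  "reads L a k (l + 1) u \<Longrightarrow> k + int j < l \<Longrightarrow>
    stepP L (a l) (stepsM L a k j u) = stepsM L a k j (stepP L (a l) u)"
proof (induction j)
  case (Suc j)
  have "reads L a (k + int j) (l + 1) (stepsM L a k j u)"
    using Suc.prems by (intro reads_stepsM) auto
  then have "stepM L (a (k + int j + 1)) (stepP L (a l) (stepsM L a k j u))
      = stepP L (a l) (stepM L (a (k + int j + 1)) (stepsM L a k j u))"
    using Suc.prems by (intro step_commute) auto
  then show ?case
    using Suc by simp
qed simp

lemma stepsP_stepM:
  "reads L a (k - 1) l u \<Longrightarrow> k < l - int j \<Longrightarrow>
    stepM L (a k) (stepsP L a l j u) = stepsP L a l j (stepM L (a k) u)"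
proof (induction j)
  case (Suc j)
  have "reads L a (k - 1) (l - int j) (stepsP L a l j u)"
    using Suc.prems by (intro reads_stepsP) auto
  then have "stepM L (a k) (stepP L (a (l - int j - 1)) (stepsP L a l j u))
      = stepP L (a (l - int j - 1)) (stepM L (a k) (stepsP L a l j u))"
    using Suc.prems by (intro step_commute) auto
  then show ?case
    using Suc by simp
qed simp

lemma reads_vx:
  assumes x: "x \<in> XL L"
  shows "k < l \<Longrightarrow> reads L (label_at L x) k l (vx x k l)"
proof (induction l rule: int_gr_induct)
  case base
  show ?case
    using vx_Vert[OF x, of k "k + 1"] by (auto simp: reads_def lev_def P_words_def)
next
  case (step l)
  then show ?case
    using reads_extend_P[OF ep_EdgeP[OF x]] by (simp add: x source_ep terminal_ep labelP_ep)
qed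

text \<open>
  The key construction.  Whenever \<open>x\<close> and \<open>y\<close> have the same vertex at \<open>(p, q)\<close>, the triangle of \<open>x\<close>
  below it can be exchanged for that of \<open>y\<close>.  Outside the square at \<open>(p, q)\<close> this forces new vertices
  everywhere, and they are found by walking down from the unchanged square along the new labels.
  FPCC is what lets the walk go on beyond the triangle: the changed word can be read from the vertex of \<open>x\<close> at
  \<open>(p, q)\<close>, hence, extended on both sides, from all vertices of the square, and so both kinds of steps exist.
  The local property makes the result independent of the way down.
\<close>

lemma config_refill:
  assumes x: "x \<in> XL L" and y: "y \<in> XL L" and pq: "p < q" and v: "vx x p q = vx y p q"
  obtains z where "z \<in> XL L" "(z, x) \<in> Rpq L p q" "\<And>n. p < n \<Longrightarrow> n < q \<Longrightarrow> label_at L z n = label_at L y n"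
proof -
  define a where "a n = (if p < n \<and> n < q then label_at L y n else label_at L x n)" for n
  have a_x: "a n = label_at L x n" if "n \<le> p \<or> q \<le> n" for n
    using that by (auto simp: a_def)
  \<comment> \<open>the nearest position of the square above \<open>(k, l)\<close> is \<open>(min p k, max q l)\<close>; go down from there\<close>
  define w where "w k l = stepsM L a (min p k) (nat (k - min p k))
    (stepsP L a (max q l) (nat (max q l - l)) (vx x (min p k) (max q l)))" for k l
  define z where "z = restrict (\<lambda>(k, l). (w k l, edge_out L (w (k - 1) l) (a k), edge_in L (w k (l + 1)) (a l))) Z2lt"
  have base: "reads L a p q (vx x p q)"
    using reads_vx[OF y pq] reads_cong[of p q a "label_at L y" L "vx y p q"] by (simp add: a_def v)
  have right: "reads L a p l (vx x p l)" if "q \<le> l" for l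
    using that
  proof (induction l rule: int_ge_induct)
    case (step l)
    then show ?case
      using reads_extend_P[OF ep_EdgeP[OF x], of p l a] pq by (simp add: x source_ep terminal_ep labelP_ep a_x)
  qed (rule base)
  have rd: "reads L a k l (vx x k l)" if "k \<le> p" "q \<le> l" for k l
    using that(1)
  proof (induction k rule: int_le_induct)
    case (step k)
    then show ?case
      using reads_extend_M[OF em_EdgeM[OF x], of k l a] pq that by (simp add: x source_em terminal_em labelM_em a_x)
  qed (rule right[OF that(2)])
  have w_sq: "w k l = vx x k l" if "k \<le> p" "q \<le> l" for k l
    using that by (simp add: w_def min_absorb2 max_absorb2)
  have rP: "reads L a k l (stepsP L a (max q l) (nat (max q l - l)) (vx x k (max q l)))"
    if "k \<le> p" "k < l" for k l
    using reads_stepsP[OF rd[of k "max q l"], of "nat (max q l - l)"] that by simp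
  have rw: "reads L a k l (w k l)" if "k < l" for k l
    using reads_stepsM[OF rP[of "min p k" l], of "nat (k - min p k)"] that by (simp add: w_def)
  have stM: "stepM L (a k) (w (k - 1) l) = w k l" if "k < l" for k l
  proof (cases "p < k")
    case True
    then have "nat (k - min p k) = Suc (nat (k - 1 - min p (k - 1)))" "min p (k - 1) = min p k"
      "min p k + int (nat (k - 1 - min p (k - 1))) + 1 = k"
      by auto
    then show ?thesis
      by (simp add: w_def)
  next
    case False
    let ?Q = "max q l" let ?j = "nat (max q l - l)"
    have "stepM L (a k) (stepsP L a ?Q ?j (vx x (k - 1) ?Q)) = stepsP L a ?Q ?j (stepM L (a k) (vx x (k - 1) ?Q))"
      using False that by (intro stepsP_stepM rd) auto
    also have "stepM L (a k) (vx x (k - 1) ?Q) = vx x k ?Q"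
      using stepM_vx[OF x, of k ?Q] False that by (simp add: a_x)
    finally show ?thesis
      using False by (simp add: w_def min_absorb2)
  qed
  have stP: "stepP L (a l) (w k (l + 1)) = w k l" if "k < l" for k l
  proof -
    let ?P = "min p k" let ?i = "nat (k - min p k)"
    let ?u = "stepsP L a (max q (l + 1)) (nat (max q (l + 1) - (l + 1))) (vx x ?P (max q (l + 1)))"
    have "stepP L (a l) (stepsM L a ?P ?i ?u) = stepsM L a ?P ?i (stepP L (a l) ?u)"
      using that by (intro stepsM_stepP rP) auto
    moreover have "stepP L (a l) ?u = stepsP L a (max q l) (nat (max q l - l)) (vx x ?P (max q l))"
    proof (cases "l < q")
      case True
      then have "nat (max q l - l) = Suc (nat (max q (l + 1) - (l + 1)))" "max q (l + 1) = max q l"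
        "max q l - int (nat (max q (l + 1) - (l + 1))) - 1 = l"
        by auto
      then show ?thesis
        by simp
    next
      case False
      then show ?thesis
        using stepP_vx[OF x, of ?P l] that by (simp add: a_x max_absorb2)
    qed
    ultimately show ?thesis
      by (simp add: w_def)
  qed
  have z: "vx z k l = w k l" "em z k l = edge_out L (w (k - 1) l) (a k)" "ep z k l = edge_in L (w k (l + 1)) (a l)"
    if "k < l" for k l
    using that by (simp_all add: z_def vx_def em_def ep_def Z2lt_def)
  have edges: "w k l \<in> Vert L (lev k l)"
    "edge_out L (w (k - 1) l) (a k) \<in> EdgeM L (lev k l)" "source L (edge_out L (w (k - 1) l) (a k)) = w (k - 1) l"
    "labelM L (edge_out L (w (k - 1) l) (a k)) = a k"
    "edge_in L (w k (l + 1)) (a l) \<in> EdgeP L (lev k l)" "terminal L (edge_in L (w k (l + 1)) (a l)) = w k (l + 1)"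
    "labelP L (edge_in L (w k (l + 1)) (a l)) = a l" if "k < l" for k l
    using reads_edge_out[OF rw[of "k - 1" l] that] reads_edge_in[OF rw[of k "l + 1"] that] readsD(2)[OF rw[OF that]] that
    by auto
  have "a n \<in> Alph L" for n
    using labelM_Alph[OF edges(2)[of n "n + 1"]] edges(4)[of n "n + 1"] by simp
  then have lz: "label_sequence L z a"
    using edges z by (auto simp: label_sequence_def Z2lt_def)
  have zX: "z \<in> XL L"
    unfolding XL_def mem_Collect_eq
    using lz edges stM stP z by (auto simp: Z2lt_def z_def)
  have la: "a = label_at L z"
    using label_sequence_lab[OF zX] lz by simp
  have "z (k, l) = x (k, l)" if "k \<le> p" "q \<le> l" for k l
    using that pq la w_sq by (intro config_eq_at[OF zX x]) (auto simp: z a_def simp flip: la)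
  then have "(z, x) \<in> Rpq L p q"
    using zX x by (simp add: Rpq_iff)
  moreover have "label_at L z n = label_at L y n" if "p < n" "n < q" for n
    using that by (simp flip: la add: a_def)
  ultimately show ?thesis
    using that zX by blast
qed

text \<open>
  Refilling in the form in which it is used: the graph of the partial homeomorphism that belongs to a basic
  set of pairs lies over the whole cylinder.
\<close>

lemma cyl_Rpq_lift:
  assumes "(x, z) \<in> Rpq L p q" "p < q" "z' \<in> cyl L p q z"
  obtains x' where "(x', z') \<in> Rpq L p q" "x' \<in> cyl L p q x"
proof -
  have "vx x p q = vx z p q"
    using assms by (simp add: Rpq_iff vx_def)
  then have "vx z' p q = vx x p q" "z' \<in> XL L" "x \<in> XL L"
    using assms by (auto simp: cyl_def Rpq_iff)
  then obtain x' where x': "x' \<in> XL L" "(x', z') \<in> Rpq L p q"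
      "\<And>n. p < n \<Longrightarrow> n < q \<Longrightarrow> label_at L x' n = label_at L x n"
    using config_refill[of z' x p q] \<open>p < q\<close> by metis
  moreover have "vx x' p q = vx z' p q"
    using x' by (simp add: Rpq_iff vx_def)
  ultimately show ?thesis
    using that \<open>vx z' p q = vx x p q\<close> by (auto simp: cyl_def)
qed

end

context lambda_graph_bisystem
begin

section \<open>The configuration space is compact and totally disconnected\<close>

lemma cylinder_eq_cyl:
  assumes "x \<in> XL L"
  shows "cylinder L p q (map (label_at L x) [p+1..q-1]) (vx x p q) = cyl L p q x"
  by (auto simp: cylinder_def cyl_def label_sequence_lab)

lemma P_words_vx:
  assumes x: "x \<in> XL L"
  shows "k < l \<Longrightarrow> map (label_at L x) [k+1..l-1] \<in> P_words L (lev k l) (vx x k l)"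
proof (induction l rule: int_gr_induct)
  case base
  show ?case
    by (auto simp: lev_def P_words_def)
next
  case (step l)
  have "map (label_at L x) [k+1..l] = map (label_at L x) [k+1..l-1] @ [label_at L x l]"
    using step by (simp add: upto_rec2)
  then show ?case
    using step ep_EdgeP[OF x, of k l] terminal_ep[OF x, of k l] source_ep[OF x, of k l] labelP_ep[OF x, of k l]
    by (auto simp: lev_simps P_words_Suc)
qed

text \<open>
  The cylinders are a base and not merely a subbase because cylinders around one configuration shrink as
  \<open>(p, q)\<close> moves outwards.
\<close>

lemma openin_Xtop_iff:
  "openin (Xtop L) W \<longleftrightarrow> W \<subseteq> XL L \<and> (\<forall>x\<in>W. \<exists>p q. p < q \<and> cyl L p q x \<subseteq> W)"
    (is "?L \<longleftrightarrow> ?R")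
proof
  assume ?L
  then have "generate_topology_on {cylinder L p q \<mu> v | p q \<mu> v. (p, q) \<in> Z2lt \<and> v \<in> Vert L (lev p q) \<and> \<mu> \<in> P_words L (lev p q) v} W"
    by (simp add: Xtop_def openin_topology_generated_by_iff)
  then show ?R
  proof (induction rule: generate_topology_on.induct)
    case (Int a b)
    show ?case
    proof (intro conjI ballI)
      fix x assume x: "x \<in> a \<inter> b"
      then obtain p q p' q' where "p < q" "cyl L p q x \<subseteq> a" "p' < q'" "cyl L p' q' x \<subseteq> b"
        using Int by blast
      moreover have "x \<in> XL L"
        using Int x by blast
      ultimately have "min p p' < max q q'" "cyl L (min p p') (max q q') x \<subseteq> a \<inter> b"
        using cyl_mono[of x "min p p'" p q "max q q'"] cyl_mono[of x "min p p'" p' q' "max q q'"] by auto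
      then show "\<exists>p q. p < q \<and> cyl L p q x \<subseteq> a \<inter> b"
        by blast
    qed (use Int in blast)
  next
    case (UN K)
    then show ?case
      by (meson Sup_le_iff UnionE Union_upper order_trans)
  next
    case (Basis s)
    then obtain p q \<mu> v where s: "s = cylinder L p q \<mu> v" "p < q"
      by (auto simp: Z2lt_def)
    have "cyl L p q x \<subseteq> s" if "x \<in> s" for x
    proof -
      have "x \<in> XL L" "\<mu> = map (label_at L x) [p+1..q-1]" "v = vx x p q"
        using that s by (auto simp: cylinder_def label_sequence_lab)
      then show ?thesis
        using s cylinder_eq_cyl by auto
    qed
    moreover have "s \<subseteq> XL L"
      using s by (auto simp: cylinder_def)
    ultimately show ?case
      using s by blast
  qed simp
next
  assume R: ?R
  have "openin (Xtop L) (cyl L p q x)" if "x \<in> W" "p < q" for p q x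
  proof -
    have x: "x \<in> XL L"
      using that R by blast
    show ?thesis
      unfolding Xtop_def cylinder_eq_cyl[OF x, symmetric]
      by (intro topology_generated_by_Basis CollectI exI conjI refl)
        (use vx_Vert[OF x] P_words_vx[OF x] that in \<open>auto simp: Z2lt_def\<close>)
  qed
  then show ?L
    using R cyl_refl by (subst openin_subopen) (metis subsetD)
qed

lemma openin_cyl: "p < q \<Longrightarrow> openin (Xtop L) (cyl L p q x)"
  unfolding openin_Xtop_iff using cyl_subset cyl_eq by blast

lemma closedin_cyl:
  assumes "p < q"
  shows "closedin (Xtop L) (cyl L p q x)"
proof -
  have "cyl L p q y \<subseteq> XL L - cyl L p q x" if "y \<in> XL L - cyl L p q x" for y
  proof
    fix w assume w: "w \<in> cyl L p q y"
    have "w \<notin> cyl L p q x"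
      using cyl_eq[OF w] cyl_eq[of w p q x] that cyl_refl[of y p q] by auto
    then show "w \<in> XL L - cyl L p q x"
      using w cyl_subset by blast
  qed
  then show ?thesis
    using assms cyl_subset unfolding closedin_def topspace_Xtop openin_Xtop_iff by blast
qed

lemma cyl_separates:
  assumes x: "x \<in> XL L" and y: "y \<in> XL L" and "x \<noteq> y"
  obtains p q where "p < q" "cyl L p q x \<inter> cyl L p q y = {}"
proof -
  have "\<exists>p q. p < q \<and> y \<notin> cyl L p q x"
  proof (rule ccontr)
    assume "\<nexists>p q. p < q \<and> y \<notin> cyl L p q x"
    then have *: "y \<in> cyl L p q x" if "p < q" for p q
      using that by blast
    have "y (k, l) = x (k, l)" if "k < l" for k l
      using *[of "k - 1" "l + 1"] that by (intro config_eq_at[OF y x]) (auto simp: cyl_def)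
    moreover have "y i = x i" if "i \<notin> Z2lt" for i
      using x y that by (simp add: XL_def extensional_arb[of _ Z2lt])
    ultimately have "y (k, l) = x (k, l)" for k l
      by (cases "k < l") (auto simp: Z2lt_def)
    then show False
      using \<open>x \<noteq> y\<close> by (simp add: fun_eq_iff)
  qed
  then show ?thesis
    using that cyl_eq y cyl_refl by (metis disjoint_iff)
qed

lemma Hausdorff_Xtop: "Hausdorff_space (Xtop L)"
  unfolding Hausdorff_space_def topspace_Xtop
  by (metis cyl_separates openin_cyl cyl_refl disjnt_def)

text \<open>
  Configurations form a closed subset of a product of finite sets: each requirement concerns two positions only,
  the existence of a label sequence being the requirement that labels agree with those of the edges
  in positions \<open>(n, n + 1)\<close>.  A cylinder is open in the product topology because it is given by finitely many
  coordinates, so Tychonoff's theorem applies.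
\<close>

lemma compact_Xtop: "compact_space (Xtop L)"
proof -
  let ?P = "product_topology (\<lambda>_. discrete_topology (UNIV :: ('v \<times> 'e \<times> 'e) set)) Z2lt"
  let ?K = "PiE Z2lt (\<lambda>(k, l). Vert L (lev k l) \<times> EdgeM L (lev k l) \<times> EdgeP L (lev k l))"
  have op1: "openin ?P {y \<in> topspace ?P. Q (y i)}" if "i \<in> Z2lt" for i Q
    using openin_continuous_map_preimage[OF continuous_map_product_projection[OF that, of "\<lambda>_. discrete_topology UNIV"], of "{b. Q b}"]
    by simp
  have cl: "closedin ?P {y \<in> topspace ?P. Q (y i) (y j)}" if "i \<in> Z2lt" "j \<in> Z2lt" for i j Q
  proof -
    have "topspace ?P - {y \<in> topspace ?P. Q (y i) (y j)}
        = (\<Union>(a, b)\<in>{(a, b). \<not> Q a b}. {y \<in> topspace ?P. y i = a} \<inter> {y \<in> topspace ?P. y j = b})"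
      by auto
    moreover have "openin ?P \<dots>"
    proof (intro openin_Union ballI)
      fix T assume "T \<in> (\<lambda>(a, b). {y \<in> topspace ?P. y i = a} \<inter> {y \<in> topspace ?P. y j = b}) ` {(a, b). \<not> Q a b}"
      then obtain a b where "T = {y \<in> topspace ?P. y i = a} \<inter> {y \<in> topspace ?P. y j = b}"
        by auto
      then show "openin ?P T"
        using that by (simp only:) (intro openin_Int op1)
    qed
    ultimately show ?thesis
      by (auto simp: closedin_def)
  qed
  \<comment> \<open>the conditions attached to position \<open>(k, l)\<close>\<close>
  define C where "C k l = ?K
     \<inter> {y \<in> topspace ?P. source L (fst (snd (y (k, l)))) = fst (y (k - 1, l))}
     \<inter> {y \<in> topspace ?P. terminal L (fst (snd (y (k, l)))) = fst (y (k, l)) \<and> source L (snd (snd (y (k, l)))) = fst (y (k, l))}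
     \<inter> {y \<in> topspace ?P. terminal L (snd (snd (y (k, l)))) = fst (y (k, l + 1))}
     \<inter> {y \<in> topspace ?P. labelM L (fst (snd (y (k, l)))) = labelM L (fst (snd (y (k, k + 1))))}
     \<inter> {y \<in> topspace ?P. labelP L (snd (snd (y (k, l)))) = labelM L (fst (snd (y (l, l + 1))))}" for k l
  have K: "compactin ?P ?K"
    unfolding compactin_PiE using finite_Vert finite_EdgeM finite_EdgeP by (auto simp: compactin_discrete_topology)
  have clK: "closedin ?P ?K"
    unfolding closedin_product_topology by auto
  have clC: "closedin ?P (C k l)" if "(k, l) \<in> Z2lt" for k l
    unfolding C_def using that
    by (intro closedin_Int clK cl cl[where i = "(k, l)" and j = "(k, l)" and Q = "\<lambda>a b. _ a"]) (auto simp: Z2lt_def)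
  have XL_eq: "XL L = (\<Inter>(k, l)\<in>Z2lt. C k l)"
  proof (intro equalityI subsetI)
    fix x assume x: "x \<in> XL L"
    have "x i \<in> (case i of (k, l) \<Rightarrow> Vert L (lev k l) \<times> EdgeM L (lev k l) \<times> EdgeP L (lev k l))" if "i \<in> Z2lt" for i
    proof -
      obtain k l where i: "i = (k, l)" "k < l"
        using \<open>i \<in> Z2lt\<close> by (auto simp: Z2lt_def)
      show ?thesis
        using XL_cell(1-3)[OF x i(2)] by (simp add: i(1) vx_def em_def ep_def mem_Times_iff)
    qed
    moreover have "x i = undefined" if "i \<notin> Z2lt" for i
      using x that by (simp add: XL_def extensional_arb[of _ Z2lt])
    ultimately have K: "x \<in> ?K"
      by (rule PiE_I)
    have "x \<in> C k l" if "(k, l) \<in> Z2lt" for k l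
    proof -
      have kl: "k < l"
        using that by (simp add: Z2lt_def)
      show ?thesis
        using K XL_cell[OF x kl] labelM_em[OF x kl] labelP_ep[OF x kl]
        by (simp add: C_def vx_def em_def ep_def label_at_def PiE_def)
    qed
    then show "x \<in> (\<Inter>(k, l)\<in>Z2lt. C k l)"
      by auto
  next
    fix x assume "x \<in> (\<Inter>(k, l)\<in>Z2lt. C k l)"
    then have x: "x \<in> C k l" if "k < l" for k l
      using that by (auto simp: Z2lt_def)
    have ext: "x \<in> ?K"
      using x[of 0 1] by (simp add: C_def)
    have cell: "vx x k l \<in> Vert L (lev k l) \<and> em x k l \<in> EdgeM L (lev k l) \<and> ep x k l \<in> EdgeP L (lev k l)" if "k < l" for k l
      using PiE_mem[OF ext, of "(k, l)"] that by (auto simp: Z2lt_def vx_def em_def ep_def mem_Times_iff)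
    have eqs: "source L (em x k l) = vx x (k - 1) l \<and> terminal L (em x k l) = vx x k l \<and>
        source L (ep x k l) = vx x k l \<and> terminal L (ep x k l) = vx x k (l + 1) \<and>
        labelM L (em x k l) = label_at L x k \<and> labelP L (ep x k l) = label_at L x l" if "k < l" for k l
      using x[OF that] by (simp add: C_def vx_def em_def ep_def label_at_def)
    have "label_at L x n \<in> Alph L" for n
      using cell[of n "n + 1"] labelM_Alph by (auto simp: label_at_def)
    then have "label_sequence L x (label_at L x)"
      using eqs by (auto simp: label_sequence_def Z2lt_def)
    moreover have "x \<in> extensional Z2lt"
      using ext by (simp add: PiE_def)
    ultimately show "x \<in> XL L"
      using cell eqs unfolding XL_def mem_Collect_eq Z2lt_def by blast
  qed
  have "closedin ?P (XL L)"
    unfolding XL_eq using clC by (intro closedin_Inter) (auto simp: Z2lt_def)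
  moreover have "XL L \<subseteq> ?K"
  proof
    fix x assume "x \<in> XL L"
    then have "x \<in> C 0 1"
      by (subst (asm) XL_eq) (auto simp: Z2lt_def)
    then show "x \<in> ?K"
      by (simp add: C_def)
  qed
  ultimately have "compactin ?P (XL L)"
    using closed_compactin K by blast
  then have "compactin (subtopology ?P (XL L)) (XL L)"
    by (simp add: compactin_subtopology)
  moreover have "continuous_map (subtopology ?P (XL L)) (Xtop L) id"
    unfolding continuous_map
  proof (intro conjI allI impI)
    show "id ` topspace (subtopology ?P (XL L)) \<subseteq> topspace (Xtop L)"
      by (auto simp: topspace_Xtop)
    fix U assume U: "openin (Xtop L) U"
    have XP: "XL L \<subseteq> topspace ?P"
      by (auto simp: XL_def PiE_def)
    have "openin (subtopology ?P (XL L)) U"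
      unfolding openin_subopen[of _ U]
    proof
      fix x assume "x \<in> U"
      then have x: "x \<in> XL L" and "\<exists>p q. p < q \<and> cyl L p q x \<subseteq> U"
        using U unfolding openin_Xtop_iff by blast+
      then obtain p q where pq: "p < q" "cyl L p q x \<subseteq> U"
        by blast
      let ?O = "{y \<in> topspace ?P. fst (y (p, q)) = vx x p q} \<inter>
          (\<Inter>n\<in>{p..q}. {y \<in> topspace ?P. p < n \<and> n < q \<longrightarrow> labelM L (fst (snd (y (n, n + 1)))) = label_at L x n})"
      have "openin ?P ?O"
        using pq by (intro openin_Int openin_INT2 op1) (auto simp: Z2lt_def)
      moreover have "cyl L p q x = ?O \<inter> XL L"
        using XP by (auto simp: cyl_def vx_def label_at_def em_def)
      ultimately have "openin (subtopology ?P (XL L)) (cyl L p q x)"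
        by (auto simp: openin_subtopology)
      then show "\<exists>T. openin (subtopology ?P (XL L)) T \<and> x \<in> T \<and> T \<subseteq> U"
        using pq cyl_refl[OF x] by blast
    qed
    moreover have "{x \<in> topspace (subtopology ?P (XL L)). id x \<in> U} = U"
      using U XP openin_subset[OF U] by (auto simp: topspace_Xtop)
    ultimately show "openin (subtopology ?P (XL L)) {x \<in> topspace (subtopology ?P (XL L)). id x \<in> U}"
      by simp
  qed
  ultimately have "compactin (Xtop L) (id ` XL L)"
    by (rule image_compactin)
  then show ?thesis
    by (simp add: compact_space_def topspace_Xtop)
qed

lemma compactin_cyl: "p < q \<Longrightarrow> compactin (Xtop L) (cyl L p q x)"
  using closedin_compact_space[OF compact_Xtop closedin_cyl] .

section \<open>The shift and the algebra of arrows\<close>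

lemma shift_pow_XL_imp:
  assumes x: "x \<in> XL L"
  shows "shift_pow n x \<in> XL L"
proof -
  have "label_sequence L (shift_pow n x) (\<lambda>k. label_at L x (k + n))"
    using label_sequence_lab[OF x, of "label_at L x"]
    by (auto simp: label_sequence_def shift_pow_def em_def ep_def Z2lt_def)
  moreover have "lev (k + n) (l + n) = lev k l" for k l
    by (simp add: lev_def)
  moreover have "shift_pow n x \<in> extensional Z2lt"
    using x by (auto simp: XL_def extensional_def shift_pow_def Z2lt_def)
  moreover have "vx (shift_pow n x) k l = vx x (k + n) (l + n)" "em (shift_pow n x) k l = em x (k + n) (l + n)"
    "ep (shift_pow n x) k l = ep x (k + n) (l + n)" for k l
    by (simp_all add: shift_pow_def vx_def em_def ep_def)
  ultimately show ?thesis
    using XL_cell[OF x, of "_ + n" "_ + n"] unfolding XL_def mem_Collect_eq Z2lt_def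
    by (auto simp: algebra_simps)
qed

lemma shift_pow_inverse: "shift_pow n (shift_pow (- n) x) = x" "shift_pow (- n) (shift_pow n x) = x"
  by (simp_all add: shift_pow_0 flip: shift_pow_add)

lemma shift_pow_XL [simp]: "shift_pow n x \<in> XL L \<longleftrightarrow> x \<in> XL L"
  using shift_pow_XL_imp shift_pow_inverse by metis

lemma shift_pow_cyl: "shift_pow n y \<in> cyl L p q (shift_pow n x) \<longleftrightarrow> y \<in> cyl L (p + n) (q + n) x"
proof -
  have "(\<forall>m. p < m \<and> m < q \<longrightarrow> label_at L (shift_pow n y) m = label_at L (shift_pow n x) m) \<longleftrightarrow>
      (\<forall>m. p + n < m \<and> m < q + n \<longrightarrow> label_at L y m = label_at L x m)" (is "?L \<longleftrightarrow> ?R")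
  proof
    assume L: ?L
    show ?R
    proof (intro allI impI)
      fix m assume "p + n < m \<and> m < q + n"
      then show "label_at L y m = label_at L x m"
        using L[rule_format, of "m - n"] by (simp add: label_at_def em_def shift_pow_def)
    qed
  next
    assume R: ?R
    show ?L
    proof (intro allI impI)
      fix m assume "p < m \<and> m < q"
      then show "label_at L (shift_pow n y) m = label_at L (shift_pow n x) m"
        using R[rule_format, of "m + n"] by (simp add: label_at_def em_def shift_pow_def algebra_simps)
    qed
  qed
  then show ?thesis
    by (simp add: cyl_def) (simp add: vx_def shift_pow_def)
qed

lemma shift_pow_Rpq: "(shift_pow n x, shift_pow n z) \<in> Rpq L p q \<longleftrightarrow> (x, z) \<in> Rpq L (p + n) (q + n)"
proof -
  have "(\<forall>k\<le>p. \<forall>l\<ge>q. shift_pow n x (k, l) = shift_pow n z (k, l)) \<longleftrightarrow>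
      (\<forall>k\<le>p + n. \<forall>l\<ge>q + n. x (k, l) = z (k, l))" (is "?L \<longleftrightarrow> ?R")
  proof
    assume L: ?L
    show ?R
    proof (intro allI impI)
      fix k l assume "k \<le> p + n" "q + n \<le> l"
      then show "x (k, l) = z (k, l)"
        using L[rule_format, of "k - n" "l - n"] by (simp add: shift_pow_def)
    qed
  qed (simp add: shift_pow_def)
  then show ?thesis
    by (simp add: Rpq_iff)
qed

lemma Rpq_sym: "(x, z) \<in> Rpq L p q \<Longrightarrow> (z, x) \<in> Rpq L p q"
  by (auto simp: Rpq_iff)

lemma RL_iff: "(x, z) \<in> RL L \<longleftrightarrow> (\<exists>p q. p < q \<and> (x, z) \<in> Rpq L p q)"
  by (auto simp: RL_def Z2lt_def)

lemma RL_sym: "(x, z) \<in> RL L \<Longrightarrow> (z, x) \<in> RL L"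
  unfolding RL_iff using Rpq_sym by blast

lemma RL_trans:
  assumes "(x, y) \<in> RL L" "(y, z) \<in> RL L"
  shows "(x, z) \<in> RL L"
proof -
  obtain p q p' q' where "p < q" "(x, y) \<in> Rpq L p q" "(y, z) \<in> Rpq L p' q'"
    using assms by (auto simp: RL_iff)
  then have "(x, y) \<in> Rpq L (min p p') (max q q')" "(y, z) \<in> Rpq L (min p p') (max q q')" "min p p' < max q q'"
    using Rpq_mono[of "min p p'" p q "max q q'"] Rpq_mono[of "min p p'" p' q' "max q q'"] by auto
  moreover from this have "(x, z) \<in> Rpq L (min p p') (max q q')"
    by (auto simp: Rpq_iff)
  ultimately show ?thesis
    unfolding RL_iff by blast
qed

lemma RL_refl: "x \<in> XL L \<Longrightarrow> (x, x) \<in> RL L"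
  by (auto simp: RL_iff Rpq_iff intro: exI[of _ 0] exI[of _ 1])

lemma shift_pow_RL: "(shift_pow n x, shift_pow n z) \<in> RL L \<longleftrightarrow> (x, z) \<in> RL L"
proof
  assume "(x, z) \<in> RL L"
  then obtain p q where "p < q" "(x, z) \<in> Rpq L p q"
    by (auto simp: RL_iff)
  then show "(shift_pow n x, shift_pow n z) \<in> RL L"
    unfolding RL_iff by (intro exI[of _ "p - n"] exI[of _ "q - n"]) (simp add: shift_pow_Rpq)
next
  assume "(shift_pow n x, shift_pow n z) \<in> RL L"
  then obtain p q where "p < q" "(x, z) \<in> Rpq L (p + n) (q + n)"
    by (auto simp: RL_iff shift_pow_Rpq)
  then show "(x, z) \<in> RL L"
    unfolding RL_iff by (intro exI[of _ "p + n"] exI[of _ "q + n"]) simp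
qed

lemma RL_XL: "(x, z) \<in> RL L \<Longrightarrow> x \<in> XL L \<and> z \<in> XL L"
  by (auto simp: RL_iff Rpq_iff)

lemma GL_iff: "(x, n, z) \<in> GL_set L \<longleftrightarrow> (shift_pow n x, z) \<in> RL L"
  using RL_XL[of "shift_pow n x" z] by (auto simp: GL_set_def)

lemma GL_D: "(x, n, z) \<in> GL_set L \<Longrightarrow> x \<in> XL L" "(x, n, z) \<in> GL_set L \<Longrightarrow> z \<in> XL L"
  by (auto simp: GL_set_def)

lemma GL_unit: "(x, 0, z) \<in> GL_set L \<longleftrightarrow> (x, z) \<in> RL L" "x \<in> XL L \<Longrightarrow> (x, 0, x) \<in> GL_set L"
  using RL_refl by (auto simp: GL_iff shift_pow_0)

lemma GL_inv: "(x, n, z) \<in> GL_set L \<Longrightarrow> (z, - n, x) \<in> GL_set L"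
  using shift_pow_RL[of "- n" "shift_pow n x" z] by (simp add: GL_iff shift_pow_inverse RL_sym)

lemma GL_mult:
  assumes "(x, n, y) \<in> GL_set L" "(y, m, z) \<in> GL_set L"
  shows "(x, n + m, z) \<in> GL_set L"
proof -
  have "(shift_pow m (shift_pow n x), shift_pow m y) \<in> RL L" "(shift_pow m y, z) \<in> RL L"
    using assms by (simp_all add: GL_iff shift_pow_RL)
  from RL_trans[OF this] show ?thesis
    by (simp add: GL_iff add.commute[of n] shift_pow_add)
qed

section \<open>The topologies of $R_{\mathcal L}$ and $\mathcal G_{\mathcal L}$\<close>

lemma R_basic_eq: "(a, b) \<in> R_basic L p q x z \<Longrightarrow> (a, b) \<in> Rpq L p q \<and> R_basic L p q a b = R_basic L p q x z"
  using cyl_eq[of a p q x] cyl_eq[of b p q z] by (auto simp: R_basic_def)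

lemma R_basic_refl: "(x, z) \<in> Rpq L p q \<Longrightarrow> (x, z) \<in> R_basic L p q x z"
  by (auto simp: R_basic_def Rpq_iff intro: cyl_refl)

text \<open>
  For the converse the intersection with each \<open>Rpq L p q\<close> has to be open.  Around one of its points take a
  product of cylinders so far out that \<open>Rpq_cyl\<close> brings the pairs back to the basic set.
\<close>

lemma openin_RL_iff:
  "openin (RL_top L) W \<longleftrightarrow>
    W \<subseteq> RL L \<and> (\<forall>(x, z)\<in>W. \<exists>p q. p < q \<and> (x, z) \<in> Rpq L p q \<and> R_basic L p q x z \<subseteq> W)"
  (is "?L \<longleftrightarrow> ?R")
proof
  assume L: ?L
  have "\<exists>p q. p < q \<and> (x, z) \<in> Rpq L p q \<and> R_basic L p q x z \<subseteq> W" if xz: "(x, z) \<in> W" for x z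
  proof -
    obtain p q where pq: "p < q" "(x, z) \<in> Rpq L p q"
      using L xz RL_iff openin_RL_top by blast
    then have "openin (Rpq_top L p q) (W \<inter> Rpq L p q)"
      using L openin_RL_top[of L W] by (auto simp: Z2lt_def)
    then obtain T where T: "openin (prod_topology (Xtop L) (Xtop L)) T" "W \<inter> Rpq L p q = T \<inter> Rpq L p q"
      unfolding Rpq_top_def openin_subtopology by blast
    moreover have "(x, z) \<in> T"
      using T xz pq by blast
    ultimately obtain U V where UV: "openin (Xtop L) U" "openin (Xtop L) V" "x \<in> U" "z \<in> V" "U \<times> V \<subseteq> T"
      unfolding openin_prod_topology_alt by meson
    then obtain p1 q1 p2 q2 where c: "p1 < q1" "cyl L p1 q1 x \<subseteq> U" "p2 < q2" "cyl L p2 q2 z \<subseteq> V"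
      by (meson openin_Xtop_iff)
    define P Q where "P = min p (min p1 p2)" and "Q = max q (max q1 q2)"
    have PQ: "P \<le> p" "P \<le> p1" "P \<le> p2" "q \<le> Q" "q1 \<le> Q" "q2 \<le> Q" "P < Q"
      using pq by (auto simp: P_def Q_def)
    have xz': "(x, z) \<in> Rpq L P Q" "x \<in> XL L" "z \<in> XL L"
      using pq(2) Rpq_mono[OF PQ(1,4)] by (blast, simp_all add: Rpq_iff)
    have "R_basic L P Q x z \<subseteq> W"
    proof
      fix ab assume "ab \<in> R_basic L P Q x z"
      then obtain a b where ab: "ab = (a, b)" "(a, b) \<in> Rpq L P Q" "a \<in> cyl L P Q x" "b \<in> cyl L P Q z"
        by (auto simp: R_basic_def)
      have "a \<in> U" "b \<in> V"
        using cyl_mono[OF xz'(2) PQ(2) c(1) PQ(5)] cyl_mono[OF xz'(3) PQ(3) c(3) PQ(6)] c ab by blast+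
      moreover have "(a, b) \<in> Rpq L p q"
        using Rpq_cyl[OF ab(2-4) pq(2) PQ(1) pq(1) PQ(4)] .
      ultimately show "ab \<in> W"
        using UV(5) T(2) ab(1) by blast
    qed
    then show ?thesis
      using PQ(7) xz' by blast
  qed
  moreover have "W \<subseteq> RL L"
    using L openin_RL_top by blast
  ultimately show ?R
    by auto
next
  assume R: ?R
  have "openin (Rpq_top L p q) (W \<inter> Rpq L p q)" if pq: "p < q" for p q
    unfolding openin_subopen[of _ "W \<inter> Rpq L p q"]
  proof clarify
    fix x z assume xz: "(x, z) \<in> W" "(x, z) \<in> Rpq L p q"
    then obtain p1 q1 where 1: "p1 < q1" "(x, z) \<in> Rpq L p1 q1" "R_basic L p1 q1 x z \<subseteq> W"
      using R by blast
    define P Q where "P = min p p1" and "Q = max q q1"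
    have PQ: "P \<le> p" "P \<le> p1" "q \<le> Q" "q1 \<le> Q" "P < Q"
      using pq by (auto simp: P_def Q_def)
    let ?N = "(cyl L P Q x \<times> cyl L P Q z) \<inter> Rpq L p q"
    have "openin (Rpq_top L p q) ?N"
      unfolding Rpq_top_def openin_subtopology using openin_cyl[OF PQ(5)]
      by (intro exI[of _ "cyl L P Q x \<times> cyl L P Q z"]) (simp add: openin_prod_Times_iff)
    moreover have "(x, z) \<in> ?N"
      using xz(2) by (auto simp: Rpq_iff intro: cyl_refl)
    moreover have "?N \<subseteq> W \<inter> Rpq L p q"
    proof
      fix c assume "c \<in> ?N"
      then obtain a b where c: "c = (a, b)"
        and ab: "a \<in> cyl L P Q x" "b \<in> cyl L P Q z" "(a, b) \<in> Rpq L p q"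
        by blast
      then have "(a, b) \<in> Rpq L P Q"
        using Rpq_mono[OF PQ(1,3)] by blast
      then have "(a, b) \<in> Rpq L p1 q1"
        by (rule Rpq_cyl[OF _ ab(1,2) 1(2) PQ(2) 1(1) PQ(4)])
      moreover have "x \<in> XL L" "z \<in> XL L"
        using xz(2) by (simp_all add: Rpq_iff)
      then have "a \<in> cyl L p1 q1 x" "b \<in> cyl L p1 q1 z"
        using cyl_mono[OF _ PQ(2) 1(1) PQ(4)] ab by blast+
      ultimately have "(a, b) \<in> R_basic L p1 q1 x z"
        by (simp add: R_basic_def)
      then show "c \<in> W \<inter> Rpq L p q"
        unfolding c using 1(3) ab(3) by blast
    qed
    ultimately show "\<exists>T. openin (Rpq_top L p q) T \<and> (x, z) \<in> T \<and> T \<subseteq> W \<inter> Rpq L p q"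
      by blast
  qed
  then show ?L
    using R by (auto simp: openin_RL_top Z2lt_def)
qed

lemma G_basic_iff:
  "(x', m, z') \<in> G_basic L p q (x, n, z) \<longleftrightarrow> m = n \<and> x' \<in> XL L \<and> z' \<in> XL L \<and>
     (shift_pow n x', z') \<in> Rpq L p q \<and> x' \<in> cyl L (p + n) (q + n) x \<and> z' \<in> cyl L p q z"
  by (auto simp: G_basic_def R_basic_def shift_pow_cyl Rpq_iff)

lemma G_basic_refl: "(shift_pow n x, z) \<in> Rpq L p q \<Longrightarrow> (x, n, z) \<in> G_basic L p q (x, n, z)"
  by (auto simp: G_basic_iff Rpq_iff intro: cyl_refl)

lemma G_basic_GL: "p < q \<Longrightarrow> G_basic L p q (x, n, z) \<subseteq> GL_set L"
  by (auto simp: G_basic_iff GL_iff RL_iff, blast)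

lemma G_basic_eq: "(x', m, z') \<in> G_basic L p q (x, n, z) \<Longrightarrow> G_basic L p q (x', m, z') = G_basic L p q (x, n, z)"
  using cyl_eq[of x' "p + n" "q + n" x] cyl_eq[of z' p q z] by (auto simp: G_basic_iff)

text \<open>
  The map that defines the topology of $\mathcal G_{\mathcal L}$ is injective because the shift is.  So a set of arrows
  is the preimage of its image, and the image is open as soon as it contains a basic set around each of its points.
\<close>

lemma openin_GL_iff:
  "openin (gtop (GL L)) W \<longleftrightarrow> W \<subseteq> GL_set L \<and>
     (\<forall>(x, n, z)\<in>W. \<exists>p q. p < q \<and> (shift_pow n x, z) \<in> Rpq L p q \<and> G_basic L p q (x, n, z) \<subseteq> W)"
  (is "?L \<longleftrightarrow> ?R")
proof
  let ?f = "\<lambda>(x, n, z). ((shift_pow n x, z), n)"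
  assume ?L
  then obtain T where T: "openin (prod_topology (RL_top L) (discrete_topology UNIV)) T" "W = ?f -` T \<inter> GL_set L"
    by (auto simp: GL_def openin_pullback_topology)
  have "\<exists>p q. p < q \<and> (shift_pow n x, z) \<in> Rpq L p q \<and> G_basic L p q (x, n, z) \<subseteq> W" if W: "(x, n, z) \<in> W" for x n z
  proof -
    have "((shift_pow n x, z), n) \<in> T"
      using W T by auto
    then obtain U V where UV: "openin (RL_top L) U" "(shift_pow n x, z) \<in> U" "n \<in> V" "U \<times> V \<subseteq> T"
      using T(1) unfolding openin_prod_topology_alt by meson
    then obtain p q where pq: "p < q" "(shift_pow n x, z) \<in> Rpq L p q" "R_basic L p q (shift_pow n x) z \<subseteq> U"
      unfolding openin_RL_iff by blast
    have "G_basic L p q (x, n, z) \<subseteq> ?f -` (U \<times> V) \<inter> GL_set L"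
      using G_basic_GL[OF pq(1)] pq(3) UV(3) by (auto simp: G_basic_def)
    then show ?thesis
      using pq UV T by blast
  qed
  then show ?R
    using T by auto
next
  let ?f = "\<lambda>(x, n, z). ((shift_pow n x, z), n)"
  assume R: ?R
  have "openin (prod_topology (RL_top L) (discrete_topology UNIV)) (?f ` W)"
    unfolding openin_prod_topology_alt
  proof (intro allI impI)
    fix xz n assume "(xz, n) \<in> ?f ` W"
    then obtain x z where W: "(x, n, z) \<in> W" "xz = (shift_pow n x, z)"
      by auto
    then obtain p q where pq: "p < q" "(shift_pow n x, z) \<in> Rpq L p q" "G_basic L p q (x, n, z) \<subseteq> W"
      using R by blast
    have "openin (RL_top L) (R_basic L p q (shift_pow n x) z)"
      unfolding openin_RL_iff using pq(1) R_basic_eq by (force simp: RL_iff)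
    moreover have "xz \<in> R_basic L p q (shift_pow n x) z"
      using W pq R_basic_refl by simp
    moreover have "R_basic L p q (shift_pow n x) z \<times> {n} \<subseteq> ?f ` W"
    proof clarify
      fix a b assume ab: "(a, b) \<in> R_basic L p q (shift_pow n x) z"
      then have "(shift_pow (- n) a, n, b) \<in> G_basic L p q (x, n, z)"
        by (auto simp: G_basic_def shift_pow_inverse R_basic_def Rpq_iff)
      then show "((a, b), n) \<in> ?f ` W"
        using pq(3) by (force simp: shift_pow_inverse intro!: image_eqI[of _ _ "(shift_pow (- n) a, n, b)"])
    qed
    ultimately show "\<exists>U V. openin (RL_top L) U \<and> openin (discrete_topology UNIV) V \<and> xz \<in> U \<and> n \<in> V \<and> U \<times> V \<subseteq> ?f ` W"
      by (intro exI[of _ "R_basic L p q (shift_pow n x) z"] exI[of _ "{n}"]) simp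
  qed
  moreover have "?f -` (?f ` W) \<inter> GL_set L = W"
  proof -
    have "g = h" if "?f g = ?f h" for g h :: "('v, 'e) garrow"
    proof -
      obtain a m b c k d where gh: "g = (a, m, b)" "h = (c, k, d)"
        using prod_cases3 by metis
      then have "shift_pow (- m) (shift_pow m a) = shift_pow (- m) (shift_pow m c)" "m = k" "b = d"
        using that by auto
      then show ?thesis
        using gh by (simp add: shift_pow_inverse)
    qed
    then show ?thesis
      using R by blast
  qed
  ultimately show ?L
    by (auto simp: GL_def openin_pullback_topology)
qed

lemma openin_G_basic: "p < q \<Longrightarrow> openin (gtop (GL L)) (G_basic L p q (x, n, z))"
  unfolding openin_GL_iff using G_basic_GL G_basic_eq by (fastforce simp: G_basic_iff)

lemma openin_GL_E:
  assumes "openin (gtop (GL L)) W" "(x, n, z) \<in> W"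
  obtains p q where "p < q" "(shift_pow n x, z) \<in> Rpq L p q" "G_basic L p q (x, n, z) \<subseteq> W" "(x, n, z) \<in> G_basic L p q (x, n, z)"
  using assms G_basic_refl unfolding openin_GL_iff by fast

lemma continuous_map_gsource: "continuous_map (gtop (GL L)) (Xtop L) (snd \<circ> snd)"
  unfolding continuous_map
proof (intro conjI allI impI)
  show "(snd \<circ> snd) ` topspace (gtop (GL L)) \<subseteq> topspace (Xtop L)"
    by (auto simp: gcarrier_GL topspace_Xtop GL_set_def)
  fix U assume U: "openin (Xtop L) U"
  show "openin (gtop (GL L)) {g \<in> topspace (gtop (GL L)). (snd \<circ> snd) g \<in> U}"
    unfolding openin_GL_iff gcarrier_GL
  proof (intro conjI; clarsimp)
    fix x n z assume g: "(x, n, z) \<in> GL_set L" "z \<in> U"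
    obtain p q where pq: "p < q" "cyl L p q z \<subseteq> U"
      using U g by (meson openin_Xtop_iff)
    obtain p1 q1 where 1: "p1 < q1" "(shift_pow n x, z) \<in> Rpq L p1 q1"
      using g by (auto simp: GL_iff RL_iff)
    define P Q where "P = min p1 p" and "Q = max q1 q"
    have PQ: "P \<le> p1" "P \<le> p" "q1 \<le> Q" "q \<le> Q" "P < Q"
      using 1 by (auto simp: P_def Q_def)
    have "G_basic L P Q (x, n, z) \<subseteq> {g \<in> GL_set L. snd (snd g) \<in> U}"
      using G_basic_GL[OF PQ(5)] subset_trans[OF cyl_mono[OF GL_D(2)[OF g(1)] PQ(2) pq(1) PQ(4)] pq(2)]
      by (auto simp: G_basic_iff)
    then show "\<exists>p q. p < q \<and> (shift_pow n x, z) \<in> Rpq L p q \<and> G_basic L p q (x, n, z) \<subseteq> {g \<in> GL_set L. snd (snd g) \<in> U}"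
      using PQ(5) Rpq_mono[OF PQ(1,3)] 1 by blast
  qed
qed

lemma G_basic_inverse:
  "(z', - n, x') \<in> G_basic L (p + n) (q + n) (z, - n, x) \<longleftrightarrow> (x', n, z') \<in> G_basic L p q (x, n, z)"
proof -
  have "(shift_pow (- n) z', x') \<in> Rpq L (p + n) (q + n) \<longleftrightarrow> (shift_pow n x', z') \<in> Rpq L p q"
    using shift_pow_Rpq[of n x' "shift_pow (- n) z'" p q] Rpq_sym by (auto simp: shift_pow_inverse)
  then show ?thesis
    by (auto simp: G_basic_iff)
qed

lemma openin_inv_set:
  assumes A: "openin (gtop (GL L)) A"
  shows "openin (gtop (GL L)) (inv_set A)"
  unfolding openin_GL_iff
proof (intro conjI; clarsimp)
  show "(z, n, x) \<in> GL_set L" if "(x, - n, z) \<in> A" for x n z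
    using that A GL_inv by (fastforce simp: openin_GL_iff)
  fix z n x assume "(x, - n, z) \<in> A"
  then obtain p q where pq: "p < q" "(shift_pow (- n) x, z) \<in> Rpq L p q" "G_basic L p q (x, - n, z) \<subseteq> A"
    using openin_GL_E[OF A] by metis
  have "(shift_pow n z, x) \<in> Rpq L (p - n) (q - n)"
    using pq(2) shift_pow_Rpq[of "- n" x "shift_pow n z" p q] Rpq_sym by (auto simp: shift_pow_inverse)
  moreover have "G_basic L (p - n) (q - n) (z, n, x) \<subseteq> inv_set A"
  proof clarsimp
    fix a m b assume g: "(a, m, b) \<in> G_basic L (p - n) (q - n) (z, n, x)"
    then have "m = n"
      by (simp add: G_basic_iff)
    then show "(b, - m, a) \<in> A"
      using g pq(3) G_basic_inverse[of a "- n" b p q z x] by auto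
  qed
  ultimately show "\<exists>p q. p < q \<and> (shift_pow n z, x) \<in> Rpq L p q \<and> G_basic L p q (z, n, x) \<subseteq> inv_set A"
    using pq(1) by (intro exI[of _ "p - n"] exI[of _ "q - n"]) auto
qed

lemma continuous_map_grange: "continuous_map (gtop (GL L)) (Xtop L) fst"
  unfolding continuous_map
proof (intro conjI allI impI)
  show "fst ` topspace (gtop (GL L)) \<subseteq> topspace (Xtop L)"
    by (auto simp: gcarrier_GL topspace_Xtop GL_set_def)
  fix U assume U: "openin (Xtop L) U"
  have "{g \<in> topspace (gtop (GL L)). fst g \<in> U} = inv_set {g \<in> topspace (gtop (GL L)). (snd \<circ> snd) g \<in> U}"
    using GL_inv by (force simp: gcarrier_GL)
  then show "openin (gtop (GL L)) {g \<in> topspace (gtop (GL L)). fst g \<in> U}"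
    using openin_inv_set[OF openin_continuous_map_preimage[OF continuous_map_gsource U]] by simp
qed

lemma continuous_map_dL: "continuous_map (gtop (GL L)) (discrete_topology UNIV) dL"
  unfolding continuous_map
proof (intro conjI allI impI)
  fix U :: "int set"
  show "openin (gtop (GL L)) {g \<in> topspace (gtop (GL L)). dL g \<in> U}"
    unfolding openin_GL_iff gcarrier_GL
  proof (intro conjI; clarsimp)
    fix x n z assume g: "(x, n, z) \<in> GL_set L" "dL (x, n, z) \<in> U"
    obtain p q where pq: "p < q" "(shift_pow n x, z) \<in> Rpq L p q"
      using g by (auto simp: GL_iff RL_iff)
    have "G_basic L p q (x, n, z) \<subseteq> {g \<in> GL_set L. dL g \<in> U}"
      using G_basic_GL[OF pq(1)] g(2) by (auto simp: G_basic_iff dL_def)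
    then show "\<exists>p q. p < q \<and> (shift_pow n x, z) \<in> Rpq L p q \<and> G_basic L p q (x, n, z) \<subseteq> {g \<in> GL_set L. dL g \<in> U}"
      using pq by blast
  qed
qed simp

text \<open>
  Range, degree and source are continuous, and together they determine an arrow.
\<close>

lemma Hausdorff_GL: "Hausdorff_space (gtop (GL L))"
proof (rule Hausdorff_space_injective_preimage)
  show "Hausdorff_space (prod_topology (Xtop L) (prod_topology (discrete_topology (UNIV :: int set)) (Xtop L)))"
    by (simp add: Hausdorff_space_prod_topology Hausdorff_Xtop)
  show "continuous_map (gtop (GL L)) (prod_topology (Xtop L) (prod_topology (discrete_topology (UNIV :: int set)) (Xtop L)))
      (\<lambda>g. (fst g, dL g, (snd \<circ> snd) g))"
    by (intro continuous_map_pairedI continuous_map_grange continuous_map_dL continuous_map_gsource)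
qed (auto simp: inj_on_def dL_def)

lemma continuous_map_unit: "continuous_map (Xtop L) (gtop (GL L)) (\<lambda>x. (x, 0, x))"
  unfolding continuous_map
proof (intro conjI allI impI)
  show "(\<lambda>x. (x, 0, x)) ` topspace (Xtop L) \<subseteq> topspace (gtop (GL L))"
    by (auto simp: gcarrier_GL topspace_Xtop intro: GL_unit(2))
  fix U assume U: "openin (gtop (GL L)) U"
  show "openin (Xtop L) {x \<in> topspace (Xtop L). (x, 0, x) \<in> U}"
    unfolding openin_Xtop_iff topspace_Xtop
  proof (intro conjI; clarsimp)
    fix x assume x: "x \<in> XL L" "(x, 0, x) \<in> U"
    obtain p q where pq: "p < q" "G_basic L p q (x, 0, x) \<subseteq> U"
      using openin_GL_E[OF U x(2)] .
    have "(y, 0, y) \<in> G_basic L p q (x, 0, x)" if "y \<in> cyl L p q x" for y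
      using that cyl_subset by (auto simp: G_basic_iff shift_pow_0 Rpq_iff)
    then have "cyl L p q x \<subseteq> {x \<in> XL L. (x, 0, x) \<in> U}"
      using pq(2) cyl_subset by blast
    then show "\<exists>p q. p < q \<and> cyl L p q x \<subseteq> {x \<in> XL L. (x, 0, x) \<in> U}"
      using pq(1) by blast
  qed
qed

text \<open>
  Two arrows of a basic set with the same range or source have ends which agree on a square and on the
  triangle below it.
\<close>

lemma G_basic_inj:
  assumes "p < q" "(x1, m, z1) \<in> G_basic L p q g" "(x2, m, z2) \<in> G_basic L p q g"
  shows "x1 = x2 \<longleftrightarrow> z1 = z2"
proof -
  obtain x n z where g: "g = (x, n, z)"
    by (cases g)
  have 1: "(shift_pow n x1, z1) \<in> Rpq L p q" "(shift_pow n x2, z2) \<in> Rpq L p q"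
    "shift_pow n x1 \<in> cyl L p q (shift_pow n x)" "shift_pow n x2 \<in> cyl L p q (shift_pow n x)"
    "z1 \<in> cyl L p q z" "z2 \<in> cyl L p q z"
    using assms(2,3) by (auto simp: g G_basic_iff shift_pow_cyl)
  show ?thesis
  proof
    assume "x1 = x2"
    then have "(z1, z2) \<in> Rpq L p q"
      using 1 by (auto simp: Rpq_iff)
    then show "z1 = z2"
      by (rule Rpq_eqI) (use assms 1 in \<open>auto simp: cyl_def\<close>)
  next
    assume "z1 = z2"
    then have "(shift_pow n x1, shift_pow n x2) \<in> Rpq L p q"
      using 1 by (auto simp: Rpq_iff)
    then have "shift_pow n x1 = shift_pow n x2"
      by (rule Rpq_eqI) (use assms 1 in \<open>auto simp: cyl_def\<close>)
    then show "x1 = x2"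
      using shift_pow_inverse by metis
  qed
qed

end

context fpcc_bisystem
begin

lemma G_basic_source:
  assumes "p < q" "(shift_pow n x, z) \<in> Rpq L p q"
  shows "(snd \<circ> snd) ` G_basic L p q (x, n, z) = cyl L p q z"
proof (intro equalityI subsetI)
  fix z' assume z': "z' \<in> cyl L p q z"
  then obtain w where w: "(w, z') \<in> Rpq L p q" "w \<in> cyl L p q (shift_pow n x)"
    using cyl_Rpq_lift[OF assms(2,1)] by blast
  have "w = shift_pow n (shift_pow (- n) w)"
    by (simp add: shift_pow_inverse)
  then have "(shift_pow (- n) w, n, z') \<in> G_basic L p q (x, n, z)"
    using w by (auto simp: G_basic_def R_basic_def shift_pow_inverse Rpq_iff z')
  then show "z' \<in> (snd \<circ> snd) ` G_basic L p q (x, n, z)"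
    by force
qed (auto simp: G_basic_iff)

text \<open>
  The source of a basic set is a full cylinder, by refilling; so the source map is open.
\<close>

lemma openin_source_image:
  assumes "openin (gtop (GL L)) W"
  shows "openin (Xtop L) ((snd \<circ> snd) ` W)"
  unfolding openin_Xtop_iff
proof (intro conjI ballI)
  show "(snd \<circ> snd) ` W \<subseteq> XL L"
    using openin_subset[OF assms] GL_D by (fastforce simp: gcarrier_GL)
  fix z assume "z \<in> (snd \<circ> snd) ` W"
  then obtain x n where "(x, n, z) \<in> W"
    by force
  then obtain p q where "p < q" "(shift_pow n x, z) \<in> Rpq L p q" "G_basic L p q (x, n, z) \<subseteq> W"
    using openin_GL_E[OF assms] by metis
  then show "\<exists>p q. p < q \<and> cyl L p q z \<subseteq> (snd \<circ> snd) ` W"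
    using G_basic_source by blast
qed

text \<open>
  The source map is a bijection of the basic set onto a cylinder, and its inverse is continuous since the source
  map is open.
\<close>

lemma compactin_G_basic:
  assumes "p < q" "(shift_pow n x, z) \<in> Rpq L p q"
  shows "compactin (gtop (GL L)) (G_basic L p q (x, n, z))"
proof -
  let ?S = "G_basic L p q (x, n, z)"
  define s where "s = the_inv_into ?S (snd \<circ> snd)"
  have inj: "inj_on (snd \<circ> snd) ?S"
    using G_basic_inj[OF assms(1)] by (auto simp: inj_on_def G_basic_iff)
  have s: "s z' \<in> ?S" "(snd \<circ> snd) (s z') = z'" if "z' \<in> cyl L p q z" for z'
    using that the_inv_into_into[OF inj _ subset_refl, of z'] f_the_inv_into_f[OF inj, of z']
    unfolding G_basic_source[OF assms] s_def by auto
  have s_img: "s ` cyl L p q z = ?S"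
    using the_inv_into_onto[OF inj] unfolding s_def G_basic_source[OF assms] .
  have "continuous_map (subtopology (Xtop L) (cyl L p q z)) (gtop (GL L)) s"
    unfolding continuous_map
  proof (intro conjI allI impI)
    show "s ` topspace (subtopology (Xtop L) (cyl L p q z)) \<subseteq> topspace (gtop (GL L))"
      using s(1) G_basic_GL[OF assms(1), of x n z] unfolding gcarrier_GL by fastforce
    fix W assume W: "openin (gtop (GL L)) W"
    have "{z' \<in> topspace (subtopology (Xtop L) (cyl L p q z)). s z' \<in> W} = (snd \<circ> snd) ` (W \<inter> ?S)"
    proof (intro equalityI subsetI)
      fix z' assume "z' \<in> {z' \<in> topspace (subtopology (Xtop L) (cyl L p q z)). s z' \<in> W}"
      then have "z' \<in> cyl L p q z" "s z' \<in> W"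
        by auto
      then show "z' \<in> (snd \<circ> snd) ` (W \<inter> ?S)"
        using s by (metis IntI image_eqI)
    next
      fix z' assume "z' \<in> (snd \<circ> snd) ` (W \<inter> ?S)"
      then obtain g where g: "g \<in> W" "g \<in> ?S" "z' = (snd \<circ> snd) g"
        by blast
      then have "z' \<in> cyl L p q z" "s z' = g"
        using G_basic_source[OF assms] the_inv_into_f_f[OF inj] by (auto simp: s_def)
      then show "z' \<in> {z' \<in> topspace (subtopology (Xtop L) (cyl L p q z)). s z' \<in> W}"
        using g cyl_subset by (auto simp: topspace_Xtop)
    qed
    moreover have "openin (Xtop L) ((snd \<circ> snd) ` (W \<inter> ?S))"
      using openin_source_image W openin_G_basic[OF assms(1)] by (intro openin_source_image openin_Int)
    moreover have "(snd \<circ> snd) ` (W \<inter> ?S) \<subseteq> cyl L p q z"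
      using G_basic_source[OF assms] by blast
    ultimately show "openin (subtopology (Xtop L) (cyl L p q z)) {z' \<in> topspace (subtopology (Xtop L) (cyl L p q z)). s z' \<in> W}"
      using openin_open_subtopology[OF openin_cyl[OF assms(1), of z]] by simp
  qed
  moreover have "compactin (subtopology (Xtop L) (cyl L p q z)) (cyl L p q z)"
    using compactin_cyl[OF assms(1)] by (simp add: compactin_subtopology)
  ultimately have "compactin (gtop (GL L)) (s ` cyl L p q z)"
    using image_compactin by blast
  then show ?thesis
    by (simp only: s_img)
qed

end

section \<open>Products of open sets and slices\<close>

definition mult_set :: "('v, 'e) garrow set \<Rightarrow> ('v, 'e) garrow set \<Rightarrow> ('v, 'e) garrow set" where
  "mult_set A B = {(x, n + m, z) | x n y m z. (x, n, y) \<in> A \<and> (y, m, z) \<in> B}"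

definition units :: "('v, 'e) config set \<Rightarrow> ('v, 'e) garrow set" where
  "units U = {(x, 0, x) | x. x \<in> U}"

text \<open>
  The compact open bisections of the groupoid.
\<close>

definition slice :: "('v, 'e, 'a) bisystem \<Rightarrow> ('v, 'e) garrow set \<Rightarrow> bool" where
  "slice L K \<longleftrightarrow> openin (gtop (GL L)) K \<and> compactin (gtop (GL L)) K \<and> inj_on fst K \<and> inj_on (snd \<circ> snd) K"

definition arrow_to :: "('v, 'e) garrow set \<Rightarrow> ('v, 'e) config \<Rightarrow> ('v, 'e) garrow" where
  "arrow_to K = the_inv_into K fst"

text \<open>
  On the arrows \<open>g\<close> whose range is the range of some \<open>k\<close> in \<open>K\<close>, division by \<open>K\<close> is the map
  $g \mapsto k^{-1} g$.
\<close>

definition slice_dom :: "('v, 'e, 'a) bisystem \<Rightarrow> ('v, 'e) garrow set \<Rightarrow> ('v, 'e) garrow set" where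
  "slice_dom L K = {g \<in> GL_set L. fst g \<in> fst ` K}"

definition slice_div :: "('v, 'e) garrow set \<Rightarrow> ('v, 'e) garrow \<Rightarrow> ('v, 'e) garrow" where
  "slice_div K = (\<lambda>(x, m, y). (snd (snd (arrow_to K x)), m - dL (arrow_to K x), y))"

text \<open>
  Convolution by a function \<open>f\<close> supported in the slice \<open>K\<close>, as a weighted pullback: only one term of the
  convolution sum is left, and \<open>slice_div K\<close> is injective because the source is injective on \<open>K\<close>.
\<close>

definition slice_op where
  "slice_op L f K = weighted_pullback (\<lambda>g. f (arrow_to K (fst g))) (slice_dom L K) (slice_div K)"

lemma units_iff [simp]: "(x, n, z) \<in> units U \<longleftrightarrow> n = 0 \<and> x = z \<and> x \<in> U"
  by (auto simp: units_def)

lemma sliceD: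
  assumes "slice L K"
  shows "openin (gtop (GL L)) K" "compactin (gtop (GL L)) K" "K \<subseteq> GL_set L"
    "(x, n, y) \<in> K \<Longrightarrow> (x, n', y') \<in> K \<Longrightarrow> n = n' \<and> y = y'"
    "(x, n, y) \<in> K \<Longrightarrow> (x', n', y) \<in> K \<Longrightarrow> n = n' \<and> x = x'"
  using assms openin_subset[of "gtop (GL L)" K]
  by (auto simp: slice_def gcarrier_GL dest: inj_onD[of fst K "(x, n, y)" "(x, n', y')"]
      inj_onD[of "snd \<circ> snd" K "(x, n, y)" "(x', n', y)"])

context lambda_graph_bisystem
begin

lemma Rpq_trans: "(a, b) \<in> Rpq L p q \<Longrightarrow> (b, c) \<in> Rpq L p q \<Longrightarrow> (a, c) \<in> Rpq L p q"
  by (simp add: Rpq_iff)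

text \<open>
  Along a pair in \<open>Rpq L p q\<close> closeness is transported from one end to the other: the far vertices and the labels
  outside the triangle are shared, and the labels inside are prescribed by the smaller cylinder.
\<close>

lemma cyl_transfer:
  assumes "(a, b) \<in> Rpq L p q" "(a', b') \<in> Rpq L p q" "a' \<in> cyl L P Q a" "b' \<in> cyl L p q b" "P \<le> p" "p < q" "q \<le> Q"
  shows "b' \<in> cyl L P Q b"
proof -
  have "vx b' P Q = vx a' P Q" "vx a P Q = vx b P Q"
    using assms by (simp_all add: Rpq_iff vx_def)
  moreover have "label_at L b' m = label_at L b m" if "P < m" "m < Q" for m
  proof (cases "p < m \<and> m < q")
    case False
    then have "label_at L a m = label_at L b m" "label_at L a' m = label_at L b' m"
      using Rpq_lab[OF assms(1), of m] Rpq_lab[OF assms(2), of m] assms(6) by auto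
    then show ?thesis
      using assms(3) that by (auto simp: cyl_def)
  qed (use assms in \<open>auto simp: cyl_def\<close>)
  ultimately show ?thesis
    using assms(3,4) by (auto simp: cyl_def)
qed

lemma mult_set_iff: "(x, k, z) \<in> mult_set A B \<longleftrightarrow> (\<exists>n y. (x, n, y) \<in> A \<and> (y, k - n, z) \<in> B)"
  by (force simp: mult_set_def)

end

context fpcc_bisystem
begin

lemma G_basic_range:
  assumes "p < q" "(shift_pow n x, z) \<in> Rpq L p q" "x' \<in> cyl L (p + n) (q + n) x"
  obtains z' where "(x', n, z') \<in> G_basic L p q (x, n, z)"
proof -
  have "(shift_pow (- n) z, x) \<in> Rpq L (p + n) (q + n)"
    using assms(2) shift_pow_Rpq[of n x "shift_pow (- n) z" p q] Rpq_sym by (auto simp: shift_pow_inverse)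
  then have "x' \<in> (snd \<circ> snd) ` G_basic L (p + n) (q + n) (z, - n, x)"
    using assms G_basic_source[of "p + n" "q + n" "- n" z x] by simp
  then obtain z' m where "(z', m, x') \<in> G_basic L (p + n) (q + n) (z, - n, x)"
    by force
  then show ?thesis
    using that G_basic_inverse[of z' n x' p q z x] by (auto simp: G_basic_iff)
qed

text \<open>
  Multiplication is an open map.  A small perturbation of a product \<open>(x, k, z)\<close> moves \<open>x\<close> and \<open>z\<close>; the first factor
  is perturbed along its basic set, which determines the new middle point, and \<open>cyl_transfer\<close> shows that the
  second factor has moved only a little.
\<close>

lemma openin_mult_set:
  assumes A: "openin (gtop (GL L)) A" and B: "openin (gtop (GL L)) B"
  shows "openin (gtop (GL L)) (mult_set A B)"
  unfolding openin_GL_iff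
proof (intro conjI ballI subsetI; clarsimp simp: mult_set_iff)
  fix x k z n y assume xy: "(x, n, y) \<in> A" and yz: "(y, k - n, z) \<in> B"
  then have "(x, n, y) \<in> GL_set L" "(y, k - n, z) \<in> GL_set L"
    using A B by (auto simp: openin_GL_iff)
  from GL_mult[OF this] show "(x, k, z) \<in> GL_set L"
    by simp
next
  fix x k z n y assume xy: "(x, n, y) \<in> A" and yz: "(y, k - n, z) \<in> B"
  define m where "m = k - n"
  obtain p1 q1 where 1: "p1 < q1" "(shift_pow n x, y) \<in> Rpq L p1 q1" "G_basic L p1 q1 (x, n, y) \<subseteq> A"
    using openin_GL_E[OF A xy] by metis
  obtain p2 q2 where 2: "p2 < q2" "(shift_pow m y, z) \<in> Rpq L p2 q2" "G_basic L p2 q2 (y, m, z) \<subseteq> B"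
    using openin_GL_E[OF B yz] unfolding m_def by metis
  define P Q where "P = min p2 (p1 - m)" and "Q = max q2 (q1 - m)"
  have PQ: "P \<le> p2" "P \<le> p1 - m" "q2 \<le> Q" "q1 - m \<le> Q" "P < Q" "P + m \<le> p1" "q1 \<le> Q + m"
    using 1 2 by (auto simp: P_def Q_def)
  have k: "shift_pow k u = shift_pow m (shift_pow n u)" for u :: "('v, 'e) config"
    by (simp add: m_def flip: shift_pow_add)
  have sh: "(shift_pow k x', shift_pow m y') \<in> Rpq L P Q" if "(shift_pow n x', y') \<in> Rpq L p1 q1" for x' y'
    using that Rpq_mono[OF PQ(6,7)] by (auto simp: k shift_pow_Rpq)
  have "(shift_pow k x, z) \<in> Rpq L P Q"
    using sh[OF 1(2)] Rpq_mono[OF PQ(1,3)] 2(2) Rpq_trans by blast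
  moreover have "\<exists>n y. (x', n, y) \<in> A \<and> (y, j - n, z') \<in> B" if g: "(x', j, z') \<in> G_basic L P Q (x, k, z)" for x' j z'
  proof -
    have j: "j = k" "(shift_pow k x', z') \<in> Rpq L P Q" "x' \<in> cyl L (P + k) (Q + k) x" "z' \<in> cyl L P Q z"
      using g by (auto simp: G_basic_iff)
    have xX: "x \<in> XL L" "y \<in> XL L" "z \<in> XL L"
      using 1(2) 2(2) by (auto simp: Rpq_iff)
    have "x' \<in> cyl L (p1 + n) (q1 + n) x"
      using j(3) cyl_mono[OF xX(1), of "P + k" "p1 + n" "q1 + n" "Q + k"] PQ 1(1) by (auto simp: m_def)
    then obtain y' where y': "(x', n, y') \<in> G_basic L p1 q1 (x, n, y)"
      using G_basic_range[OF 1(1,2)] by blast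
    then have y'': "(shift_pow n x', y') \<in> Rpq L p1 q1" "y' \<in> cyl L p1 q1 y"
      by (auto simp: G_basic_iff)
    have "shift_pow n x' \<in> cyl L (P + m) (Q + m) (shift_pow n x)"
      using j(3) by (simp add: shift_pow_cyl m_def)
    then have "y' \<in> cyl L (P + m) (Q + m) y"
      using cyl_transfer[OF 1(2) y''(1) _ y''(2) PQ(6) 1(1) PQ(7)] by blast
    moreover have "y' \<in> cyl L (p2 + m) (q2 + m) y"
      using calculation cyl_mono[OF xX(2), of "P + m" "p2 + m" "q2 + m" "Q + m"] PQ 2(1) by auto
    moreover have "z' \<in> cyl L p2 q2 z"
      using j(4) cyl_mono[OF xX(3) PQ(1) 2(1) PQ(3)] by blast
    moreover have "(shift_pow m y', z') \<in> Rpq L P Q"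
      using sh[OF y''(1)] j(2) by (auto simp: Rpq_iff)
    ultimately have "(shift_pow m y', z') \<in> Rpq L p2 q2"
      using Rpq_cyl[OF _ _ j(4) 2(2) PQ(1) 2(1) PQ(3)] by (auto simp: shift_pow_cyl)
    then have "(y', m, z') \<in> G_basic L p2 q2 (y, m, z)"
      using \<open>y' \<in> cyl L (p2 + m) (q2 + m) y\<close> \<open>z' \<in> cyl L p2 q2 z\<close> by (auto simp: G_basic_iff Rpq_iff cyl_def)
    then show ?thesis
      using 1(3) 2(3) y' j(1) unfolding m_def by blast
  qed
  then have "G_basic L P Q (x, k, z) \<subseteq> mult_set A B"
    by (auto simp: mult_set_iff)
  ultimately show "\<exists>p q. p < q \<and> (shift_pow k x, z) \<in> Rpq L p q \<and> G_basic L p q (x, k, z) \<subseteq> mult_set A B"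
    using PQ(5) by blast
qed

end

section \<open>Convolution by functions on slices\<close>

lemma continuous_map_complex_mult:
  fixes f g :: "'g \<Rightarrow> complex"
  assumes "continuous_map X euclidean f" "continuous_map X euclidean g"
  shows "continuous_map X euclidean (\<lambda>x. f x * g x)"
proof -
  have "continuous_map (prod_topology euclidean euclidean) euclidean (\<lambda>z :: complex \<times> complex. fst z * snd z)"
    by (simp add: euclidean_product_topology continuous_on_mult continuous_on_fst continuous_on_snd continuous_on_id)
  from continuous_map_compose[OF continuous_map_pairedI[OF assms] this] show ?thesis
    by (simp add: comp_def)
qed

lemma continuous_map_on_clopen:
  assumes N: "openin X N" "closedin X N" and f: "continuous_map (subtopology X N) euclidean f"
  shows "continuous_map X euclidean (\<lambda>x. if x \<in> N then f x else (0 :: complex))"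
proof -
  have "X closure_of {x. x \<in> N} = N"
    using N(2) by (simp add: closure_of_closedin)
  moreover have "X frontier_of {x. x \<in> N} = {}"
    using N by (simp add: frontier_of_eq_empty openin_subset)
  ultimately show ?thesis
    using f by (intro continuous_map_cases) auto
qed

lemma continuous_map_restrict_clopen:
  assumes "openin X N" "closedin X N" "continuous_map X euclidean f"
  shows "continuous_map X euclidean (\<lambda>x. if x \<in> N then f x else (0 :: complex))"
  using assms by (intro continuous_map_on_clopen continuous_map_from_subtopology)

lemma GL_simps [simp]:
  "grange (GL L) (x, n, z) = (x, 0, x)" "gsource (GL L) (x, n, z) = (z, 0, z)"
  "ginv (GL L) (x, n, z) = (z, - n, x)" "gmult (GL L) (x, n, z) (z', m, w) = (x, n + m, w)"
  by (simp_all add: GL_def)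

context lambda_graph_bisystem
begin

lemma Cc_iff:
  "f \<in> Cc (GL L) \<longleftrightarrow> continuous_map (gtop (GL L)) euclidean f \<and> (\<forall>g. g \<notin> GL_set L \<longrightarrow> f g = 0) \<and>
     (\<exists>C. compactin (gtop (GL L)) C \<and> (\<forall>g. g \<notin> C \<longrightarrow> f g = 0))"
  (is "?L \<longleftrightarrow> ?R")
proof
  assume L: ?L
  let ?C = "gtop (GL L) closure_of {g \<in> gcarrier (GL L). f g \<noteq> 0}"
  have "f g = 0" if "g \<notin> ?C" for g
  proof (rule ccontr)
    assume "f g \<noteq> 0"
    then have "g \<in> {g \<in> gcarrier (GL L). f g \<noteq> 0}"
      using L unfolding Cc_def by blast
    then show False
      using that closure_of_subset[of "{g \<in> gcarrier (GL L). f g \<noteq> 0}" "gtop (GL L)"] by blast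
  qed
  then show ?R
    using L unfolding Cc_def gcarrier_GL by blast
next
  assume R: ?R
  then obtain C where C: "compactin (gtop (GL L)) C" "\<And>g. g \<notin> C \<Longrightarrow> f g = 0"
    by blast
  have cl: "closedin (gtop (GL L)) C"
    using compactin_imp_closedin[OF Hausdorff_GL C(1)] .
  have "gtop (GL L) closure_of {g \<in> gcarrier (GL L). f g \<noteq> 0} \<subseteq> C"
    using C(2) by (intro closure_of_minimal cl) auto
  then have "compactin (gtop (GL L)) (gtop (GL L) closure_of {g \<in> gcarrier (GL L). f g \<noteq> 0})"
    using closed_compactin[OF C(1)] by simp
  then show ?L
    using R by (simp add: Cc_def gcarrier_GL)
qed

lemma Cc_bounded:
  assumes "f \<in> Cc (GL L)"
  obtains B where "\<And>g. cmod (f g) \<le> B"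
proof -
  obtain C where C: "compactin (gtop (GL L)) C" "\<And>g. g \<notin> C \<Longrightarrow> f g = 0"
    and f: "continuous_map (gtop (GL L)) euclidean f"
    using assms unfolding Cc_iff by blast
  have "compact (f ` C)"
    using image_compactin[OF C(1) f] by simp
  then obtain B where "\<And>z. z \<in> f ` C \<Longrightarrow> cmod z \<le> B"
    using compact_imp_bounded bounded_iff by metis
  then have "cmod (f g) \<le> max B 0" for g
    using C(2)[of g] by (cases "g \<in> C") (auto simp: le_max_iff_disj)
  then show ?thesis
    using that by blast
qed

lemma Cc_D:
  assumes "f \<in> Cc (GL L)"
  shows "continuous_map (gtop (GL L)) euclidean f" "g \<notin> GL_set L \<Longrightarrow> f g = 0"
    "\<exists>C. compactin (gtop (GL L)) C \<and> (\<forall>g. g \<notin> C \<longrightarrow> f g = 0)"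
  using assms unfolding Cc_iff by blast+

lemma Cc_I:
  assumes "continuous_map (gtop (GL L)) euclidean f" "\<And>g. g \<notin> GL_set L \<Longrightarrow> f g = 0"
    "compactin (gtop (GL L)) C" "\<And>g. g \<notin> C \<Longrightarrow> f g = 0"
  shows "f \<in> Cc (GL L)"
  using assms unfolding Cc_iff by blast

lemma Cc_add:
  assumes f: "f \<in> Cc (GL L)" and g: "g \<in> Cc (GL L)"
  shows "(\<lambda>x. f x + g x) \<in> Cc (GL L)"
proof -
  obtain C D where C: "compactin (gtop (GL L)) C" "\<And>x. x \<notin> C \<Longrightarrow> f x = 0"
    and D: "compactin (gtop (GL L)) D" "\<And>x. x \<notin> D \<Longrightarrow> g x = 0"
    using Cc_D(3)[OF f] Cc_D(3)[OF g] by blast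
  show ?thesis
  proof (rule Cc_I)
    show "compactin (gtop (GL L)) (C \<union> D)"
      using C D by (intro compactin_Un)
    show "continuous_map (gtop (GL L)) euclidean (\<lambda>x. f x + g x)"
      by (intro continuous_map_add Cc_D(1) f g)
  qed (simp_all add: C D Cc_D(2)[OF f] Cc_D(2)[OF g])
qed

lemma Cc_restrict:
  assumes f: "f \<in> Cc (GL L)" and N: "openin (gtop (GL L)) N" "closedin (gtop (GL L)) N"
  shows "(\<lambda>x. if x \<in> N then f x else 0) \<in> Cc (GL L)"
proof -
  obtain C where C: "compactin (gtop (GL L)) C" "\<And>x. x \<notin> C \<Longrightarrow> f x = 0"
    using Cc_D(3)[OF f] by blast
  show ?thesis
    by (rule Cc_I[OF continuous_map_restrict_clopen[OF N Cc_D(1)[OF f]] _ C(1)])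
      (simp_all add: C(2) Cc_D(2)[OF f])
qed

lemma slice_clopen:
  assumes "slice L K"
  shows "openin (gtop (GL L)) K" "closedin (gtop (GL L)) K"
  using assms compactin_imp_closedin[OF Hausdorff_GL] by (auto simp: slice_def)

text \<open>
  In a factorization of \<open>(x, m, y)\<close> the second factor is determined by the first, which is any arrow with
  range \<open>x\<close>.
\<close>

lemma convolution_GL:
  "convolution (GL L) f h (x, m, y) =
    (if (x, m, y) \<in> GL_set L
     then \<Sum>\<^sub>\<infinity>a\<in>{a \<in> GL_set L. fst a = x}. f a * h (snd (snd a), m - dL a, y) else 0)"
proof -
  let ?I = "{(a, b). a \<in> gcarrier (GL L) \<and> b \<in> gcarrier (GL L) \<and>
    gsource (GL L) a = grange (GL L) b \<and> gmult (GL L) a b = (x, m, y)}"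
  show ?thesis
  proof (cases "(x, m, y) \<in> GL_set L")
    case True
    let ?A = "{a \<in> GL_set L. fst a = x}"
    have "bij_betw (\<lambda>a. (a, (snd (snd a), m - dL a, y))) ?A ?I"
    proof (rule bij_betw_byWitness[where f' = fst])
      show "(\<lambda>a. (a, (snd (snd a), m - dL a, y))) ` ?A \<subseteq> ?I"
      proof (rule image_subsetI)
        fix a assume "a \<in> ?A"
        then obtain n w where a: "a = (x, n, w)" "(x, n, w) \<in> GL_set L"
          by (cases a) auto
        then have "(w, - n + m, y) \<in> GL_set L"
          using GL_mult[OF GL_inv[OF a(2)], of m y] True by simp
        then show "(a, (snd (snd a), m - dL a, y)) \<in> ?I"
          using a by (simp add: gcarrier_GL dL_def)
      qed
    qed (auto simp: dL_def gcarrier_GL)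
    from infsum_reindex_bij_betw[OF this, of "\<lambda>(a, b). f a * h b"] show ?thesis
      using True by (simp add: convolution_def)
  next
    case False
    have I: "?I = {}"
      using False GL_mult by (auto simp: gcarrier_GL)
    show ?thesis
      by (simp only: convolution_def I infsum_empty False if_False)
  qed
qed

lemma arrow_to: "slice L K \<Longrightarrow> (x, n, w) \<in> K \<Longrightarrow> arrow_to K x = (x, n, w)"
  unfolding arrow_to_def slice_def using the_inv_into_f_f[of fst K "(x, n, w)"] by simp

lemma slice_div: "slice L K \<Longrightarrow> (x, n, w) \<in> K \<Longrightarrow> slice_div K (x, m, y) = (w, m - n, y)"
  by (simp add: slice_div_def arrow_to dL_def)

lemma slice_dom_iff: "(x, m, y) \<in> slice_dom L K \<longleftrightarrow> (x, m, y) \<in> GL_set L \<and> (\<exists>n w. (x, n, w) \<in> K)"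
  by (force simp: slice_dom_def)

lemma slice_div_GL:
  assumes "slice L K" "(x, n, w) \<in> K" "(x, m, y) \<in> GL_set L"
  shows "(w, m - n, y) \<in> GL_set L"
  using GL_mult[OF GL_inv, of x n w m y] assms sliceD(3) by auto

lemma inj_on_slice_div:
  assumes K: "slice L K"
  shows "inj_on (slice_div K) (slice_dom L K)"
proof (rule inj_onI)
  fix g h assume g: "g \<in> slice_dom L K" and h: "h \<in> slice_dom L K" and eq: "slice_div K g = slice_div K h"
  obtain x m y x' m' y' where gh: "g = (x, m, y)" "h = (x', m', y')"
    by (metis prod_cases3)
  obtain n w n' w' where "(x, n, w) \<in> K" "(x', n', w') \<in> K"
    using g h by (auto simp: gh slice_dom_iff)
  then show "g = h"
    using eq slice_div[OF K] sliceD(5)[OF K] by (force simp: gh)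
qed

lemma slice_op_apply:
  assumes K: "slice L K" and B: "\<And>g. cmod (f g) \<le> B"
  shows "(x, n, w) \<in> K \<Longrightarrow> (x, m, y) \<in> GL_set L \<Longrightarrow>
      ell2_fun (slice_op L f K \<xi>) (x, m, y) = f (x, n, w) * ell2_fun \<xi> (w, m - n, y)"
    and "(x, m, y) \<notin> slice_dom L K \<Longrightarrow> ell2_fun (slice_op L f K \<xi>) (x, m, y) = 0"
proof -
  have eq: "ell2_fun (slice_op L f K \<xi>) g =
      (if g \<in> slice_dom L K then f (arrow_to K (fst g)) * ell2_fun \<xi> (slice_div K g) else 0)" for g
    unfolding slice_op_def by (rule weighted_pullback_apply[OF inj_on_slice_div[OF K], of _ B]) (rule B)
  show "(x, n, w) \<in> K \<Longrightarrow> (x, m, y) \<in> GL_set L \<Longrightarrow>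
      ell2_fun (slice_op L f K \<xi>) (x, m, y) = f (x, n, w) * ell2_fun \<xi> (w, m - n, y)"
    unfolding eq using arrow_to[OF K] slice_div[OF K] by (auto simp: slice_dom_iff)
  show "(x, m, y) \<notin> slice_dom L K \<Longrightarrow> ell2_fun (slice_op L f K \<xi>) (x, m, y) = 0"
    unfolding eq by simp
qed

lemma regular_rep_slice_op:
  assumes K: "slice L K" and B: "\<And>g. cmod (f g) \<le> B" and 0: "\<And>g. g \<notin> K \<Longrightarrow> f g = 0"
  shows "regular_rep (GL L) f (slice_op L f K)"
  unfolding regular_rep_def
proof (intro allI ext)
  fix \<xi> and g :: "('v, 'e) garrow"
  obtain x m y where g: "g = (x, m, y)"
    using prod_cases3 by blast
  let ?F = "\<lambda>a. f a * ell2_fun \<xi> (snd (snd a), m - dL a, y)"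
  show "ell2_fun (slice_op L f K \<xi>) g = convolution (GL L) f (ell2_fun \<xi>) g"
  proof (cases "(x, m, y) \<in> slice_dom L K")
    case True
    then obtain n w where w: "(x, n, w) \<in> K" and G: "(x, m, y) \<in> GL_set L"
      by (auto simp: slice_dom_iff)
    have "f a = 0" if "fst a = x" "a \<noteq> (x, n, w)" for a
      using that 0[of a] sliceD(4)[OF K w] by (cases a) auto
    then have "infsum ?F {a \<in> GL_set L. fst a = x} = infsum ?F {(x, n, w)}"
      using w sliceD(3)[OF K] by (intro infsum_cong_neutral) auto
    then show ?thesis
      using G slice_op_apply(1)[OF K B w G] by (simp add: g convolution_GL dL_def)
  next
    case False
    have "infsum ?F {a \<in> GL_set L. fst a = x} = 0" if "(x, m, y) \<in> GL_set L"
      using False that 0 by (intro infsum_0) (force simp: slice_dom_iff)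
    then show ?thesis
      using False slice_op_apply(2)[OF K B False] by (simp add: g convolution_GL)
  qed
qed

end

context fpcc_bisystem
begin

lemma compactin_inv_set:
  assumes "compactin (gtop (GL L)) C"
  shows "compactin (gtop (GL L)) (inv_set C)"
proof -
  have "continuous_map (gtop (GL L)) (gtop (GL L)) (\<lambda>(x, n, z). (z, - n, x))"
    unfolding continuous_map
  proof (intro conjI allI impI)
    show "(\<lambda>(x, n, z). (z, - n, x)) ` topspace (gtop (GL L)) \<subseteq> topspace (gtop (GL L))"
      using GL_inv by (auto simp: gcarrier_GL)
    fix U assume U: "openin (gtop (GL L)) U"
    have "{g \<in> topspace (gtop (GL L)). (case g of (x, n, z) \<Rightarrow> (z, - n, x)) \<in> U} = inv_set U"
      using openin_subset[OF openin_inv_set[OF U]] by auto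
    then show "openin (gtop (GL L)) {g \<in> topspace (gtop (GL L)). (case g of (x, n, z) \<Rightarrow> (z, - n, x)) \<in> U}"
      using openin_inv_set[OF U] by simp
  qed
  from image_compactin[OF assms this] have "compactin (gtop (GL L)) ((\<lambda>(x, n, z). (z, - n, x)) ` C)" .
  moreover have "(\<lambda>(x, n, z). (z, - n, x)) ` C = inv_set C"
    by (force simp: inv_set_def)
  ultimately show ?thesis
    by simp
qed

lemma slice_inv_set:
  assumes K: "slice L K"
  shows "slice L (inv_set K)"
  unfolding slice_def
proof (intro conjI)
  show "inj_on fst (inv_set K)" "inj_on (snd \<circ> snd) (inv_set K)"
    by (rule inj_onI, clarsimp simp: split_paired_all, use sliceD(4,5)[OF K] in \<open>metis add.inverse_inverse\<close>)+
qed (use K openin_inv_set compactin_inv_set in \<open>auto simp: slice_def\<close>)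

lemma slice_G_basic:
  assumes "p < q" "(shift_pow n x, z) \<in> Rpq L p q"
  shows "slice L (G_basic L p q (x, n, z))"
proof -
  have "g = h" if gh: "g \<in> G_basic L p q (x, n, z)" "h \<in> G_basic L p q (x, n, z)"
    and eq: "fst g = fst h \<or> (snd \<circ> snd) g = (snd \<circ> snd) h" for g h
  proof -
    obtain x1 z1 x2 z2 where "g = (x1, n, z1)" "h = (x2, n, z2)"
      using gh by (cases g, cases h) (auto simp: G_basic_iff)
    then show ?thesis
      using gh eq G_basic_inj[OF assms(1), of x1 n z1 "(x, n, z)" x2 z2] by auto
  qed
  then show ?thesis
    using openin_G_basic[OF assms(1)] compactin_G_basic[OF assms] by (simp add: slice_def inj_on_def)
qed

lemma openin_range_image:
  assumes "openin (gtop (GL L)) W"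
  shows "openin (Xtop L) (fst ` W)"
proof -
  have "fst ` W = (snd \<circ> snd) ` inv_set W"
    by (force simp: inv_set_def image_iff)
  then show ?thesis
    using openin_source_image[OF openin_inv_set[OF assms]] by simp
qed

lemma openin_units:
  assumes U: "openin (Xtop L) U"
  shows "openin (gtop (GL L)) (units U)"
  unfolding openin_GL_iff
proof (intro conjI; clarsimp)
  show "(x, 0, x) \<in> GL_set L" if "x \<in> U" for x
    using that openin_subset[OF U] by (auto simp: topspace_Xtop intro: GL_unit(2))
  fix x assume x: "x \<in> U"
  then obtain p q where pq: "p < q" "cyl L p q x \<subseteq> U" and xX: "x \<in> XL L"
    using U unfolding openin_Xtop_iff by blast
  have "G_basic L p q (x, 0, x) \<subseteq> units U"
  proof clarsimp
    fix a m b assume g: "(a, m, b) \<in> G_basic L p q (x, 0, x)"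
    then have ab: "(a, b) \<in> Rpq L p q" "a \<in> cyl L p q x" "b \<in> cyl L p q x" "m = 0"
      by (auto simp: G_basic_iff shift_pow_0)
    have "a = b"
      using ab(2,3) by (intro Rpq_eqI[OF ab(1) pq(1)]) (auto simp: cyl_def)
    then show "m = 0 \<and> a = b \<and> a \<in> U"
      using ab pq by blast
  qed
  moreover have "(shift_pow 0 x, x) \<in> Rpq L p q"
    using xX by (simp add: shift_pow_0 Rpq_iff)
  ultimately show "\<exists>p q. p < q \<and> (shift_pow 0 x, x) \<in> Rpq L p q \<and> G_basic L p q (x, 0, x) \<subseteq> units U"
    using pq by blast
qed

lemma slice_units:
  assumes "openin (Xtop L) U" "closedin (Xtop L) U"
  shows "slice L (units U)"
proof -
  have "compactin (Xtop L) U"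
    using closedin_compact_space[OF compact_Xtop assms(2)] .
  from image_compactin[OF this continuous_map_unit] have "compactin (gtop (GL L)) (units U)"
    by (simp add: units_def setcompr_eq_image)
  then show ?thesis
    using openin_units[OF assms(1)] by (auto simp: slice_def inj_on_def)
qed

lemma slice_dom_clopen:
  assumes K: "slice L K"
  shows "openin (gtop (GL L)) (slice_dom L K)" "closedin (gtop (GL L)) (slice_dom L K)"
proof -
  have eq: "slice_dom L K = {g \<in> topspace (gtop (GL L)). fst g \<in> fst ` K}"
    by (simp add: slice_dom_def gcarrier_GL)
  show "openin (gtop (GL L)) (slice_dom L K)"
    unfolding eq using openin_continuous_map_preimage[OF continuous_map_grange openin_range_image] sliceD(1)[OF K] by blast
  have "closedin (Xtop L) (fst ` K)"
    using image_compactin[OF sliceD(2)[OF K] continuous_map_grange] compactin_imp_closedin[OF Hausdorff_Xtop] by blast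
  then show "closedin (gtop (GL L)) (slice_dom L K)"
    unfolding eq using closedin_continuous_map_preimage[OF continuous_map_grange] by blast
qed

text \<open>
  The preimage of an open set \<open>W\<close> under division by \<open>K\<close> is the product of \<open>K\<close> and \<open>W\<close>, and products are open.
\<close>

lemma continuous_slice_div:
  assumes K: "slice L K"
  shows "continuous_map (subtopology (gtop (GL L)) (slice_dom L K)) (gtop (GL L)) (slice_div K)"
  unfolding continuous_map
proof (intro conjI allI impI)
  show "slice_div K ` topspace (subtopology (gtop (GL L)) (slice_dom L K)) \<subseteq> topspace (gtop (GL L))"
    using slice_div[OF K] slice_div_GL[OF K] by (auto simp: gcarrier_GL slice_dom_iff)
  fix W assume W: "openin (gtop (GL L)) W"
  have "{g \<in> topspace (subtopology (gtop (GL L)) (slice_dom L K)). slice_div K g \<in> W} = mult_set K W"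
  proof (intro equalityI subsetI)
    fix g assume g: "g \<in> {g \<in> topspace (subtopology (gtop (GL L)) (slice_dom L K)). slice_div K g \<in> W}"
    obtain x m y where xy: "g = (x, m, y)"
      using prod_cases3 by blast
    with g obtain n w where "(x, n, w) \<in> K"
      by (auto simp: slice_dom_iff)
    then show "g \<in> mult_set K W"
      using g slice_div[OF K] by (auto simp: xy mult_set_iff)
  next
    fix g assume g: "g \<in> mult_set K W"
    obtain x m y where xy: "g = (x, m, y)"
      using prod_cases3 by blast
    with g obtain n w where w: "(x, n, w) \<in> K" "(w, m - n, y) \<in> W"
      by (auto simp: mult_set_iff)
    moreover have "g \<in> GL_set L"
      using openin_subset[OF openin_mult_set[OF sliceD(1)[OF K] W]] g by (auto simp: gcarrier_GL)
    ultimately show "g \<in> {g \<in> topspace (subtopology (gtop (GL L)) (slice_dom L K)). slice_div K g \<in> W}"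
      using slice_div[OF K w(1)] by (auto simp: xy gcarrier_GL slice_dom_iff)
  qed
  moreover have "openin (gtop (GL L)) (mult_set K W)"
    by (rule openin_mult_set[OF sliceD(1)[OF K] W])
  ultimately show "openin (subtopology (gtop (GL L)) (slice_dom L K))
      {g \<in> topspace (subtopology (gtop (GL L)) (slice_dom L K)). slice_div K g \<in> W}"
    using openin_open_subtopology[OF slice_dom_clopen(1)[OF K]] by fastforce
qed

lemma continuous_arrow_to:
  assumes K: "slice L K"
  shows "continuous_map (subtopology (gtop (GL L)) (slice_dom L K)) (gtop (GL L)) (\<lambda>g. arrow_to K (fst g))"
  unfolding continuous_map
proof (intro conjI allI impI)
  have in_K: "arrow_to K (fst g) \<in> K" "fst (arrow_to K (fst g)) = fst g" if "g \<in> slice_dom L K" for g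
    using that arrow_to[OF K] by (cases g; auto simp: slice_dom_iff)+
  show "(\<lambda>g. arrow_to K (fst g)) ` topspace (subtopology (gtop (GL L)) (slice_dom L K)) \<subseteq> topspace (gtop (GL L))"
    using in_K sliceD(3)[OF K] by (auto simp: gcarrier_GL)
  fix W assume W: "openin (gtop (GL L)) W"
  have "{g \<in> topspace (subtopology (gtop (GL L)) (slice_dom L K)). arrow_to K (fst g) \<in> W}
      = {g \<in> topspace (gtop (GL L)). fst g \<in> fst ` (K \<inter> W)}"
  proof (intro equalityI subsetI)
    fix g assume "g \<in> {g \<in> topspace (subtopology (gtop (GL L)) (slice_dom L K)). arrow_to K (fst g) \<in> W}"
    then show "g \<in> {g \<in> topspace (gtop (GL L)). fst g \<in> fst ` (K \<inter> W)}"
      using in_K[of g] by (auto intro!: image_eqI[of _ _ "arrow_to K (fst g)"])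
  next
    fix g assume "g \<in> {g \<in> topspace (gtop (GL L)). fst g \<in> fst ` (K \<inter> W)}"
    then show "g \<in> {g \<in> topspace (subtopology (gtop (GL L)) (slice_dom L K)). arrow_to K (fst g) \<in> W}"
      using arrow_to[OF K] by (cases g) (auto simp: slice_dom_iff gcarrier_GL, blast)
  qed
  moreover have "openin (gtop (GL L)) {g \<in> topspace (gtop (GL L)). fst g \<in> fst ` (K \<inter> W)}"
    using W sliceD(1)[OF K] by (intro openin_continuous_map_preimage[OF continuous_map_grange] openin_range_image openin_Int)
  moreover have "{g \<in> topspace (gtop (GL L)). fst g \<in> fst ` (K \<inter> W)} \<subseteq> slice_dom L K"
    by (auto simp: slice_dom_iff gcarrier_GL, blast)
  ultimately show "openin (subtopology (gtop (GL L)) (slice_dom L K))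
      {g \<in> topspace (subtopology (gtop (GL L)) (slice_dom L K)). arrow_to K (fst g) \<in> W}"
    using openin_open_subtopology[OF slice_dom_clopen(1)[OF K]] by simp
qed

text \<open>
  If \<open>f\<close> is supported in a slice, the convolution with \<open>g\<close> is given by a single term, a product of
  continuous functions on the clopen set \<open>slice_dom L K\<close>.  Its support is the image of a part of the
  support of \<open>g\<close> under division by the inverse slice, so it is compact.
\<close>

lemma slice_op_convolution:
  assumes K: "slice L K" and f: "f \<in> Cc (GL L)" and f0: "\<And>a. a \<notin> K \<Longrightarrow> f a = 0"
    and g: "g \<in> Cc (GL L)" and T: "regular_rep (GL L) g T"
  shows "\<exists>h\<in>Cc (GL L). regular_rep (GL L) h (slice_op L f K o\<^sub>L T)"
proof
  let ?N = "slice_dom L K" and ?G = "gtop (GL L)"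
  define h where "h c = (if c \<in> ?N then f (arrow_to K (fst c)) * g (slice_div K c) else 0)" for c
  have fc: "continuous_map ?G euclidean f" and gc: "continuous_map ?G euclidean g"
    using f g by (auto simp: Cc_iff)
  obtain B where B: "\<And>a. cmod (f a) \<le> B"
    using Cc_bounded[OF f] by blast
  have h: "h (x, m, y) = f (x, n, w) * g (w, m - n, y)" if "(x, n, w) \<in> K" "(x, m, y) \<in> GL_set L" for x n w m y
    using that arrow_to[OF K that(1)] slice_div[OF K that(1)] by (auto simp: h_def slice_dom_iff)
  have K': "slice L (inv_set K)"
    by (rule slice_inv_set[OF K])
  have "continuous_map ?G euclidean h"
    unfolding h_def using slice_dom_clopen[OF K]
      continuous_map_compose[OF continuous_arrow_to[OF K] fc] continuous_map_compose[OF continuous_slice_div[OF K] gc]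
    by (intro continuous_map_on_clopen continuous_map_complex_mult) (simp_all add: comp_def)
  moreover have "\<exists>C. compactin ?G C \<and> (\<forall>c. c \<notin> C \<longrightarrow> h c = 0)"
  proof -
    obtain D where D: "compactin ?G D" "\<And>a. a \<notin> D \<Longrightarrow> g a = 0"
      using g unfolding Cc_iff by blast
    let ?D = "slice_dom L (inv_set K) \<inter> D"
    have "compactin ?G ?D"
      using D(1) slice_dom_clopen[OF K'] by (intro closed_Int_compactin)
    then have "compactin (subtopology ?G (slice_dom L (inv_set K))) ?D"
      by (simp add: compactin_subtopology)
    from image_compactin[OF this continuous_slice_div[OF K']]
    have "compactin ?G (slice_div (inv_set K) ` ?D)" .
    moreover have "h c = 0" if "c \<notin> slice_div (inv_set K) ` ?D" for c
    proof (rule ccontr)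
      assume c0: "h c \<noteq> 0"
      obtain x m y where c: "c = (x, m, y)"
        using prod_cases3 by blast
      obtain n w where w: "(x, n, w) \<in> K" "(x, m, y) \<in> GL_set L"
        using c0 by (auto simp: h_def c slice_dom_iff split: if_splits)
      have "g (w, m - n, y) \<noteq> 0"
        using c0 by (simp add: c h[OF w])
      then have "(w, m - n, y) \<in> D"
        using D(2) by blast
      moreover have "(w, m - n, y) \<in> slice_dom L (inv_set K)"
        using slice_div_GL[OF K w] w(1) by (auto simp: slice_dom_iff intro!: exI[of _ "- n"] exI[of _ x])
      moreover have "slice_div (inv_set K) (w, m - n, y) = c"
        using slice_div[OF K', of w "- n" x "m - n" y] w(1) by (simp add: c)
      ultimately show False
        using that by (metis IntI image_eqI)
    qed
    ultimately show ?thesis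
      by blast
  qed
  ultimately show "h \<in> Cc (GL L)"
    unfolding Cc_iff by (auto simp: h_def slice_dom_def)
  show "regular_rep (GL L) h (slice_op L f K o\<^sub>L T)"
    unfolding regular_rep_def
  proof (intro allI ext)
    fix \<xi> and c :: "('v, 'e) garrow"
    obtain x m y where c: "c = (x, m, y)"
      using prod_cases3 by blast
    have T': "ell2_fun (T \<xi>) d = convolution (GL L) g (ell2_fun \<xi>) d" for d
      using T by (simp add: regular_rep_def)
    show "ell2_fun ((slice_op L f K o\<^sub>L T) \<xi>) c = convolution (GL L) h (ell2_fun \<xi>) c"
    proof (cases "(x, m, y) \<in> ?N")
      case True
      then obtain n w where w: "(x, n, w) \<in> K" and G: "(x, m, y) \<in> GL_set L"
        by (auto simp: slice_dom_iff)
      let ?A = "{a \<in> GL_set L. fst a = x}" and ?B = "{b \<in> GL_set L. fst b = w}"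
      have xw: "(x, n, w) \<in> GL_set L"
        using w sliceD(3)[OF K] by blast
      have bij: "bij_betw (\<lambda>(x', k, z). (w, k - n, z)) ?A ?B"
        by (rule bij_betw_byWitness[where f' = "\<lambda>(w', k, z). (x, k + n, z)"])
          (use GL_mult[OF xw] GL_mult[OF GL_inv[OF xw]] in \<open>auto simp: add.commute\<close>)
      have "ell2_fun ((slice_op L f K o\<^sub>L T) \<xi>) c
          = f (x, n, w) * (\<Sum>\<^sub>\<infinity>b\<in>?B. g b * ell2_fun \<xi> (snd (snd b), m - n - dL b, y))"
        using slice_op_apply(1)[OF K B w G] slice_div_GL[OF K w G] by (simp add: c T' convolution_GL)
      also have "\<dots> = f (x, n, w) * (\<Sum>\<^sub>\<infinity>a\<in>?A. (\<lambda>b. g b * ell2_fun \<xi> (snd (snd b), m - n - dL b, y)) ((\<lambda>(x', k, z). (w, k - n, z)) a))"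
        by (subst infsum_reindex_bij_betw[OF bij]) simp
      also have "\<dots> = (\<Sum>\<^sub>\<infinity>a\<in>?A. f (x, n, w) * (g (w, dL a - n, snd (snd a)) * ell2_fun \<xi> (snd (snd a), m - dL a, y)))"
        by (simp add: infsum_cmult_right' case_prod_beta dL_def)
      also have "\<dots> = (\<Sum>\<^sub>\<infinity>a\<in>?A. h a * ell2_fun \<xi> (snd (snd a), m - dL a, y))"
        using h[OF w] by (intro infsum_cong) (auto simp: dL_def)
      finally show ?thesis
        using G by (simp add: c convolution_GL)
    next
      case False
      have "h a = 0" if "fst a = x" "(x, m, y) \<in> GL_set L" for a
        using that False by (cases a) (auto simp: h_def slice_dom_iff)
      then have "convolution (GL L) h (ell2_fun \<xi>) (x, m, y) = 0"
        by (auto simp: convolution_GL intro!: infsum_0)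
      then show ?thesis
        using slice_op_apply(2)[OF K B False] by (simp add: c)
    qed
  qed
qed

end

section \<open>The reduced $C^*$-algebra of $\mathcal G_{\mathcal L}$\<close>

text \<open>
  The function on the groupoid that an operator in the reduced $C^*$-algebra comes from.  Its values at the arrows with
  source \<open>z\<close> form the column of the operator at the unit \<open>z\<close>; for convolution by \<open>f\<close> this gives back \<open>f\<close>, see
  \<open>regular_rep_symbol\<close>.
\<close>

definition symbol :: "(('v, 'e) garrow ell2 \<Rightarrow>\<^sub>L ('v, 'e) garrow ell2) \<Rightarrow> ('v, 'e) garrow \<Rightarrow> complex" where
  "symbol T = (\<lambda>(x, n, z). ell2_fun (T (delta (z, 0, z))) (x, n, z))"

lemma bounded_linear_entry: "bounded_linear (\<lambda>T :: 'g ell2 \<Rightarrow>\<^sub>L 'h ell2. ell2_fun (T (delta g)) h)"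
proof (rule bounded_linear_intro)
  show "cmod (ell2_fun (T (delta g)) h) \<le> norm T * 1" for T :: "'g ell2 \<Rightarrow>\<^sub>L 'h ell2"
    using norm_entry_le by simp
qed (simp_all add: blinfun.add_left blinfun.scaleR_left plus_ell2.rep_eq scaleR_ell2.rep_eq)

lemma continuous_on_entry [continuous_intros]:
  "continuous_on S (\<lambda>T :: 'g ell2 \<Rightarrow>\<^sub>L 'h ell2. ell2_fun (T (delta g)) h)"
  using bounded_linear.continuous_on[OF bounded_linear_entry continuous_on_id] .

context lambda_graph_bisystem
begin

lemma CL_I: "f \<in> Cc (GL L) \<Longrightarrow> regular_rep (GL L) f T \<Longrightarrow> T \<in> CL L"
  unfolding groupoid_cstar_def by (intro subsetD[OF closure_subset] CollectI bexI)

lemma CL_closure_induct: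
  assumes T: "T \<in> CL L" and closed: "closed {T. P T}"
    and P: "\<And>f T. f \<in> Cc (GL L) \<Longrightarrow> regular_rep (GL L) f T \<Longrightarrow> P T"
  shows "P T"
proof -
  have "CL L \<subseteq> {T. P T}"
    unfolding groupoid_cstar_def by (rule closure_minimal[OF _ closed]) (use P in blast)
  then show ?thesis
    using T by blast
qed

lemma CL_outside:
  assumes T: "T \<in> CL L" and g: "g \<notin> GL_set L"
  shows "ell2_fun (T \<xi>) g = 0"
proof -
  let ?P = "pullback_op (GL_set L) id :: ('v, 'e) garrow ell2 \<Rightarrow>\<^sub>L ('v, 'e) garrow ell2"
  have P: "ell2_fun (?P \<eta>) h = (if h \<in> GL_set L then ell2_fun \<eta> h else 0)" for \<eta> h
    using pullback_op_apply[of id "GL_set L"] by simp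
  have "?P o\<^sub>L T = T"
  proof (rule CL_closure_induct[OF T])
    show "closed {T. ?P o\<^sub>L T = T}"
      by (intro closed_Collect_eq continuous_intros)
    fix f T assume "regular_rep (GL L) f T"
    then show "?P o\<^sub>L T = T"
      by (intro blinfun_eqI ell2_eqI) (auto simp: P regular_rep_def convolution_GL)
  qed
  then have "ell2_fun (T \<xi>) g = ell2_fun ((?P o\<^sub>L T) \<xi>) g"
    by (simp only:)
  then show ?thesis
    using g by (simp add: P)
qed

lemma CL_cong:
  assumes T: "T \<in> CL L" and eq: "\<And>g. g \<in> GL_set L \<Longrightarrow> ell2_fun \<xi> g = ell2_fun \<eta> g"
  shows "T \<xi> = T \<eta>"
proof -
  let ?P = "pullback_op (GL_set L) id :: ('v, 'e) garrow ell2 \<Rightarrow>\<^sub>L ('v, 'e) garrow ell2"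
  have P: "ell2_fun (?P \<eta>) h = (if h \<in> GL_set L then ell2_fun \<eta> h else 0)" for \<eta> h
    using pullback_op_apply[of id "GL_set L"] by simp
  have TP: "T o\<^sub>L ?P = T"
  proof (rule CL_closure_induct[OF T])
    show "closed {T. T o\<^sub>L ?P = T}"
      by (intro closed_Collect_eq continuous_intros)
    fix f T assume T: "regular_rep (GL L) f T"
    have "convolution (GL L) f (ell2_fun (?P \<xi>)) (x, m, y) = convolution (GL L) f (ell2_fun \<xi>) (x, m, y)" for \<xi> x m y
    proof (cases "(x, m, y) \<in> GL_set L")
      case True
      have "(snd (snd a), m - dL a, y) \<in> GL_set L" if aG: "a \<in> GL_set L" "fst a = x" for a
      proof -
        obtain n v where a: "a = (x, n, v)" "(x, n, v) \<in> GL_set L"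
          using aG by (cases a) auto
        then show ?thesis
          using GL_mult[OF GL_inv[OF a(2)] True] by (simp add: dL_def)
      qed
      then show ?thesis
        using True by (auto simp: convolution_GL P intro!: infsum_cong)
    qed (simp add: convolution_GL)
    then show "T o\<^sub>L ?P = T"
      using T by (intro blinfun_eqI ell2_eqI) (auto simp: regular_rep_def)
  qed
  have "T (?P \<zeta>) = T \<zeta>" for \<zeta>
    using arg_cong[OF TP, of "\<lambda>U. blinfun_apply U \<zeta>"] by simp
  moreover have "?P \<xi> = ?P \<eta>"
    by (rule ell2_eqI) (simp add: P eq)
  ultimately show ?thesis
    by metis
qed

lemma regular_rep_entry:
  assumes T: "regular_rep (GL L) f T"
  shows "ell2_fun (T (delta (w, k, z))) (x, m, y) =
    (if (x, m, y) \<in> GL_set L \<and> (w, k, z) \<in> GL_set L \<and> y = z then f (x, m - k, w) else 0)"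
proof (cases "(x, m, y) \<in> GL_set L \<and> (w, k, z) \<in> GL_set L \<and> y = z")
  case True
  then have "(x, m - k, w) \<in> GL_set L"
    using GL_mult[of x m y "- k" w] GL_inv[of w k y] by auto
  then have "(\<Sum>\<^sub>\<infinity>a\<in>{a \<in> GL_set L. fst a = x}. f a * ell2_fun (delta (w, k, z)) (snd (snd a), m - dL a, y))
      = (\<Sum>\<^sub>\<infinity>a\<in>{(x, m - k, w)}. f a * ell2_fun (delta (w, k, z)) (snd (snd a), m - dL a, y))"
    by (intro infsum_cong_neutral) (auto simp: delta_apply dL_def)
  then show ?thesis
    using True T by (simp add: regular_rep_def convolution_GL delta_apply dL_def)
next
  case False
  have "(\<Sum>\<^sub>\<infinity>a\<in>{a \<in> GL_set L. fst a = x}. f a * ell2_fun (delta (w, k, z)) (snd (snd a), m - dL a, y)) = 0"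
    if G: "(x, m, y) \<in> GL_set L"
  proof (rule infsum_0)
    fix a assume "a \<in> {a \<in> GL_set L. fst a = x}"
    then obtain n v where a: "a = (x, n, v)" "(x, n, v) \<in> GL_set L"
      by (cases a) auto
    then have "(v, m - n, y) \<in> GL_set L"
      using GL_mult[OF GL_inv[OF a(2)] G] by simp
    then show "f a * ell2_fun (delta (w, k, z)) (snd (snd a), m - dL a, y) = 0"
      using False G a by (auto simp: delta_apply dL_def)
  qed
  then show ?thesis
    unfolding if_not_P[OF False] using T by (simp add: regular_rep_def convolution_GL)
qed

text \<open>
  Operators in the algebra preserve the decomposition of $\ell^2$ by sources.
\<close>

lemma CL_entry:
  assumes T: "T \<in> CL L" and "ell2_fun (T (delta (w, k, z))) (x, m, y) \<noteq> 0"
  shows "(x, m, y) \<in> GL_set L" "(w, k, z) \<in> GL_set L" "y = z"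
proof -
  have "(x, m, y) \<in> GL_set L \<and> (w, k, z) \<in> GL_set L \<and> y = z"
  proof (rule ccontr)
    assume *: "\<not> ((x, m, y) \<in> GL_set L \<and> (w, k, z) \<in> GL_set L \<and> y = z)"
    have "ell2_fun (T (delta (w, k, z))) (x, m, y) = 0"
    proof (rule CL_closure_induct[OF T])
      show "closed {T :: ('v, 'e) garrow ell2 \<Rightarrow>\<^sub>L ('v, 'e) garrow ell2. ell2_fun (T (delta (w, k, z))) (x, m, y) = 0}"
        by (intro closed_Collect_eq continuous_intros)
    qed (use * regular_rep_entry in auto)
    then show False
      using assms by blast
  qed
  then show "(x, m, y) \<in> GL_set L" "(w, k, z) \<in> GL_set L" "y = z"
    by auto
qed

lemma regular_rep_symbol:
  assumes "regular_rep (GL L) f T" "g \<in> GL_set L"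
  shows "symbol T g = f g"
  using assms regular_rep_entry[OF assms(1)] GL_D GL_unit(2) by (cases g) (auto simp: symbol_def)

text \<open>
  A uniform limit of functions in $C_c$, because entries are bounded by the operator norm.
\<close>

lemma continuous_map_symbol:
  assumes T: "T \<in> CL L"
  shows "continuous_map (gtop (GL L)) euclidean (symbol T)"
  unfolding continuous_map
proof (intro conjI allI impI)
  fix U :: "complex set" assume "openin euclidean U"
  then have U: "open U" by simp
  show "openin (gtop (GL L)) {g \<in> topspace (gtop (GL L)). symbol T g \<in> U}"
    unfolding openin_subopen[of _ "{g \<in> topspace (gtop (GL L)). symbol T g \<in> U}"]
  proof clarify
    fix x n z assume g: "(x, n, z) \<in> topspace (gtop (GL L))" "symbol T (x, n, z) \<in> U"
    then obtain e where e: "e > 0" "ball (symbol T (x, n, z)) e \<subseteq> U"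
      using U open_contains_ball by blast
    have "\<exists>S\<in>{T. \<exists>f\<in>Cc (GL L). regular_rep (GL L) f T}. dist S T < e / 3"
    proof -
      have "0 < e / 3"
        using e(1) by simp
      then show ?thesis
        using T unfolding groupoid_cstar_def closure_approachable by blast
    qed
    then obtain S f where S: "f \<in> Cc (GL L)" "regular_rep (GL L) f S" "dist S T < e / 3"
      by blast
    have close: "dist (f h) (symbol T h) < e / 3" if "h \<in> GL_set L" for h
    proof -
      obtain x n z where h: "h = (x, n, z)"
        using prod_cases3 by blast
      have "dist (f h) (symbol T h) = cmod (ell2_fun ((S - T) (delta (z, 0, z))) (x, n, z))"
        unfolding regular_rep_symbol[OF S(2) that, symmetric]
        by (simp add: h symbol_def dist_norm blinfun.diff_left minus_ell2.rep_eq)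
      also have "\<dots> \<le> norm (S - T)"
        by (rule norm_entry_le)
      finally show ?thesis
        using S(3) by (simp add: dist_norm)
    qed
    let ?O = "{h \<in> topspace (gtop (GL L)). f h \<in> ball (f (x, n, z)) (e / 3)}"
    have "openin (gtop (GL L)) ?O"
      by (rule openin_continuous_map_preimage[OF Cc_D(1)[OF S(1)]]) simp
    moreover have "(x, n, z) \<in> ?O"
      using g e by simp
    moreover have "?O \<subseteq> {g \<in> topspace (gtop (GL L)). symbol T g \<in> U}"
    proof
      fix h assume h: "h \<in> ?O"
      then have "dist (f (x, n, z)) (f h) < e / 3" "h \<in> GL_set L" "(x, n, z) \<in> GL_set L"
        using g unfolding gcarrier_GL by simp_all
      then have "dist (symbol T (x, n, z)) (symbol T h) < e"
        using close[of h] close[of "(x, n, z)"]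
          dist_triangle[of "symbol T (x, n, z)" "symbol T h" "f (x, n, z)"]
          dist_triangle[of "f (x, n, z)" "symbol T h" "f h"] by (simp add: dist_commute)
      then show "h \<in> {g \<in> topspace (gtop (GL L)). symbol T g \<in> U}"
        using e(2) h by (simp add: subset_iff)
    qed
    ultimately show "\<exists>V. openin (gtop (GL L)) V \<and> (x, n, z) \<in> V \<and> V \<subseteq> {g \<in> topspace (gtop (GL L)). symbol T g \<in> U}"
      by blast
  qed
qed simp

end

context fpcc_bisystem
begin

lemma Cc_cover:
  assumes "f \<in> Cc (GL L)"
  obtains \<K> where "finite \<K>" "\<And>K. K \<in> \<K> \<Longrightarrow> slice L K" "\<And>g. g \<notin> \<Union>\<K> \<Longrightarrow> f g = 0"
proof -
  obtain C where C: "compactin (gtop (GL L)) C" "\<And>g. g \<notin> C \<Longrightarrow> f g = 0"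
    using Cc_D(3)[OF assms] by blast
  have "\<exists>K. slice L K \<and> g \<in> K" if g: "g \<in> C" for g
  proof -
    obtain x n z where xz: "g = (x, n, z)"
      using prod_cases3 by blast
    then have "(x, n, z) \<in> GL_set L"
      using g compactin_subset_topspace[OF C(1)] by (auto simp: gcarrier_GL)
    then obtain p q where "p < q" "(shift_pow n x, z) \<in> Rpq L p q"
      by (auto simp: GL_iff RL_iff)
    then show ?thesis
      using slice_G_basic G_basic_refl xz by blast
  qed
  then have "C \<subseteq> \<Union>{K. slice L K}"
    by blast
  moreover have "openin (gtop (GL L)) K" if "K \<in> {K. slice L K}" for K
    using that slice_clopen by blast
  ultimately obtain \<K> where "finite \<K>" "\<K> \<subseteq> {K. slice L K}" "C \<subseteq> \<Union>\<K>"
    using C(1) unfolding compactin_def by meson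
  then show ?thesis
    using C(2) by (intro that[of \<K>]) blast+
qed

text \<open>
  The support is covered by finitely many slices, and each slice contains at most one arrow with a given range.  This
  makes convolution sums finite, hence additive.
\<close>

lemma Cc_range_fibre:
  assumes "f \<in> Cc (GL L)"
  shows "finite {a. fst a = x \<and> f a \<noteq> 0}"
proof -
  obtain \<K> where \<K>: "finite \<K>" "\<And>K. K \<in> \<K> \<Longrightarrow> slice L K" "\<And>g. g \<notin> \<Union>\<K> \<Longrightarrow> f g = 0"
    using Cc_cover[OF assms] by blast
  have "a \<in> (\<lambda>K. arrow_to K x) ` \<K>" if a: "fst a = x" "f a \<noteq> 0" for a
  proof -
    obtain K where K: "K \<in> \<K>" "a \<in> K"
      using a \<K>(3)[of a] by blast
    then have "arrow_to K x = a"
      using arrow_to[OF \<K>(2)[OF K(1)]] a(1) by (cases a) auto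
    then show ?thesis
      using K by blast
  qed
  then have "{a. fst a = x \<and> f a \<noteq> 0} \<subseteq> (\<lambda>K. arrow_to K x) ` \<K>"
    by blast
  then show ?thesis
    by (rule finite_subset) (rule finite_imageI[OF \<K>(1)])
qed

lemma convolution_add:
  assumes "f \<in> Cc (GL L)" "g \<in> Cc (GL L)"
  shows "convolution (GL L) (\<lambda>a. f a + g a) h c = convolution (GL L) f h c + convolution (GL L) g h c"
proof -
  have summable: "(\<lambda>a. f a * h (snd (snd a), m - dL a, y)) summable_on {a \<in> GL_set L. fst a = x}"
    if "f \<in> Cc (GL L)" for f x m y
    by (rule finite_nonzero_values_imp_summable_on)
      (rule finite_subset[OF _ Cc_range_fibre[OF that, of x]], auto)
  show ?thesis
    using infsum_add[OF summable[OF assms(1)] summable[OF assms(2)]]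
    by (cases c) (simp add: convolution_GL distrib_right)
qed

lemma regular_rep_add:
  assumes "f \<in> Cc (GL L)" "g \<in> Cc (GL L)" "regular_rep (GL L) f S" "regular_rep (GL L) g T"
  shows "regular_rep (GL L) (\<lambda>a. f a + g a) (S + T)"
  using assms convolution_add[OF assms(1,2)] unfolding regular_rep_def
  by (simp add: blinfun.add_left plus_ell2.rep_eq fun_eq_iff)

text \<open>
  The support of \<open>f\<close> is covered by finitely many slices; the part of \<open>f\<close> on one of them is handled by
  \<open>slice_op_convolution\<close>, and the rest is supported in the other slices.
\<close>

lemma regular_rep_mult:
  assumes "finite \<K>"
  shows "(\<And>K. K \<in> \<K> \<Longrightarrow> slice L K) \<Longrightarrow> f \<in> Cc (GL L) \<Longrightarrow> (\<And>a. a \<notin> \<Union>\<K> \<Longrightarrow> f a = 0) \<Longrightarrow>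
    regular_rep (GL L) f S \<Longrightarrow> g \<in> Cc (GL L) \<Longrightarrow> regular_rep (GL L) g T \<Longrightarrow>
    \<exists>h\<in>Cc (GL L). regular_rep (GL L) h (S o\<^sub>L T)"
  using assms
proof (induction \<K> arbitrary: f S rule: finite_induct)
  case empty
  have "f = (\<lambda>_. 0)"
    using empty by auto
  then have "convolution (GL L) f u c = 0" for u c
    by (cases c) (simp add: convolution_GL)
  then have "convolution (GL L) f u = (\<lambda>_. 0)" for u
    by blast
  then show ?case
    using empty.prems(4) by (intro bexI[OF _ empty.prems(2)]) (simp add: regular_rep_def)
next
  case (insert K \<K>)
  have K: "slice L K"
    using insert.prems(1) by blast
  define f1 where "f1 a = (if a \<in> K then f a else 0)" for a
  define f2 where "f2 a = (if a \<in> GL_set L - K then f a else 0)" for a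
  have f1: "f1 \<in> Cc (GL L)" and f1_0: "\<And>a. a \<notin> K \<Longrightarrow> f1 a = 0"
    unfolding f1_def using Cc_restrict[OF insert.prems(2) slice_clopen[OF K]] by auto
  have f2: "f2 \<in> Cc (GL L)"
    unfolding f2_def using slice_clopen[OF K] openin_diff[OF openin_topspace] closedin_diff[OF closedin_topspace]
    by (intro Cc_restrict insert.prems(2)) (auto simp flip: gcarrier_GL)
  have f: "f = (\<lambda>a. f1 a + f2 a)"
    using Cc_D(2)[OF insert.prems(2)] sliceD(3)[OF K] by (auto simp: f1_def f2_def fun_eq_iff)
  let ?S1 = "slice_op L f1 K"
  obtain B where B: "\<And>a. cmod (f1 a) \<le> B"
    using Cc_bounded[OF f1] by blast
  have S1: "regular_rep (GL L) f1 ?S1"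
    by (rule regular_rep_slice_op[OF K B f1_0])
  have S2: "regular_rep (GL L) f2 (S - ?S1)"
    using insert.prems(4) S1 convolution_add[OF f1 f2] unfolding f regular_rep_def
    by (simp add: blinfun.diff_left minus_ell2.rep_eq fun_eq_iff)
  obtain h1 where h1: "h1 \<in> Cc (GL L)" "regular_rep (GL L) h1 (?S1 o\<^sub>L T)"
    using slice_op_convolution[OF K f1 f1_0 insert.prems(5,6)] by blast
  have "\<And>a. a \<notin> \<Union>\<K> \<Longrightarrow> f2 a = 0"
    using insert.prems(3) by (auto simp: f2_def)
  then obtain h2 where h2: "h2 \<in> Cc (GL L)" "regular_rep (GL L) h2 ((S - ?S1) o\<^sub>L T)"
    using insert.IH[OF _ f2 _ S2 insert.prems(5,6)] insert.prems(1) by blast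
  have "(?S1 o\<^sub>L T) + ((S - ?S1) o\<^sub>L T) = S o\<^sub>L T"
    by (rule blinfun_eqI) (simp add: blinfun.add_left blinfun.diff_left)
  then show ?case
    using regular_rep_add[OF h1(1) h2(1) h1(2) h2(2)] Cc_add[OF h1(1) h2(1)] by auto
qed

text \<open>
  For convolution operators this is \<open>regular_rep_mult\<close>, and composition is continuous.
\<close>

lemma CL_mult:
  assumes S: "S \<in> CL L" and T: "T \<in> CL L"
  shows "S o\<^sub>L T \<in> CL L"
proof -
  let ?A = "{T. \<exists>f\<in>Cc (GL L). regular_rep (GL L) f T}"
  have mult: "S o\<^sub>L T \<in> ?A" if ST: "S \<in> ?A" "T \<in> ?A" for S T
  proof -
    obtain f g where fg: "f \<in> Cc (GL L)" "regular_rep (GL L) f S" "g \<in> Cc (GL L)" "regular_rep (GL L) g T"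
      using ST by blast
    obtain \<K> where "finite \<K>" "\<And>K. K \<in> \<K> \<Longrightarrow> slice L K" "\<And>a. a \<notin> \<Union>\<K> \<Longrightarrow> f a = 0"
      using Cc_cover[OF fg(1)] by blast
    from regular_rep_mult[OF this(1,2) fg(1) this(3) fg(2-4)] show ?thesis
      by blast
  qed
  obtain s t where "\<And>i. s i \<in> ?A" "s \<longlonglongrightarrow> S" "\<And>i. t i \<in> ?A" "t \<longlonglongrightarrow> T"
    using S T unfolding groupoid_cstar_def closure_sequential by blast
  then have "(\<lambda>i. s i o\<^sub>L t i) \<longlonglongrightarrow> (S o\<^sub>L T)" "\<And>i. s i o\<^sub>L t i \<in> ?A"
    using mult by (auto intro!: bounded_bilinear.tendsto[OF bounded_bilinear_blinfun_compose])
  then show ?thesis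
    unfolding groupoid_cstar_def closure_sequential by (intro exI[of _ "\<lambda>i. s i o\<^sub>L t i"]) blast
qed

end

section \<open>From an isomorphism of groupoids to one of $C^*$-algebras\<close>

definition lift_arrow :: "(('v, 'e) config \<Rightarrow> ('w, 'f) config) \<Rightarrow> ('v, 'e) garrow \<Rightarrow> ('w, 'f) garrow" where
  "lift_arrow a = (\<lambda>(x, n, z). (a x, n, a z))"

lemma lift_arrow_simps [simp]:
  "lift_arrow a (x, n, z) = (a x, n, a z)" "fst (lift_arrow a g) = a (fst g)"
  "dL (lift_arrow a g) = dL g" "snd (snd (lift_arrow a g)) = a (snd (snd g))"
  by (simp_all add: lift_arrow_def dL_def case_prod_beta)

text \<open>
  A bijection of the configuration spaces that respects arrows and their topology.  That \<open>a\<close> maps arrows to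
  arrows is part of the continuity of its lift, as a continuous map sends the carrier into the carrier.
\<close>

locale graded_iso = A: lambda_graph_bisystem L1 + B: lambda_graph_bisystem L2
  for L1 :: "('v1, 'e1, 'a1) bisystem" and L2 :: "('v2, 'e2, 'a2) bisystem" +
  fixes a :: "('v1, 'e1) config \<Rightarrow> ('v2, 'e2) config" and b :: "('v2, 'e2) config \<Rightarrow> ('v1, 'e1) config"
  assumes ba: "x \<in> XL L1 \<Longrightarrow> b (a x) = x"
    and ab: "y \<in> XL L2 \<Longrightarrow> a (b y) = y"
    and cont_a: "continuous_map (gtop (GL L1)) (gtop (GL L2)) (lift_arrow a)"
    and cont_b: "continuous_map (gtop (GL L2)) (gtop (GL L1)) (lift_arrow b)"
begin

text \<open>
  The situation is symmetric.  Facts about the inverse direction are read off from those proved before by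
  interpreting the locale with the two sides exchanged.
\<close>

lemma swap: "graded_iso L2 L1 b a"
  by unfold_locales (use ab ba cont_a cont_b in auto)

lemma lift_GL: "g \<in> GL_set L1 \<Longrightarrow> lift_arrow a g \<in> GL_set L2"
  using continuous_map_image_subset_topspace[OF cont_a] by (auto simp: gcarrier_GL)

lemma lift_inverse: "g \<in> GL_set L1 \<Longrightarrow> lift_arrow b (lift_arrow a g) = g"
  by (cases g) (simp add: ba A.GL_D)

lemma inj_lift: "inj_on (lift_arrow a) (GL_set L1)"
  using lift_inverse by (metis inj_onI)

end

context graded_iso
begin

interpretation S: graded_iso L2 L1 b a
  by (rule swap)

lemma lift_GL': "g \<in> GL_set L2 \<Longrightarrow> lift_arrow b g \<in> GL_set L1"
  by (rule S.lift_GL)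

lemma lift_inverse': "g \<in> GL_set L2 \<Longrightarrow> lift_arrow a (lift_arrow b g) = g"
  by (rule S.lift_inverse)

lemma b_XL: "y \<in> XL L2 \<Longrightarrow> b y \<in> XL L1"
  using S.lift_GL[of "(y, 0, y)"] B.GL_unit(2) A.GL_D(1) by fastforce

lemma bij_lift: "bij_betw (lift_arrow a) (GL_set L1) (GL_set L2)"
  by (rule bij_betw_byWitness[where f' = "lift_arrow b"])
    (use lift_inverse lift_inverse' lift_GL lift_GL' in auto)

lemma groupoid_iso_lift: "groupoid_iso (GL L1) (GL L2) (lift_arrow a)"
  unfolding groupoid_iso_def gcarrier_GL
proof (intro conjI ballI impI)
  show "homeomorphic_map (gtop (GL L1)) (gtop (GL L2)) (lift_arrow a)"
    using cont_a cont_b lift_inverse lift_inverse'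
    by (intro homeomorphic_maps_imp_map[of _ _ _ "lift_arrow b"]) (auto simp: homeomorphic_maps_def gcarrier_GL)
  fix g h :: "('v1, 'e1) garrow"
  assume "gsource (GL L1) g = grange (GL L1) h"
  then show "lift_arrow a (gmult (GL L1) g h) = gmult (GL L2) (lift_arrow a g) (lift_arrow a h)"
    by (cases g, cases h) simp
qed (metis GL_simps(1-3) lift_arrow_simps(1) prod_cases3)+

definition "push = pullback_op (GL_set L2) (lift_arrow b)"

definition "pull = pullback_op (GL_set L1) (lift_arrow a)"

definition "transport T = push o\<^sub>L T o\<^sub>L pull"

lemma push_apply: "ell2_fun (push \<xi>) h = (if h \<in> GL_set L2 then ell2_fun \<xi> (lift_arrow b h) else 0)"
  unfolding push_def by (rule pullback_op_apply[OF S.inj_lift])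

lemma pull_apply: "ell2_fun (pull \<eta>) g = (if g \<in> GL_set L1 then ell2_fun \<eta> (lift_arrow a g) else 0)"
  unfolding pull_def by (rule pullback_op_apply[OF inj_lift])

lemma transport_apply: "transport T \<xi> = push (T (pull \<xi>))"
  by (simp add: transport_def)

lemma pull_push_apply: "ell2_fun (pull (push \<xi>)) g = (if g \<in> GL_set L1 then ell2_fun \<xi> g else 0)"
  by (simp add: pull_apply push_apply lift_GL lift_inverse)

text \<open>
  Relabelling back and forth is the projection onto the functions on the carrier, which acts trivially on the
  algebra.
\<close>

lemma CL_pull_push: "T \<in> CL L1 \<Longrightarrow> T (pull (push \<xi>)) = T \<xi>"
  by (rule A.CL_cong) (simp_all add: pull_push_apply)

lemma pull_push_CL: "T \<in> CL L1 \<Longrightarrow> pull (push (T \<xi>)) = T \<xi>"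
  by (rule ell2_eqI) (simp add: pull_push_apply A.CL_outside)

lemma cinner_push: "cinner (push \<xi>) \<eta> = cinner \<xi> (pull \<eta>)"
  unfolding push_def pull_def
proof (rule cinner_pullback_op)
  show "bij_betw (lift_arrow b) (GL_set L2) (GL_set L1)"
    by (rule bij_betw_byWitness[where f' = "lift_arrow a"])
      (use lift_inverse lift_inverse' lift_GL lift_GL' in auto)
qed (rule lift_inverse')

lemma cinner_pull: "cinner (pull \<eta>) \<xi> = cinner \<eta> (push \<xi>)"
  unfolding push_def pull_def by (rule cinner_pullback_op[OF bij_lift lift_inverse])

text \<open>
  Convolution only involves the multiplication of the groupoid, so conjugation by the relabelling turns
  convolution by \<open>f\<close> into convolution by the transported function.
\<close>

lemma regular_rep_transport:
  assumes T: "regular_rep (GL L1) f T"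
  shows "regular_rep (GL L2) (\<lambda>h. if h \<in> GL_set L2 then f (lift_arrow b h) else 0) (transport T)"
  unfolding regular_rep_def
proof (intro allI ext)
  fix \<xi> and c :: "('v2, 'e2) garrow"
  obtain x m y where c: "c = (x, m, y)"
    using prod_cases3 by blast
  show "ell2_fun (transport T \<xi>) c
    = convolution (GL L2) (\<lambda>h. if h \<in> GL_set L2 then f (lift_arrow b h) else 0) (ell2_fun \<xi>) c"
  proof (cases "(x, m, y) \<in> GL_set L2")
    case True
    let ?A = "{g \<in> GL_set L1. fst g = b x}" and ?B = "{h \<in> GL_set L2. fst h = x}"
    have G: "(b x, m, b y) \<in> GL_set L1"
      using lift_GL'[OF True] by simp
    have "lift_arrow a ` ?A \<subseteq> ?B"
      by (rule image_subsetI) (use lift_GL ab[OF B.GL_D(1)[OF True]] in simp)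
    then have bij: "bij_betw (lift_arrow b) ?B ?A"
      by (intro bij_betw_byWitness[where f' = "lift_arrow a"])
        (use lift_inverse lift_inverse' lift_GL' in auto)
    have "ell2_fun (transport T \<xi>) c = (\<Sum>\<^sub>\<infinity>g\<in>?A. f g * ell2_fun (pull \<xi>) (snd (snd g), m - dL g, b y))"
      using T True G by (simp add: c transport_apply push_apply regular_rep_def A.convolution_GL)
    also have "\<dots> = (\<Sum>\<^sub>\<infinity>h\<in>?B. f (lift_arrow b h) * ell2_fun (pull \<xi>) (b (snd (snd h)), m - dL h, b y))"
      by (subst infsum_reindex_bij_betw[OF bij, symmetric]) simp
    also have "\<dots> = (\<Sum>\<^sub>\<infinity>h\<in>?B. f (lift_arrow b h) * ell2_fun \<xi> (snd (snd h), m - dL h, y))"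
    proof (rule infsum_cong)
      fix h assume h: "h \<in> ?B"
      then obtain n w where hw: "h = (x, n, w)" "(x, n, w) \<in> GL_set L2"
        by (cases h) auto
      have "(w, m - n, y) \<in> GL_set L2"
        using B.GL_mult[OF B.GL_inv[OF hw(2)] True] by simp
      then show "f (lift_arrow b h) * ell2_fun (pull \<xi>) (b (snd (snd h)), m - dL h, b y)
          = f (lift_arrow b h) * ell2_fun \<xi> (snd (snd h), m - dL h, y)"
        using lift_GL'[of "(w, m - n, y)"] lift_inverse'[of "(w, m - n, y)"]
        by (simp add: hw dL_def pull_apply)
    qed
    finally show ?thesis
      using True by (auto simp: c B.convolution_GL intro!: infsum_cong)
  next
    case False
    then show ?thesis
      by (simp add: c transport_apply push_apply B.convolution_GL)
  qed
qed

lemma Cc_transport: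
  assumes f: "f \<in> Cc (GL L1)"
  shows "(\<lambda>h. if h \<in> GL_set L2 then f (lift_arrow b h) else 0) \<in> Cc (GL L2)"
proof -
  obtain C where C: "compactin (gtop (GL L1)) C" "\<And>g. g \<notin> C \<Longrightarrow> f g = 0"
    using A.Cc_D(3)[OF f] by blast
  show ?thesis
  proof (rule B.Cc_I)
    show "compactin (gtop (GL L2)) (lift_arrow a ` C)"
      by (rule image_compactin[OF C(1) cont_a])
    show "continuous_map (gtop (GL L2)) euclidean (\<lambda>h. if h \<in> GL_set L2 then f (lift_arrow b h) else 0)"
      by (rule continuous_map_eq[OF continuous_map_compose[OF cont_b A.Cc_D(1)[OF f]]]) (simp add: gcarrier_GL)
    show "(if h \<in> GL_set L2 then f (lift_arrow b h) else 0) = 0" if "h \<notin> lift_arrow a ` C" for h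
      using that lift_inverse'[of h] C(2)[of "lift_arrow b h"] by (metis image_eqI)
  qed simp
qed

lemma transport_CL:
  assumes "T \<in> CL L1"
  shows "transport T \<in> CL L2"
proof -
  let ?S = "{T. \<exists>f\<in>Cc (GL L1). regular_rep (GL L1) f T}"
  have "transport ` closure ?S \<subseteq> CL L2"
  proof (rule image_closure_subset)
    show "continuous_on (closure ?S) transport"
      unfolding transport_def by (intro continuous_intros)
    show "transport ` ?S \<subseteq> CL L2"
      using regular_rep_transport Cc_transport B.CL_I by blast
  qed (simp add: groupoid_cstar_def)
  then show ?thesis
    using assms by (auto simp: groupoid_cstar_def)
qed

lemma continuous_b: "continuous_map (Xtop L2) (Xtop L1) b"
  using continuous_map_compose[OF continuous_map_compose[OF B.continuous_map_unit cont_b] A.continuous_map_grange]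
  by (simp add: comp_def)

lemma transport_CX:
  assumes "T \<in> CX L1"
  shows "transport T \<in> CX L2"
proof -
  obtain f where f: "continuous_map (Xtop L1) euclidean f"
    "regular_rep (GL L1) (\<lambda>(x, n, z). if x \<in> XL L1 \<and> n = 0 \<and> z = x then f x else 0) T"
    using assms by (auto simp: CX_def)
  have "(if h \<in> GL_set L2 then (\<lambda>(x, n, z). if x \<in> XL L1 \<and> n = 0 \<and> z = x then f x else 0) (lift_arrow b h) else 0)
      = (\<lambda>(y, n, w). if y \<in> XL L2 \<and> n = 0 \<and> w = y then (f \<circ> b) y else 0) h" for h
  proof (cases h)
    case (fields y n w)
    have "b w = b y \<longleftrightarrow> w = y" if "h \<in> GL_set L2"
      using that ab B.GL_D fields by metis
    then show ?thesis
      using B.GL_D[of y n w] B.GL_unit(2)[of y] b_XL[of y] by (auto simp: fields)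
  qed
  then have "regular_rep (GL L2) (\<lambda>(y, n, w). if y \<in> XL L2 \<and> n = 0 \<and> w = y then (f \<circ> b) y else 0) (transport T)"
    using regular_rep_transport[OF f(2)] by presburger
  moreover have "continuous_map (Xtop L2) euclidean (f \<circ> b)"
    by (rule continuous_map_compose[OF continuous_b f(1)])
  ultimately show ?thesis
    unfolding CX_def by blast
qed

end

context graded_iso
begin

interpretation S: graded_iso L2 L1 b a
  by (rule swap)

lemma swap_transport_apply: "S.transport T \<xi> = pull (T (push \<xi>))"
  by (simp add: S.transport_apply S.push_def S.pull_def pull_def push_def)

lemma transport_inverse: "T \<in> CL L1 \<Longrightarrow> S.transport (transport T) = T"
  by (rule blinfun_eqI) (simp add: swap_transport_apply transport_apply CL_pull_push pull_push_CL)

lemma swap_transport_inverse: "T \<in> CL L2 \<Longrightarrow> transport (S.transport T) = T"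
  using S.CL_pull_push S.pull_push_CL
  by (intro blinfun_eqI) (simp add: swap_transport_apply transport_apply S.push_def S.pull_def pull_def push_def)

lemma bij_transport: "bij_betw transport (CL L1) (CL L2)"
  by (rule bij_betw_byWitness[where f' = S.transport])
    (use transport_inverse swap_transport_inverse transport_CL S.transport_CL in auto)

lemma transport_CX_onto:
  assumes "CX L2 \<subseteq> CL L2"
  shows "transport ` CX L1 = CX L2"
proof (intro equalityI subsetI)
  fix T assume "T \<in> CX L2"
  then have "T = transport (S.transport T)" "S.transport T \<in> CX L1"
    using swap_transport_inverse S.transport_CX assms by auto
  then show "T \<in> transport ` CX L1"
    by blast
qed (use transport_CX in blast)

lemma cstar_iso_transport: "cstar_iso (CL L1) (CL L2) transport"
  unfolding cstar_iso_def
proof (intro conjI ballI allI impI)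
  show "bij_betw transport (CL L1) (CL L2)"
    by (rule bij_transport)
next
  fix S T :: "('v1, 'e1) garrow ell2 \<Rightarrow>\<^sub>L ('v1, 'e1) garrow ell2"
  show "transport (S + T) = transport S + transport T"
    by (rule blinfun_eqI) (simp add: transport_apply blinfun.add_left blinfun.add_right)
next
  fix c and T :: "('v1, 'e1) garrow ell2 \<Rightarrow>\<^sub>L ('v1, 'e1) garrow ell2"
  show "transport (cscale c T) = cscale c (transport T)"
    by (intro blinfun_eqI ell2_eqI) (simp add: transport_apply cscale_apply push_apply)
next
  fix S T :: "('v1, 'e1) garrow ell2 \<Rightarrow>\<^sub>L ('v1, 'e1) garrow ell2"
  assume "S \<in> CL L1" "T \<in> CL L1"
  then show "transport (S o\<^sub>L T) = transport S o\<^sub>L transport T"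
    by (intro blinfun_eqI) (simp add: transport_apply pull_push_CL)
next
  fix S T :: "('v1, 'e1) garrow ell2 \<Rightarrow>\<^sub>L ('v1, 'e1) garrow ell2"
  assume "is_adjoint T S"
  then show "is_adjoint (transport T) (transport S)"
    by (simp add: is_adjoint_def transport_apply cinner_push flip: cinner_pull)
qed

lemma transport_gauge: "T \<in> CL L1 \<Longrightarrow> transport (gauge_action L1 t T) = gauge_action L2 t (transport T)"
proof -
  assume T: "T \<in> CL L1"
  have push_phase: "push (phase_op t \<xi>) = phase_op t (push \<xi>)" for t \<xi>
    by (rule ell2_eqI) (simp add: push_apply phase_op_apply gauge_fun_def case_prod_beta lift_arrow_def)
  have pull_phase: "pull (phase_op t \<eta>) = phase_op t (pull \<eta>)" for t \<eta>
    by (rule ell2_eqI) (simp add: pull_apply phase_op_apply gauge_fun_def case_prod_beta lift_arrow_def)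
  show ?thesis
    unfolding gauge_action_eq[OF T] gauge_action_eq[OF transport_CL[OF T]]
    by (rule blinfun_eqI) (simp add: transport_apply phase_conj_apply push_phase pull_phase)
qed

end

text \<open>
  An isomorphism respects range and source, so it acts on \<open>(x, n, z)\<close> by its action on the units at \<open>x\<close> and \<open>z\<close>;
  the degree is kept by assumption.
\<close>

lemma graded_iso_of_groupoid_iso:
  assumes L: "lambda_graph_bisystem L1" "lambda_graph_bisystem L2"
    and iso: "groupoid_iso (GL L1) (GL L2) \<phi>" and d: "\<And>g. g \<in> gcarrier (GL L1) \<Longrightarrow> dL (\<phi> g) = dL g"
  shows "\<exists>a b. graded_iso L1 L2 a b"
proof -
  interpret A: lambda_graph_bisystem L1 by fact
  interpret B: lambda_graph_bisystem L2 by fact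
  obtain \<psi> where hom: "homeomorphic_maps (gtop (GL L1)) (gtop (GL L2)) \<phi> \<psi>"
    using iso unfolding groupoid_iso_def homeomorphic_map_maps by blast
  have cont: "continuous_map (gtop (GL L1)) (gtop (GL L2)) \<phi>" "continuous_map (gtop (GL L2)) (gtop (GL L1)) \<psi>"
    and inv: "\<And>g. g \<in> GL_set L1 \<Longrightarrow> \<psi> (\<phi> g) = g" "\<And>h. h \<in> GL_set L2 \<Longrightarrow> \<phi> (\<psi> h) = h"
    using hom by (auto simp: homeomorphic_maps_def gcarrier_GL)
  have GL: "\<And>g. g \<in> GL_set L1 \<Longrightarrow> \<phi> g \<in> GL_set L2" "\<And>h. h \<in> GL_set L2 \<Longrightarrow> \<psi> h \<in> GL_set L1"
    using continuous_map_image_subset_topspace[OF cont(1)] continuous_map_image_subset_topspace[OF cont(2)]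
    by (auto simp: gcarrier_GL)
  define a where "a x = fst (\<phi> (x, 0, x))" for x
  define b where "b y = fst (\<psi> (y, 0, y))" for y
  have a: "\<phi> (x, n, z) = (a x, n, a z)" if g: "(x, n, z) \<in> GL_set L1" for x n z
  proof -
    obtain p m q where pq: "\<phi> (x, n, z) = (p, m, q)"
      using prod_cases3 by blast
    have "grange (GL L2) (\<phi> (x, n, z)) = \<phi> (grange (GL L1) (x, n, z))"
      "gsource (GL L2) (\<phi> (x, n, z)) = \<phi> (gsource (GL L1) (x, n, z))"
      using iso g unfolding groupoid_iso_def gcarrier_GL by blast+
    then have "(p, 0, p) = \<phi> (x, 0, x)" "(q, 0, q) = \<phi> (z, 0, z)"
      by (simp_all add: pq)
    then have "p = a x" "q = a z"
      by (metis a_def fst_conv)+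
    moreover have "m = n"
      using d[of "(x, n, z)"] g by (simp add: gcarrier_GL pq dL_def)
    ultimately show ?thesis
      by (simp add: pq)
  qed
  have ba: "b (a x) = x" if "x \<in> XL L1" for x
    using a[OF A.GL_unit(2)[OF that]] inv(1)[OF A.GL_unit(2)[OF that]] by (simp add: b_def)
  have b: "\<psi> (y, n, w) = (b y, n, b w)" if h: "(y, n, w) \<in> GL_set L2" for y n w
  proof -
    obtain x m z where xz: "\<psi> (y, n, w) = (x, m, z)" "(x, m, z) \<in> GL_set L1"
      using GL(2)[OF h] by (metis prod_cases3)
    then have "(y, n, w) = (a x, m, a z)"
      using inv(2)[OF h] a[OF xz(2)] by simp
    then show ?thesis
      using xz ba A.GL_D[OF xz(2)] by simp
  qed
  have ab: "a (b y) = y" if "y \<in> XL L2" for y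
    using b[OF B.GL_unit(2)[OF that]] inv(2)[OF B.GL_unit(2)[OF that]]
      a[of "b y" 0 "b y"] GL(2)[OF B.GL_unit(2)[OF that]] by simp
  have "graded_iso L1 L2 a b"
  proof
    show "continuous_map (gtop (GL L1)) (gtop (GL L2)) (lift_arrow a)"
      by (rule continuous_map_eq[OF cont(1)]) (auto simp: gcarrier_GL a lift_arrow_def)
    show "continuous_map (gtop (GL L2)) (gtop (GL L1)) (lift_arrow b)"
      by (rule continuous_map_eq[OF cont(2)]) (auto simp: gcarrier_GL b lift_arrow_def)
  qed (use ab ba in auto)
  then show ?thesis
    by blast
qed

section \<open>Partial isometries of slices and diagonal projections\<close>

definition slice_isom :: "('v, 'e, 'a) bisystem \<Rightarrow> ('v, 'e) garrow set \<Rightarrow> ('v, 'e) garrow ell2 \<Rightarrow>\<^sub>L ('v, 'e) garrow ell2" where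
  "slice_isom L K = slice_op L (\<lambda>g. if g \<in> K then 1 else 0) K"

abbreviation proj :: "('v, 'e, 'a) bisystem \<Rightarrow> ('v, 'e) config set \<Rightarrow> ('v, 'e) garrow ell2 \<Rightarrow>\<^sub>L ('v, 'e) garrow ell2" where
  "proj L U \<equiv> slice_isom L (units U)"

abbreviation clopen :: "('v, 'e, 'a) bisystem \<Rightarrow> ('v, 'e) config set \<Rightarrow> bool" where
  "clopen L U \<equiv> openin (Xtop L) U \<and> closedin (Xtop L) U"

lemma regular_rep_unique: "regular_rep G f S \<Longrightarrow> regular_rep G f T \<Longrightarrow> S = T"
  by (rule blinfun_eqI) (simp add: regular_rep_def ell2_fun_inject[symmetric])

lemma cscale_0: "cscale 0 T = 0"
  by (intro blinfun_eqI ell2_eqI) (simp add: cscale_apply zero_ell2.rep_eq)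

context lambda_graph_bisystem
begin

lemma slice_isom_apply:
  assumes K: "slice L K"
  shows "(x, n, w) \<in> K \<Longrightarrow> (x, m, y) \<in> GL_set L \<Longrightarrow>
      ell2_fun (slice_isom L K \<xi>) (x, m, y) = ell2_fun \<xi> (w, m - n, y)"
    and "(x, m, y) \<notin> slice_dom L K \<Longrightarrow> ell2_fun (slice_isom L K \<xi>) (x, m, y) = 0"
  using slice_op_apply[OF K, of "\<lambda>g. if g \<in> K then 1 else 0" 1] by (simp_all add: slice_isom_def)

lemma slice_isom_regular_rep: "slice L K \<Longrightarrow> regular_rep (GL L) (\<lambda>g. if g \<in> K then 1 else 0) (slice_isom L K)"
  unfolding slice_isom_def by (rule regular_rep_slice_op[of _ _ 1]) auto

lemma Cc_indicator:
  assumes K: "slice L K"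
  shows "(\<lambda>g. if g \<in> K then 1 else 0) \<in> Cc (GL L)"
  by (rule Cc_I[OF continuous_map_restrict_clopen[OF slice_clopen[OF K]] _ sliceD(2)[OF K]])
    (use sliceD(3)[OF K] in auto)

lemma slice_isom_CL: "slice L K \<Longrightarrow> slice_isom L K \<in> CL L"
  by (rule CL_I[OF Cc_indicator slice_isom_regular_rep])

lemma CL_cscale:
  assumes "T \<in> CL L"
  shows "cscale c T \<in> CL L"
proof -
  let ?S = "{T. \<exists>f\<in>Cc (GL L). regular_rep (GL L) f T}"
  have "cscale c ` closure ?S \<subseteq> CL L"
  proof (rule image_closure_subset)
    show "continuous_on (closure ?S) (cscale c)"
      unfolding cscale_def by (intro continuous_intros)
    show "cscale c ` ?S \<subseteq> CL L"
    proof (rule image_subsetI)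
      fix T assume "T \<in> ?S"
      then obtain f where f: "f \<in> Cc (GL L)" "regular_rep (GL L) f T"
        by blast
      have "convolution (GL L) (\<lambda>g. c * f g) u d = c * convolution (GL L) f u d" for u d
        by (cases d) (simp add: convolution_GL infsum_cmult_right' mult.assoc)
      then have "regular_rep (GL L) (\<lambda>g. c * f g) (cscale c T)"
        using f(2) by (simp add: regular_rep_def fun_eq_iff cscale_apply)
      moreover have "(\<lambda>g. c * f g) \<in> Cc (GL L)"
      proof -
        obtain C where "compactin (gtop (GL L)) C" "\<And>g. g \<notin> C \<Longrightarrow> f g = 0"
          using Cc_D(3)[OF f(1)] by blast
        then show ?thesis
          using Cc_D(1,2)[OF f(1)] by (intro Cc_I[of _ C] continuous_map_complex_mult) auto
      qed
      ultimately show "cscale c T \<in> CL L"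
        by (rule CL_I[rotated])
    qed
  qed (simp add: groupoid_cstar_def)
  then show ?thesis
    using assms by (auto simp: groupoid_cstar_def)
qed

end

context fpcc_bisystem
begin

lemma proj_apply:
  assumes U: "clopen L U"
  shows "ell2_fun (proj L U \<xi>) (x, m, y) = (if (x, m, y) \<in> GL_set L \<and> x \<in> U then ell2_fun \<xi> (x, m, y) else 0)"
proof -
  have K: "slice L (units U)"
    using U by (intro slice_units) simp_all
  show ?thesis
  proof (cases "(x, m, y) \<in> GL_set L \<and> x \<in> U")
    case True
    then show ?thesis
      using slice_isom_apply(1)[OF K, of x 0 x m y] by simp
  next
    case False
    then have "(x, m, y) \<notin> slice_dom L (units U)"
      by (auto simp: slice_dom_iff)
    from slice_isom_apply(2)[OF K this] show ?thesis
      unfolding if_not_P[OF False] .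
  qed
qed

lemma clopen_XL: "clopen L U \<Longrightarrow> U \<subseteq> XL L"
  using openin_subset[of "Xtop L" U] by (simp add: topspace_Xtop)

lemma proj_inj: "clopen L U \<Longrightarrow> clopen L V \<Longrightarrow> proj L U = proj L V \<Longrightarrow> U = V"
proof -
  assume U: "clopen L U" and V: "clopen L V" and eq: "proj L U = proj L V"
  have "x \<in> U \<longleftrightarrow> x \<in> V" if x: "x \<in> XL L" for x
  proof -
    have "ell2_fun (proj L U (delta (x, 0, x))) (x, 0, x) = ell2_fun (proj L V (delta (x, 0, x))) (x, 0, x)"
      using eq by simp
    then show ?thesis
      unfolding proj_apply[OF U] proj_apply[OF V] using GL_unit(2)[OF x] by (simp add: delta_apply split: if_splits)
  qed
  then show "U = V"
    using clopen_XL[OF U] clopen_XL[OF V] by blast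
qed

lemma proj_Int:
  assumes U: "clopen L U" and V: "clopen L V"
  shows "proj L U o\<^sub>L proj L V = proj L (U \<inter> V)"
proof (intro blinfun_eqI ell2_eqI)
  fix \<xi> and g :: "('v, 'e) garrow"
  have UV: "clopen L (U \<inter> V)"
    using U V by (simp add: openin_Int closedin_Int)
  show "ell2_fun ((proj L U o\<^sub>L proj L V) \<xi>) g = ell2_fun (proj L (U \<inter> V) \<xi>) g"
    by (cases g) (simp add: proj_apply[OF U] proj_apply[OF V] proj_apply[OF UV])
qed

lemma proj_empty: "proj L {} = 0"
proof (intro blinfun_eqI ell2_eqI)
  fix \<xi> and g :: "('v, 'e) garrow"
  show "ell2_fun (proj L {} \<xi>) g = ell2_fun ((0 :: ('v, 'e) garrow ell2 \<Rightarrow>\<^sub>L ('v, 'e) garrow ell2) \<xi>) g"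
    by (cases g) (simp add: proj_apply zero_ell2.rep_eq)
qed

lemma CX_function:
  "(\<lambda>(x, n, z). if x \<in> XL L \<and> n = 0 \<and> z = x then f x else 0) = (\<lambda>g. if g \<in> units (XL L) then f (fst g) else 0)"
  by auto

lemma slice_XL: "slice L (units (XL L))"
  using slice_units[of "XL L"] openin_topspace[of "Xtop L"] closedin_topspace[of "Xtop L"]
  by (simp add: topspace_Xtop)

lemma CX_subset_CL: "CX L \<subseteq> CL L"
proof
  fix T assume "T \<in> CX L"
  then obtain f where f: "continuous_map (Xtop L) euclidean f"
    "regular_rep (GL L) (\<lambda>g. if g \<in> units (XL L) then f (fst g) else 0) T"
    unfolding CX_def CX_function by blast
  have "continuous_map (gtop (GL L)) euclidean (\<lambda>g. f (fst g))"
    using continuous_map_compose[OF continuous_map_grange f(1)] by (simp add: comp_def)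
  note cont = continuous_map_restrict_clopen[OF slice_clopen[OF slice_XL] this]
  have "g \<notin> units (XL L)" if "g \<notin> GL_set L" for g
    using that sliceD(3)[OF slice_XL] by blast
  then have "(\<lambda>g. if g \<in> units (XL L) then f (fst g) else 0) \<in> Cc (GL L)"
    by (intro Cc_I[OF cont _ sliceD(2)[OF slice_XL]]) simp_all
  then show "T \<in> CL L"
    using f(2) by (rule CL_I)
qed

lemma proj_CX:
  assumes U: "clopen L U"
  shows "proj L U \<in> CX L"
proof -
  have "continuous_map (Xtop L) euclidean (\<lambda>x. if x \<in> U then 1 else (0 :: complex))"
    using U by (intro continuous_map_restrict_clopen) auto
  moreover have "(\<lambda>g. if g \<in> units (XL L) then (if fst g \<in> U then 1 else 0) else 0) = (\<lambda>g. if g \<in> units U then 1 else (0 :: complex))"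
    (is "?l = ?r")
  proof
    show "?l g = ?r g" for g
      using clopen_XL[OF U] by (cases g) auto
  qed
  moreover have "regular_rep (GL L) (\<lambda>g. if g \<in> units U then 1 else 0) (proj L U)"
    using slice_isom_regular_rep[OF slice_units] U by blast
  ultimately show ?thesis
    unfolding CX_def CX_function by (intro CollectI exI[of _ "\<lambda>x. if x \<in> U then 1 else 0"]) simp
qed

text \<open>
  An idempotent function has values 0 and 1 only.
\<close>

lemma CX_idempotent:
  assumes T: "T \<in> CX L" "T o\<^sub>L T = T"
  obtains U where "clopen L U" "T = proj L U"
proof -
  obtain f where f: "continuous_map (Xtop L) euclidean f"
    "regular_rep (GL L) (\<lambda>g. if g \<in> units (XL L) then f (fst g) else 0) T"
    using T(1) unfolding CX_def CX_function by blast
  have sq: "f x = 0 \<or> f x = 1" if x: "x \<in> XL L" for x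
  proof -
    have G: "(x, 0, x) \<in> GL_set L"
      by (rule GL_unit(2)[OF x])
    have val: "ell2_fun (T \<xi>) (x, 0, x) = f x * ell2_fun \<xi> (x, 0, x)" for \<xi>
    proof -
      have "(\<Sum>\<^sub>\<infinity>a\<in>{a \<in> GL_set L. fst a = x}. (if a \<in> units (XL L) then f (fst a) else 0) * ell2_fun \<xi> (snd (snd a), 0 - dL a, x))
        = (\<Sum>\<^sub>\<infinity>a\<in>{(x, 0, x)}. (if a \<in> units (XL L) then f (fst a) else 0) * ell2_fun \<xi> (snd (snd a), 0 - dL a, x))"
        using G by (intro infsum_cong_neutral) auto
      then show ?thesis
        using f(2) G x by (simp add: regular_rep_def convolution_GL dL_def)
    qed
    have "ell2_fun ((T o\<^sub>L T) (delta (x, 0, x))) (x, 0, x) = ell2_fun (T (delta (x, 0, x))) (x, 0, x)"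
      using T(2) by simp
    then have "f x * f x = f x"
      by (simp add: val delta_apply)
    then show ?thesis
      by simp
  qed
  define U where "U = {x \<in> XL L. f x \<in> - {0}}"
  have "openin (Xtop L) U"
    using openin_continuous_map_preimage[OF f(1), of "- {0}"] by (simp add: U_def topspace_Xtop open_Compl)
  moreover have "U = {x \<in> XL L. f x \<in> {1}}"
    using sq by (auto simp: U_def)
  then have "closedin (Xtop L) U"
    using closedin_continuous_map_preimage[OF f(1), of "{1}"] by (simp add: topspace_Xtop)
  ultimately have U: "clopen L U"
    by blast
  have "(\<lambda>g. if g \<in> units (XL L) then f (fst g) else 0) = (\<lambda>g. if g \<in> units U then 1 else 0)"
    using sq by (auto simp: U_def fun_eq_iff)
  then have "regular_rep (GL L) (\<lambda>g. if g \<in> units U then 1 else 0) T"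
    using f(2) by (simp only:)
  moreover have "regular_rep (GL L) (\<lambda>g. if g \<in> units U then 1 else 0) (proj L U)"
    using U by (intro slice_isom_regular_rep slice_units) simp_all
  ultimately have "T = proj L U"
    by (rule regular_rep_unique)
  then show ?thesis
    using that U by blast
qed

text \<open>
  The sources of the arrows in \<open>K\<close> that end in \<open>U\<close>; this is how the slice moves a clopen set.
\<close>

lemma slice_source_clopen:
  assumes K: "slice L K" and U: "clopen L U"
  shows "clopen L ((snd \<circ> snd) ` {g \<in> K. fst g \<in> U})"
proof
  have eq: "{g \<in> K. fst g \<in> U} = {g \<in> topspace (gtop (GL L)). fst g \<in> U} \<inter> K"
    using sliceD(3)[OF K] by (auto simp: gcarrier_GL)
  have "openin (gtop (GL L)) {g \<in> K. fst g \<in> U}"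
    unfolding eq using openin_continuous_map_preimage[OF continuous_map_grange] U sliceD(1)[OF K] by blast
  then show "openin (Xtop L) ((snd \<circ> snd) ` {g \<in> K. fst g \<in> U})"
    by (rule openin_source_image)
  have "compactin (gtop (GL L)) {g \<in> K. fst g \<in> U}"
    unfolding eq using closedin_continuous_map_preimage[OF continuous_map_grange] U sliceD(2)[OF K]
    by (intro closed_Int_compactin) auto
  then show "closedin (Xtop L) ((snd \<circ> snd) ` {g \<in> K. fst g \<in> U})"
    using image_compactin[OF _ continuous_map_gsource] compactin_imp_closedin[OF Hausdorff_Xtop] by blast
qed

lemma proj_slice_isom:
  assumes K: "slice L K" and U: "clopen L U"
  shows "proj L U o\<^sub>L slice_isom L K = slice_isom L K o\<^sub>L proj L ((snd \<circ> snd) ` {g \<in> K. fst g \<in> U})"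
proof (intro blinfun_eqI ell2_eqI)
  fix \<xi> and g :: "('v, 'e) garrow"
  define U' where "U' = (snd \<circ> snd) ` {g \<in> K. fst g \<in> U}"
  have U': "clopen L U'"
    unfolding U'_def by (rule slice_source_clopen[OF K U])
  obtain x m y where g: "g = (x, m, y)"
    using prod_cases3 by blast
  have "ell2_fun ((proj L U o\<^sub>L slice_isom L K) \<xi>) g = ell2_fun ((slice_isom L K o\<^sub>L proj L U') \<xi>) g"
  proof (cases "(x, m, y) \<in> slice_dom L K")
    case True
    then obtain n w where w: "(x, n, w) \<in> K" and G: "(x, m, y) \<in> GL_set L"
      by (auto simp: slice_dom_iff)
    have "w \<in> U' \<longleftrightarrow> x \<in> U"
    proof
      assume "w \<in> U'"
      then obtain x' n' where "(x', n', w) \<in> K" "x' \<in> U"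
        by (force simp: U'_def)
      then show "x \<in> U"
        using sliceD(5)[OF K w] by blast
    qed (use w in \<open>auto simp: U'_def intro!: image_eqI[of _ _ "(x, n, w)"]\<close>)
    then show ?thesis
      using G slice_div_GL[OF K w G]
      by (simp add: g slice_isom_apply(1)[OF K w G] proj_apply[OF U] proj_apply[OF U'])
  qed (simp add: g slice_isom_apply(2)[OF K] proj_apply[OF U])
  then show "ell2_fun ((proj L U o\<^sub>L slice_isom L K) \<xi>) g
    = ell2_fun ((slice_isom L K o\<^sub>L proj L ((snd \<circ> snd) ` {g \<in> K. fst g \<in> U})) \<xi>) g"
    by (simp only: U'_def)
qed

lemma slice_isom_inverse:
  assumes K: "slice L K"
  shows "slice_isom L (inv_set K) o\<^sub>L slice_isom L K = proj L ((snd \<circ> snd) ` K)"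
proof (intro blinfun_eqI ell2_eqI)
  fix \<xi> and g :: "('v, 'e) garrow"
  have K': "slice L (inv_set K)"
    by (rule slice_inv_set[OF K])
  have "clopen L (XL L)"
    using openin_topspace[of "Xtop L"] closedin_topspace[of "Xtop L"] by (simp add: topspace_Xtop)
  moreover have "{g \<in> K. fst g \<in> XL L} = K"
    using sliceD(3)[OF K] GL_D(1) by auto
  ultimately have cl: "clopen L ((snd \<circ> snd) ` K)"
    using slice_source_clopen[OF K, of "XL L"] by simp
  define V where "V = (snd \<circ> snd) ` K"
  have cl: "clopen L V"
    using cl by (simp only: V_def)
  obtain w m y where g: "g = (w, m, y)"
    using prod_cases3 by blast
  have "ell2_fun ((slice_isom L (inv_set K) o\<^sub>L slice_isom L K) \<xi>) g = ell2_fun (proj L V \<xi>) g"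
  proof (cases "(w, m, y) \<in> slice_dom L (inv_set K)")
    case True
    then obtain n x where x: "(x, n, w) \<in> K" and G: "(w, m, y) \<in> GL_set L"
      by (auto simp: slice_dom_iff)
    have x': "(w, - n, x) \<in> inv_set K"
      using x by simp
    have "w \<in> V"
      using x by (force simp: V_def)
    then show ?thesis
      using G slice_div_GL[OF K' x' G] slice_isom_apply(1)[OF K x, of "m + n" y \<xi>]
      by (simp add: g slice_isom_apply(1)[OF K' x' G] proj_apply[OF cl])
  next
    case False
    have "\<not> ((w, m, y) \<in> GL_set L \<and> w \<in> V)"
    proof
      assume *: "(w, m, y) \<in> GL_set L \<and> w \<in> V"
      then obtain x n where "(x, n, w) \<in> K"
        by (force simp: V_def)
      then have "(w, - n, x) \<in> inv_set K"
        by simp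
      then show False
        using False * slice_dom_iff by blast
    qed
    then have "ell2_fun (proj L V \<xi>) (w, m, y) = 0"
      unfolding proj_apply[OF cl] by (rule if_not_P)
    then show ?thesis
      using False by (simp add: g slice_isom_apply(2)[OF K'])
  qed
  then show "ell2_fun ((slice_isom L (inv_set K) o\<^sub>L slice_isom L K) \<xi>) g = ell2_fun (proj L ((snd \<circ> snd) ` K) \<xi>) g"
    by (simp only: V_def)
qed

text \<open>
  The gauge action detects the degree of a slice.
\<close>

lemma phase_conj_slice_isom:
  assumes K: "slice L K" and n: "\<And>g. g \<in> K \<Longrightarrow> dL g = n"
  shows "phase_conj t (slice_isom L K) = cscale (exp (2 * of_real pi * \<i> * of_int n * of_real t)) (slice_isom L K)"
proof (rule regular_rep_unique)
  let ?c = "exp (2 * of_real pi * \<i> * of_int n * of_real t)"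
  have "gauge_fun t (\<lambda>g. if g \<in> K then 1 else 0) = (\<lambda>g. ?c * (if g \<in> K then 1 else 0))"
    using n by (auto simp: gauge_fun_def fun_eq_iff dL_def)
  then show "regular_rep (GL L) (\<lambda>g. ?c * (if g \<in> K then 1 else 0)) (phase_conj t (slice_isom L K))"
    using regular_rep_phase_conj[OF slice_isom_regular_rep[OF K], of t] by simp
  have "convolution (GL L) (\<lambda>g. ?c * (if g \<in> K then 1 else 0)) u d = ?c * convolution (GL L) (\<lambda>g. if g \<in> K then 1 else 0) u d" for u d
    by (cases d) (simp add: convolution_GL infsum_cmult_right' mult.assoc del: mult_if_delta)
  then show "regular_rep (GL L) (\<lambda>g. ?c * (if g \<in> K then 1 else 0)) (cscale ?c (slice_isom L K))"
    using slice_isom_regular_rep[OF K] by (simp add: regular_rep_def fun_eq_iff cscale_apply)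
qed

end

section \<open>From an isomorphism of $C^*$-algebras to one of groupoids\<close>

locale diagonal_gauge_iso = A: fpcc_bisystem L1 + B: fpcc_bisystem L2
  for L1 :: "('v1, 'e1, 'a1) bisystem" and L2 :: "('v2, 'e2, 'a2) bisystem" +
  fixes \<Phi> :: "(('v1, 'e1) garrow ell2 \<Rightarrow>\<^sub>L ('v1, 'e1) garrow ell2) \<Rightarrow> (('v2, 'e2) garrow ell2 \<Rightarrow>\<^sub>L ('v2, 'e2) garrow ell2)"
  assumes bij: "bij_betw \<Phi> (CL L1) (CL L2)"
    and mult: "S \<in> CL L1 \<Longrightarrow> T \<in> CL L1 \<Longrightarrow> \<Phi> (S o\<^sub>L T) = \<Phi> S o\<^sub>L \<Phi> T"
    and scale: "T \<in> CL L1 \<Longrightarrow> \<Phi> (cscale c T) = cscale c (\<Phi> T)"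
    and diagonal: "\<Phi> ` CX L1 = CX L2"
    and gauge: "T \<in> CL L1 \<Longrightarrow> \<Phi> (phase_conj t T) = phase_conj t (\<Phi> T)"
begin

lemma CL: "T \<in> CL L1 \<Longrightarrow> \<Phi> T \<in> CL L2"
  using bij by (auto simp: bij_betw_def)

lemma inj: "S \<in> CL L1 \<Longrightarrow> T \<in> CL L1 \<Longrightarrow> \<Phi> S = \<Phi> T \<Longrightarrow> S = T"
  using bij by (auto simp: bij_betw_def inj_on_def)

text \<open>
  The inverse is an isomorphism of the same kind.  Its multiplicativity needs products of operators in the algebra to
  lie in the algebra, as injectivity is only known there.
\<close>

lemma swap: "diagonal_gauge_iso L2 L1 (the_inv_into (CL L1) \<Phi>)"
proof
  let ?\<Psi> = "the_inv_into (CL L1) \<Phi>"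
  have \<Psi>: "?\<Psi> S \<in> CL L1" "\<Phi> (?\<Psi> S) = S" if "S \<in> CL L2" for S
    using that bij the_inv_into_into[of \<Phi> "CL L1" S "CL L1"] f_the_inv_into_f[of \<Phi> "CL L1" S]
    by (auto simp: bij_betw_def)
  have \<Psi>_eq: "?\<Psi> S = T" if "T \<in> CL L1" "\<Phi> T = S" for S T
    using that bij the_inv_into_f_f[of \<Phi> "CL L1" T] by (auto simp: bij_betw_def)
  show "bij_betw ?\<Psi> (CL L2) (CL L1)"
    by (rule bij_betw_the_inv_into[OF bij])
  show "?\<Psi> (S o\<^sub>L T) = ?\<Psi> S o\<^sub>L ?\<Psi> T" if "S \<in> CL L2" "T \<in> CL L2" for S T
    using that by (intro \<Psi>_eq A.CL_mult) (simp_all add: \<Psi> mult)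
  show "?\<Psi> (cscale c T) = cscale c (?\<Psi> T)" if "T \<in> CL L2" for c T
    using that by (intro \<Psi>_eq A.CL_cscale) (simp_all add: \<Psi> scale)
  show "?\<Psi> (phase_conj t T) = phase_conj t (?\<Psi> T)" if "T \<in> CL L2" for t T
    using that by (intro \<Psi>_eq phase_conj_CL) (simp_all add: \<Psi> gauge)
  have "?\<Psi> ` (\<Phi> ` CX L1) = CX L1"
    using A.CX_subset_CL \<Psi>_eq by (force simp: image_image)
  then show "?\<Psi> ` CX L2 = CX L1"
    by (simp only: diagonal)
qed

text \<open>
  Clopen sets correspond to the diagonal projections, and points to ultrafilters of clopen sets.  Both
  correspondences are kept as relations, since in this form they are symmetric in the two sides.
\<close>

definition corresponds :: "('v1, 'e1) config set \<Rightarrow> ('v2, 'e2) config set \<Rightarrow> bool" where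
  "corresponds U V \<longleftrightarrow> clopen L1 U \<and> clopen L2 V \<and> \<Phi> (proj L1 U) = proj L2 V"

definition same_point :: "('v1, 'e1) config \<Rightarrow> ('v2, 'e2) config \<Rightarrow> bool" where
  "same_point x y \<longleftrightarrow> x \<in> XL L1 \<and> y \<in> XL L2 \<and> (\<forall>U V. corresponds U V \<longrightarrow> (x \<in> U \<longleftrightarrow> y \<in> V))"

lemma proj_CL: "clopen L1 U \<Longrightarrow> proj L1 U \<in> CL L1"
  by (intro A.slice_isom_CL A.slice_units) auto

lemma corresponds_ex: 
  assumes U: "clopen L1 U"
  obtains V where "corresponds U V"
proof -
  have "\<Phi> (proj L1 U) \<in> CX L2"
    using diagonal A.proj_CX[OF U] by blast
  moreover have "\<Phi> (proj L1 U) o\<^sub>L \<Phi> (proj L1 U) = \<Phi> (proj L1 U)"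
    using mult[OF proj_CL[OF U] proj_CL[OF U]] A.proj_Int[OF U U] by simp
  ultimately obtain V where "clopen L2 V" "\<Phi> (proj L1 U) = proj L2 V"
    using B.CX_idempotent by blast
  then show ?thesis
    using that U by (auto simp: corresponds_def)
qed

end

context diagonal_gauge_iso
begin

interpretation S: diagonal_gauge_iso L2 L1 "the_inv_into (CL L1) \<Phi>"
  by (rule swap)

lemma swap_corresponds: "S.corresponds V U \<longleftrightarrow> corresponds U V"
proof -
  have "the_inv_into (CL L1) \<Phi> (proj L2 V) = proj L1 U \<longleftrightarrow> \<Phi> (proj L1 U) = proj L2 V"
    if "clopen L1 U" "clopen L2 V"
    using that bij proj_CL[OF that(1)] S.proj_CL[OF that(2)] the_inv_into_f_f[of \<Phi> "CL L1" "proj L1 U"]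
      f_the_inv_into_f[of \<Phi> "CL L1" "proj L2 V"] by (auto simp: bij_betw_def)
  then show ?thesis
    by (auto simp: corresponds_def S.corresponds_def)
qed

lemma swap_same_point: "S.same_point y x \<longleftrightarrow> same_point x y"
  unfolding same_point_def S.same_point_def swap_corresponds by blast

lemma corresponds_ex': "clopen L2 V \<Longrightarrow> \<exists>U. corresponds U V"
  using S.corresponds_ex swap_corresponds by metis

lemma corresponds_Int: "corresponds U V \<Longrightarrow> corresponds U' V' \<Longrightarrow> corresponds (U \<inter> U') (V \<inter> V')"
  unfolding corresponds_def using A.proj_Int[of U U'] B.proj_Int[of V V'] mult[OF proj_CL proj_CL, of U U']
  by (simp add: openin_Int closedin_Int)

lemma corresponds_unique: "corresponds U V \<Longrightarrow> corresponds U V' \<Longrightarrow> V = V'"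
  unfolding corresponds_def using B.proj_inj by metis

lemma corresponds_empty: "corresponds {} {}"
proof -
  have "\<Phi> (proj L1 {}) = cscale 0 (\<Phi> (proj L1 {}))"
    using scale[OF proj_CL[of "{}"], of 0] by (simp add: cscale_0 A.proj_empty)
  then show ?thesis
    by (simp add: corresponds_def cscale_0 B.proj_empty)
qed

end

context diagonal_gauge_iso
begin

interpretation S: diagonal_gauge_iso L2 L1 "the_inv_into (CL L1) \<Phi>"
  by (rule swap)

lemma corresponds_unique': "corresponds U V \<Longrightarrow> corresponds U' V \<Longrightarrow> U = U'"
  using S.corresponds_unique swap_corresponds by metis

lemma corresponds_disjoint: "corresponds U V \<Longrightarrow> corresponds U' V' \<Longrightarrow> U \<inter> U' = {} \<longleftrightarrow> V \<inter> V' = {}"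
  using corresponds_Int corresponds_unique corresponds_unique' corresponds_empty by metis

lemma corresponds_Diff:
  assumes UV: "corresponds U V"
  shows "corresponds (XL L1 - U) (XL L2 - V)"
proof -
  have "clopen L1 (XL L1 - U)"
    using UV openin_diff[of "Xtop L1" "XL L1" U] closedin_diff[of "Xtop L1" "XL L1" U]
      openin_topspace[of "Xtop L1"] closedin_topspace[of "Xtop L1"] by (simp add: corresponds_def topspace_Xtop)
  then obtain V' where V': "corresponds (XL L1 - U) V'"
    using corresponds_ex by blast
  then have "V \<inter> V' = {}"
    using corresponds_disjoint[OF UV V'] by blast
  moreover have "y \<in> V \<union> V'" if y: "y \<in> XL L2" for y
  proof (rule ccontr)
    assume no: "y \<notin> V \<union> V'"
    have "openin (Xtop L2) (XL L2 - (V \<union> V'))"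
      "closedin (Xtop L2) (XL L2 - (V \<union> V'))"
      using UV V' openin_diff[of "Xtop L2" "XL L2" "V \<union> V'"] closedin_diff[of "Xtop L2" "XL L2" "V \<union> V'"]
        openin_topspace[of "Xtop L2"] closedin_topspace[of "Xtop L2"]
      by (simp_all add: corresponds_def topspace_Xtop openin_Un closedin_Un)
    then obtain U'' where U'': "corresponds U'' (XL L2 - (V \<union> V'))"
      using corresponds_ex' by blast
    have "U'' \<inter> U = {}" "U'' \<inter> (XL L1 - U) = {}"
      using corresponds_disjoint[OF U'' UV] corresponds_disjoint[OF U'' V'] by blast+
    moreover have "U'' \<subseteq> XL L1"
      using U'' A.clopen_XL by (simp add: corresponds_def)
    ultimately have "U'' = {}"
      by blast
    then have "XL L2 - (V \<union> V') = {}"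
      using corresponds_unique[OF _ corresponds_empty] U'' by blast
    then show False
      using no y by blast
  qed
  moreover have "V' \<subseteq> XL L2"
    using V' B.clopen_XL by (simp add: corresponds_def)
  ultimately have "V' = XL L2 - V"
    by blast
  then show ?thesis
    using V' by simp
qed

lemma corresponds_XL: "corresponds (XL L1) (XL L2)"
  using corresponds_Diff[OF corresponds_empty] by simp

text \<open>
  Stone duality: the sets that correspond to clopen neighbourhoods of \<open>x\<close> have the finite intersection
  property, so by compactness they have a common point.
\<close>

lemma same_point_ex:
  assumes x: "x \<in> XL L1"
  shows "\<exists>y. same_point x y"
proof -
  let ?\<V> = "{V. \<exists>U. corresponds U V \<and> x \<in> U}"
  have fin: "\<exists>U V. corresponds U V \<and> x \<in> U \<and> V \<subseteq> \<Inter>\<F>" if "finite \<F>" "\<F> \<subseteq> ?\<V>" for \<F>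
    using that
  proof (induction \<F> rule: finite_induct)
    case empty
    then show ?case
      using corresponds_XL x by auto
  next
    case (insert W \<F>)
    then obtain U V U' where "corresponds U V" "x \<in> U" "V \<subseteq> \<Inter>\<F>" "corresponds U' W" "x \<in> U'"
      by auto
    then show ?case
      using corresponds_Int[of U V U' W] by (intro exI[of _ "U \<inter> U'"] exI[of _ "V \<inter> W"]) auto
  qed
  have "\<Inter>\<F> \<noteq> {}" if \<F>: "finite \<F>" "\<F> \<subseteq> ?\<V>" for \<F>
  proof -
    obtain U V where "corresponds U V" "x \<in> U" "V \<subseteq> \<Inter>\<F>"
      using fin[OF \<F>] by blast
    moreover from this have "V \<noteq> {}"
      using corresponds_unique' corresponds_empty by blast
    ultimately show ?thesis
      by blast
  qed
  moreover have "\<forall>C\<in>?\<V>. closedin (Xtop L2) C"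
    by (auto simp: corresponds_def)
  ultimately have "\<Inter>?\<V> \<noteq> {}"
    using B.compact_Xtop unfolding compact_space_fip by presburger
  then obtain y where y: "\<And>U V. corresponds U V \<Longrightarrow> x \<in> U \<Longrightarrow> y \<in> V"
    by auto
  have "x \<in> U \<longleftrightarrow> y \<in> V" if UV: "corresponds U V" for U V
    using y[OF UV] y[OF corresponds_Diff[OF UV]] x by blast
  then show ?thesis
    using x y[OF corresponds_XL x] by (auto simp: same_point_def)
qed

lemma same_point_unique:
  assumes "same_point x y" "same_point x y'"
  shows "y = y'"
proof (rule ccontr)
  assume "y \<noteq> y'"
  moreover have Y: "y \<in> XL L2" "y' \<in> XL L2"
    using assms by (auto simp: same_point_def)
  ultimately obtain p q where pq: "p < q" "cyl L2 p q y \<inter> cyl L2 p q y' = {}"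
    using B.cyl_separates by blast
  have "clopen L2 (cyl L2 p q y)"
    using B.openin_cyl[OF pq(1)] B.closedin_cyl[OF pq(1)] by blast
  then obtain U where U: "corresponds U (cyl L2 p q y)"
    using corresponds_ex' by blast
  have "y \<in> cyl L2 p q y" "y' \<notin> cyl L2 p q y"
    using pq B.cyl_refl Y by blast+
  then show False
    using assms U unfolding same_point_def by blast
qed

end

context diagonal_gauge_iso
begin

interpretation S: diagonal_gauge_iso L2 L1 "the_inv_into (CL L1) \<Phi>"
  by (rule swap)

lemma same_point_ex': "y \<in> XL L2 \<Longrightarrow> \<exists>x. same_point x y"
  using S.same_point_ex swap_same_point by blast

context
  fixes K n
  assumes K: "slice L1 K" and n: "\<And>g. g \<in> K \<Longrightarrow> dL g = n"
begin

lemma image_isom_CL: "\<Phi> (slice_isom L1 K) \<in> CL L2"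
  by (rule CL[OF A.slice_isom_CL[OF K]])

text \<open>
  The image of the partial isometry of a slice is again homogeneous of degree \<open>n\<close> for the gauge action, and an
  entry in degree \<open>m\<close> is multiplied by another phase unless \<open>m = n\<close>.
\<close>

lemma image_isom_degree:
  assumes nz: "symbol (\<Phi> (slice_isom L1 K)) (y, m, w) \<noteq> 0"
  shows "m = n"
proof (rule ccontr)
  assume mn: "m \<noteq> n"
  let ?A = "\<Phi> (slice_isom L1 K)" and ?c = "\<lambda>k t. exp (2 * of_real pi * \<i> * of_int k * of_real t)"
  \<comment> \<open>at this time the two phases differ by the factor \<open>-1\<close>\<close>
  define t :: real where "t = 1 / (2 * (of_int m - of_int n))"
  have "phase_conj t ?A = cscale (?c n t) ?A"
    using gauge[OF A.slice_isom_CL[OF K], of t] scale[OF A.slice_isom_CL[OF K], of "?c n t"]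
      A.phase_conj_slice_isom[OF K n, of t] by simp
  then have "ell2_fun (phase_conj t ?A (delta (w, 0, w))) (y, m, w) = ?c n t * symbol ?A (y, m, w)"
    by (simp add: cscale_apply symbol_def)
  moreover have "phase_op (- t) (delta (w, 0, w)) = delta (w, 0, w)"
    by (rule ell2_eqI) (auto simp: phase_op_apply delta_apply gauge_fun_def split: if_splits)
  then have "ell2_fun (phase_conj t ?A (delta (w, 0, w))) (y, m, w) = ?c m t * symbol ?A (y, m, w)"
    by (simp add: phase_conj_apply phase_op_apply gauge_fun_def symbol_def)
  ultimately have "?c m t = ?c n t"
    using nz by simp
  moreover have "?c m t = ?c n t * exp (\<i> * of_real pi)"
  proof -
    have "2 * of_real pi * \<i> * of_int m * of_real t = 2 * of_real pi * \<i> * of_int n * of_real t + \<i> * complex_of_real (2 * pi * (of_int m - of_int n) * t)"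
      by (simp add: algebra_simps)
    also have "2 * pi * (of_int m - of_int n) * t = pi"
      using mn by (simp add: t_def divide_simps)
    finally show ?thesis
      by (simp add: exp_add)
  qed
  ultimately show False
    by (simp add: exp_pi_i')
qed

text \<open>
  The partial isometry of \<open>K\<close> intertwines the projection of a clopen set \<open>U\<close> with that of the sources of the
  arrows in \<open>K\<close> that end in \<open>U\<close>.  Its image satisfies the corresponding relation, so where the symbol
  does not vanish, \<open>x\<close> lies in \<open>U\<close> if and only if \<open>z\<close> is one of these sources.  Letting \<open>U\<close> shrink
  to \<open>x\<close> leaves the arrow of \<open>K\<close> from \<open>z\<close> to \<open>x\<close>.
\<close>

lemma image_isom_support:
  assumes nz: "symbol (\<Phi> (slice_isom L1 K)) (y, m, w) \<noteq> 0" and xy: "same_point x y" and zw: "same_point z w"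
  shows "(x, m, z) \<in> K"
proof -
  let ?T = "slice_isom L1 K" and ?A = "\<Phi> (slice_isom L1 K)" and ?\<delta> = "delta (w, 0, w)"
  have T: "?T \<in> CL L1"
    by (rule A.slice_isom_CL[OF K])
  have nz': "ell2_fun (?A ?\<delta>) (y, m, w) \<noteq> 0"
    using nz by (simp add: symbol_def)
  have G: "(y, m, w) \<in> GL_set L2" "(w, 0, w) \<in> GL_set L2"
    using B.CL_entry[OF image_isom_CL nz'] by auto
  have key: "y \<in> V \<longleftrightarrow> w \<in> V'"
    if V: "corresponds U V" and V': "corresponds ((snd \<circ> snd) ` {g \<in> K. fst g \<in> U}) V'" for U V V'
  proof -
    have cl: "clopen L1 U" "clopen L2 V" "clopen L2 V'" "clopen L1 ((snd \<circ> snd) ` {g \<in> K. fst g \<in> U})"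
      using V V' by (auto simp: corresponds_def)
    have "proj L2 V o\<^sub>L ?A = ?A o\<^sub>L proj L2 V'"
      using mult[OF proj_CL[OF cl(1)] T] mult[OF T proj_CL[OF cl(4)]] A.proj_slice_isom[OF K cl(1)] V V'
      by (simp add: corresponds_def)
    from arg_cong[OF this, of "\<lambda>T. ell2_fun (blinfun_apply T ?\<delta>) (y, m, w)"]
    have "ell2_fun (proj L2 V (?A ?\<delta>)) (y, m, w) = ell2_fun (?A (proj L2 V' ?\<delta>)) (y, m, w)"
      by simp
    moreover have "proj L2 V' ?\<delta> = (if w \<in> V' then ?\<delta> else 0)"
    proof (rule ell2_eqI)
      show "ell2_fun (proj L2 V' ?\<delta>) g = ell2_fun (if w \<in> V' then ?\<delta> else 0) g" for g
        using G(2) by (cases g) (simp add: B.proj_apply[OF cl(3)] delta_apply zero_ell2.rep_eq)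
    qed
    moreover have "ell2_fun (proj L2 V (?A ?\<delta>)) (y, m, w) = (if y \<in> V then ell2_fun (?A ?\<delta>) (y, m, w) else 0)"
      using G by (simp add: B.proj_apply[OF cl(2)])
    moreover have "ell2_fun (?A 0) (y, m, w) = 0"
      by (simp add: blinfun.zero_right zero_ell2.rep_eq)
    ultimately show ?thesis
      using nz' by (cases "y \<in> V"; cases "w \<in> V'") simp_all
  qed
  have corresponds_source: "\<exists>V'. corresponds ((snd \<circ> snd) ` {g \<in> K. fst g \<in> U}) V'" if "corresponds U V" for U V
  proof -
    have "clopen L1 U"
      using that by (simp add: corresponds_def)
    from corresponds_ex[OF A.slice_source_clopen[OF K this]] show ?thesis
      by blast
  qed
  have mem: "x \<in> U \<longleftrightarrow> z \<in> (snd \<circ> snd) ` {g \<in> K. fst g \<in> U}" if V: "corresponds U V" for U V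
  proof -
    obtain V' where V': "corresponds ((snd \<circ> snd) ` {g \<in> K. fst g \<in> U}) V'"
      using corresponds_source[OF V] by blast
    show ?thesis
      using key[OF V V'] xy zw V V' unfolding same_point_def by blast
  qed
  have x: "x \<in> XL L1"
    using xy by (simp add: same_point_def)
  then have "z \<in> (snd \<circ> snd) ` {g \<in> K. fst g \<in> XL L1}"
    using mem[OF corresponds_XL] by blast
  then obtain x' k where x': "(x', k, z) \<in> K" "x' \<in> XL L1"
    by force
  have "x' = x"
  proof (rule ccontr)
    assume "x' \<noteq> x"
    then obtain p q where pq: "p < q" "cyl L1 p q x' \<inter> cyl L1 p q x = {}"
      using A.cyl_separates[OF x'(2) x] by blast
    obtain V where V: "corresponds (cyl L1 p q x') V"
      using corresponds_ex A.openin_cyl[OF pq(1)] A.closedin_cyl[OF pq(1)] by blast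
    have "x' \<in> cyl L1 p q x'"
      by (rule A.cyl_refl[OF x'(2)])
    then have "z \<in> (snd \<circ> snd) ` {g \<in> K. fst g \<in> cyl L1 p q x'}"
      using x'(1) by (auto intro!: image_eqI[of _ _ "(x', k, z)"])
    then have "x \<in> cyl L1 p q x'"
      using mem[OF V] by blast
    then show False
      using pq(2) A.cyl_refl[OF x] by blast
  qed
  moreover have "k = m"
    using n[OF x'(1)] image_isom_degree[OF nz] by (simp add: dL_def)
  ultimately show ?thesis
    using x'(1) by simp
qed

text \<open>
  Conversely no arrow is lost.  The partial isometry is inverted, on the source of \<open>K\<close>, by that of the inverse
  slice, and this relation survives in the image; so the column at \<open>w\<close> is not zero.  By
  \<open>image_isom_support\<close> its only possible entry is the one at \<open>(y, m, w)\<close>, which is thereby an arrow.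
\<close>

lemma image_isom_nonzero:
  assumes g: "(x, m, z) \<in> K" and xy: "same_point x y" and zw: "same_point z w"
  shows "(y, m, w) \<in> GL_set L2" "symbol (\<Phi> (slice_isom L1 K)) (y, m, w) \<noteq> 0"
proof -
  let ?T = "slice_isom L1 K" and ?T' = "slice_isom L1 (inv_set K)" and ?\<delta> = "delta (w, 0, w)"
  have T: "?T \<in> CL L1" "?T' \<in> CL L1"
    by (rule A.slice_isom_CL[OF K], rule A.slice_isom_CL[OF A.slice_inv_set[OF K]])
  have "{g \<in> K. fst g \<in> XL L1} = K"
    using sliceD(3)[OF K] A.GL_D(1) by auto
  then have "clopen L1 ((snd \<circ> snd) ` K)"
    using A.slice_source_clopen[OF K, of "XL L1"] corresponds_XL by (simp add: corresponds_def)
  then obtain V where V: "corresponds ((snd \<circ> snd) ` K) V"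
    using corresponds_ex by blast
  have "z \<in> (snd \<circ> snd) ` K"
    using g by force
  then have w: "w \<in> V" "w \<in> XL L2"
    using V zw unfolding same_point_def by blast+
  have cl: "clopen L2 V"
    using V by (simp add: corresponds_def)
  have "\<Phi> ?T' o\<^sub>L \<Phi> ?T = proj L2 V"
    using mult[OF T(2,1)] A.slice_isom_inverse[OF K] V by (simp add: corresponds_def)
  from arg_cong[OF this, of "\<lambda>T. ell2_fun (blinfun_apply T ?\<delta>) (w, 0, w)"]
  have "ell2_fun (\<Phi> ?T' (\<Phi> ?T ?\<delta>)) (w, 0, w) = ell2_fun (proj L2 V ?\<delta>) (w, 0, w)"
    by simp
  also have "\<dots> = 1"
    using w B.GL_unit(2)[OF w(2)] by (simp add: B.proj_apply[OF cl] delta_apply)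
  finally have "\<Phi> ?T ?\<delta> \<noteq> 0"
    by (auto simp: zero_ell2.rep_eq blinfun.zero_right)
  then obtain h where "ell2_fun (\<Phi> ?T ?\<delta>) h \<noteq> 0"
    using ell2_eqI[of "\<Phi> ?T ?\<delta>" 0] by (auto simp: zero_ell2.rep_eq)
  then obtain p k v where pkv: "ell2_fun (\<Phi> ?T ?\<delta>) (p, k, v) \<noteq> 0"
    by (metis prod_cases3)
  have G: "(p, k, v) \<in> GL_set L2" "v = w"
    using B.CL_entry[OF image_isom_CL pkv] by auto
  have nz: "symbol (\<Phi> ?T) (p, k, w) \<noteq> 0"
    using pkv G by (simp add: symbol_def)
  obtain x' where x': "same_point x' p"
    using same_point_ex'[OF B.GL_D(1)[OF G(1)]] by blast
  have "(x', k, z) \<in> K"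
    by (rule image_isom_support[OF nz x' zw])
  then have "x' = x" "k = m"
    using sliceD(5)[OF K g] by blast+
  then have "p = y"
    using same_point_unique[OF _ xy] x' by blast
  then show "(y, m, w) \<in> GL_set L2" "symbol (\<Phi> ?T) (y, m, w) \<noteq> 0"
    using G nz \<open>k = m\<close> by auto
qed

end

definition "point_map x = (THE y. same_point x y)"

lemma same_point_point_map: "x \<in> XL L1 \<Longrightarrow> same_point x (point_map x)"
  unfolding point_map_def using same_point_ex same_point_unique by (metis theI)

lemma point_map_eq: "same_point x y \<Longrightarrow> point_map x = y"
  using same_point_point_map same_point_unique same_point_def by blast

text \<open>
  The image of a slice is the open support of a continuous function.
\<close>

lemma lift_point_map_slice:
  assumes K: "slice L1 K" and n: "\<And>g. g \<in> K \<Longrightarrow> dL g = n"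
  shows "lift_arrow point_map ` K = {g \<in> GL_set L2. symbol (\<Phi> (slice_isom L1 K)) g \<noteq> 0}"
proof (intro equalityI subsetI)
  fix g assume "g \<in> lift_arrow point_map ` K"
  then obtain x m z where xz: "(x, m, z) \<in> K" "g = (point_map x, m, point_map z)"
    by (auto simp: lift_arrow_def)
  then have "(x, m, z) \<in> GL_set L1"
    using sliceD(3)[OF K] by blast
  then have "same_point x (point_map x)" "same_point z (point_map z)"
    using same_point_point_map A.GL_D by blast+
  then show "g \<in> {g \<in> GL_set L2. symbol (\<Phi> (slice_isom L1 K)) g \<noteq> 0}"
    using image_isom_nonzero[OF K n xz(1)] xz(2) by simp
next
  fix g assume g: "g \<in> {g \<in> GL_set L2. symbol (\<Phi> (slice_isom L1 K)) g \<noteq> 0}"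
  obtain y m w where yw: "g = (y, m, w)"
    using prod_cases3 by blast
  then have "(y, m, w) \<in> GL_set L2" and nz: "symbol (\<Phi> (slice_isom L1 K)) (y, m, w) \<noteq> 0"
    using g by auto
  then obtain x z where xz: "same_point x y" "same_point z w"
    using same_point_ex' B.GL_D by blast
  have "(x, m, z) \<in> K"
    by (rule image_isom_support[OF K n nz xz])
  then show "g \<in> lift_arrow point_map ` K"
    using xz yw point_map_eq by (auto intro!: image_eqI[of _ _ "(x, m, z)"])
qed

text \<open>
  Slices of constant degree form a base, so the map on arrows is open.  Applied to the inverse isomorphism
  this will give continuity.
\<close>

lemma lift_point_map_open:
  assumes W: "openin (gtop (GL L1)) W"
  shows "openin (gtop (GL L2)) (lift_arrow point_map ` W)"
  unfolding openin_subopen[of _ "lift_arrow point_map ` W"]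
proof
  fix g assume "g \<in> lift_arrow point_map ` W"
  then obtain k where k: "k \<in> W" "g = lift_arrow point_map k"
    by (rule imageE)
  obtain x n z where "k = (x, n, z)"
    using prod_cases3 by blast
  with k have xz: "(x, n, z) \<in> W" "g = lift_arrow point_map (x, n, z)"
    by simp_all
  then obtain p q where pq: "p < q" "(shift_pow n x, z) \<in> Rpq L1 p q" "G_basic L1 p q (x, n, z) \<subseteq> W"
    "(x, n, z) \<in> G_basic L1 p q (x, n, z)"
    using A.openin_GL_E[OF W] by metis
  let ?K = "G_basic L1 p q (x, n, z)"
  have K: "slice L1 ?K"
    by (rule A.slice_G_basic[OF pq(1,2)])
  have n: "dL g = n" if "g \<in> ?K" for g
    using that by (cases g) (auto simp: A.G_basic_iff dL_def)
  have image: "lift_arrow point_map ` ?K = {g \<in> GL_set L2. symbol (\<Phi> (slice_isom L1 ?K)) g \<noteq> 0}"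
    by (rule lift_point_map_slice[OF K n])
  have "openin (gtop (GL L2)) (lift_arrow point_map ` ?K)"
    unfolding image
    using openin_continuous_map_preimage[OF B.continuous_map_symbol[OF CL[OF A.slice_isom_CL[OF K]]], of "- {0}"]
    by (simp add: gcarrier_GL open_Compl)
  then show "\<exists>T. openin (gtop (GL L2)) T \<and> g \<in> T \<and> T \<subseteq> lift_arrow point_map ` W"
    using xz pq by blast
qed

end

context diagonal_gauge_iso
begin

interpretation S: diagonal_gauge_iso L2 L1 "the_inv_into (CL L1) \<Phi>"
  by (rule swap)

lemma swap_point_map: "x \<in> XL L1 \<Longrightarrow> S.point_map (point_map x) = x" "y \<in> XL L2 \<Longrightarrow> point_map (S.point_map y) = y"
  using S.point_map_eq[of "point_map x" x] same_point_point_map[of x] point_map_eq[of "S.point_map y" y] S.same_point_point_map[of y] swap_same_point by simp_all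

lemma lift_point_map_GL: "g \<in> GL_set L1 \<Longrightarrow> lift_arrow point_map g \<in> GL_set L2"
  using openin_subset[OF lift_point_map_open[OF openin_topspace]] by (auto simp: gcarrier_GL)

end

context diagonal_gauge_iso
begin

interpretation S: diagonal_gauge_iso L2 L1 "the_inv_into (CL L1) \<Phi>"
  by (rule swap)

lemma continuous_lift_point_map: "continuous_map (gtop (GL L1)) (gtop (GL L2)) (lift_arrow point_map)"
  unfolding continuous_map
proof (intro conjI allI impI)
  show "lift_arrow point_map ` topspace (gtop (GL L1)) \<subseteq> topspace (gtop (GL L2))"
    using lift_point_map_GL by (auto simp: gcarrier_GL)
  fix W assume W: "openin (gtop (GL L2)) W"
  have W_GL: "W \<subseteq> GL_set L2"
    using openin_subset[OF W] by (simp add: gcarrier_GL)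
  have 1: "lift_arrow S.point_map (lift_arrow point_map g) = g" if "g \<in> GL_set L1" for g
    using that swap_point_map(1) A.GL_D by (cases g) simp
  have 2: "lift_arrow point_map (lift_arrow S.point_map g) = g" if "g \<in> GL_set L2" for g
    using that swap_point_map(2) B.GL_D by (cases g) simp
  have "{g \<in> topspace (gtop (GL L1)). lift_arrow point_map g \<in> W} = lift_arrow S.point_map ` W"
  proof (intro equalityI subsetI)
    fix g assume "g \<in> {g \<in> topspace (gtop (GL L1)). lift_arrow point_map g \<in> W}"
    then show "g \<in> lift_arrow S.point_map ` W"
      using 1[of g] by (auto simp: gcarrier_GL intro!: image_eqI[of _ _ "lift_arrow point_map g"])
  next
    fix g assume "g \<in> lift_arrow S.point_map ` W"
    then obtain k where k: "k \<in> W" "g = lift_arrow S.point_map k"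
      by blast
    then show "g \<in> {g \<in> topspace (gtop (GL L1)). lift_arrow point_map g \<in> W}"
      using 2[of k] W_GL S.lift_point_map_GL[of k] by (auto simp: gcarrier_GL)
  qed
  then show "openin (gtop (GL L1)) {g \<in> topspace (gtop (GL L1)). lift_arrow point_map g \<in> W}"
    using S.lift_point_map_open[OF W] by simp
qed

end

context diagonal_gauge_iso
begin

interpretation S: diagonal_gauge_iso L2 L1 "the_inv_into (CL L1) \<Phi>"
  by (rule swap)

lemma graded_iso_point_map: "graded_iso L1 L2 point_map S.point_map"
  by unfold_locales (use swap_point_map continuous_lift_point_map S.continuous_lift_point_map in auto)

lemma ex_graded_iso: "\<exists>a b. graded_iso L1 L2 a b"
  using graded_iso_point_map by blast

end

theorem theorem1p1:
  fixes L1 :: "('v1, 'e1, 'a1) bisystem" and L2 :: "('v2, 'e2, 'a2) bisystem"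
  assumes "lambda_graph_bisystem L1" and "lambda_graph_bisystem L2"
    and "FPCC L1" and "FPCC L2"
    and "equivalently_essentially_free L1" and "equivalently_essentially_free L2"
  shows "(\<exists>\<phi>. groupoid_iso (GL L1) (GL L2) \<phi> \<and> (\<forall>g\<in>gcarrier (GL L1). dL (\<phi> g) = dL g)) \<longleftrightarrow>
         (\<exists>\<Phi>. cstar_iso (CL L1) (CL L2) \<Phi> \<and> \<Phi> ` CX L1 = CX L2 \<and>
            (\<forall>t::real. \<forall>T\<in>CL L1. \<Phi> (gauge_action L1 t T) = gauge_action L2 t (\<Phi> T)))"
proof -
  interpret A: fpcc_bisystem L1
    using assms(1,3) by (simp add: fpcc_bisystem_def fpcc_bisystem_axioms_def)
  interpret B: fpcc_bisystem L2
    using assms(2,4) by (simp add: fpcc_bisystem_def fpcc_bisystem_axioms_def)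
  show ?thesis
  proof
    assume "\<exists>\<phi>. groupoid_iso (GL L1) (GL L2) \<phi> \<and> (\<forall>g\<in>gcarrier (GL L1). dL (\<phi> g) = dL g)"
    then obtain a b where "graded_iso L1 L2 a b"
      using graded_iso_of_groupoid_iso[OF assms(1,2)] by blast
    then interpret graded_iso L1 L2 a b .
    show "\<exists>\<Phi>. cstar_iso (CL L1) (CL L2) \<Phi> \<and> \<Phi> ` CX L1 = CX L2 \<and>
            (\<forall>t::real. \<forall>T\<in>CL L1. \<Phi> (gauge_action L1 t T) = gauge_action L2 t (\<Phi> T))"
      using cstar_iso_transport transport_CX_onto[OF B.CX_subset_CL] transport_gauge by blast
  next
    assume "\<exists>\<Phi>. cstar_iso (CL L1) (CL L2) \<Phi> \<and> \<Phi> ` CX L1 = CX L2 \<and>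
            (\<forall>t::real. \<forall>T\<in>CL L1. \<Phi> (gauge_action L1 t T) = gauge_action L2 t (\<Phi> T))"
    then obtain \<Phi> where \<Phi>: "cstar_iso (CL L1) (CL L2) \<Phi>" "\<Phi> ` CX L1 = CX L2"
      "\<And>t T. T \<in> CL L1 \<Longrightarrow> \<Phi> (gauge_action L1 t T) = gauge_action L2 t (\<Phi> T)"
      by blast
    interpret diagonal_gauge_iso L1 L2 \<Phi>
    proof
      fix t T assume T: "T \<in> CL L1"
      then have "\<Phi> T \<in> CL L2"
        using \<Phi>(1) by (auto simp: cstar_iso_def bij_betw_def)
      then show "\<Phi> (phase_conj t T) = phase_conj t (\<Phi> T)"
        using \<Phi>(3)[OF T, of t] gauge_action_eq T by metis
    qed (use \<Phi>(1,2) in \<open>auto simp: cstar_iso_def\<close>)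
    obtain a b where "graded_iso L1 L2 a b"
      using ex_graded_iso by blast
    then interpret graded_iso L1 L2 a b .
    show "\<exists>\<phi>. groupoid_iso (GL L1) (GL L2) \<phi> \<and> (\<forall>g\<in>gcarrier (GL L1). dL (\<phi> g) = dL g)"
      using groupoid_iso_lift by (intro exI[of _ "lift_arrow a"]) simp
  qed
qed

end
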